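(* Let $\mathcal{L}$ be a line arrangement consisting of $m$ lines in a general position. Let $(n_1,\dots,n_k)\in\mathbb{N}^k$ be a $k$-tuple, and let $\tilde{\mathcal{L}}=T_{(n_1,\dots,n_k)}(\mathcal{L})$. Then, in addition to the $\binom{m}{2}$ nodal points of $\mathcal{L}$, for every $1\le i\le k$, $\tilde{\mathcal{L}}$ has an $m$-tacnode of order $n_i-1$, and another singular point which is a blow down of an $m$-tacnode of order $n_1+\cdots+n_k-1$ (i.e., the curve has the following singularities: $[m_{n_1}],\dots,[m_{n_k}]$, $[m(n_1+\cdots+n_k),\,m_{n_1+\cdots+n_k}]$ and $\binom{m}{2}$ singularities of the type $[2]$). The degree of the resulting curve is $m(n_1+\cdots+n_k+1)$.
   Context: Curves are complex plane projective curves and $\mathbb{N}=\{1,2,3,\dots\}$. Lines are in a general position if there is no intersection of more than two lines in a point. Singularity types: if a singular point $P$ is resolved by a sequence of $s$ blow-ups, with only one singular point appearing at each blow-up, and $t_i>1$ ($1\le i\le s$) is the multiplicity of the curve at $P$ before the $i$-th blow-up, then $[t_1,\dots,t_s]$ is called the type of the singularity. A sequence of $r$ equal multiplicities $l$ is abbreviated $l_r$ (e.g. $[2,2,2]=[2_3]$). An $m$-tacnode is a singular point where $m$ smooth branches of the curve have a common tangent at the same point; an $m$-tacnode of order $k$ is an $m$-tacnode such that the higher derivatives of the branches are also equal up to order $k$ (the usual tacnode is a $2$-tacnode of order $1$). A blow down of an $m$-tacnode is the singular point obtained from an $m$-tacnode located on an exceptional curve when that curve is blown down. The Hirzebruch surface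 $F_n$ is the $\mathbb{P}^1$-bundle over $\mathbb{P}^1$ whose exceptional section has self-intersection $-n$. Elementary transformations: the first type ($F_n$ to $F_{n+1}$) blows up a point on the exceptional section and then blows down the proper transform of the fiber through that point. The second type ($F_n$ to $F_{n-1}$) blows up a point on a fiber $Q$, outside the exceptional section, and then blows down the proper transform of $Q$. In both cases the transformation is said to be performed on that fiber; the new fiber (the exceptional curve of the blow-up) replaces the old one and is called its proper transform. Construction of $T_{(n_1,\dots,n_k)}$ applied to a curve $C$ (here $C=\mathcal{L}$): take $k$ different lines $Q_1,\dots,Q_k$, all meeting $C$ transversally and intersecting in a point $O$ outside $C$, in such a way that, for a disk $D$ centered at $O$, the intersection points of the lines with the boundary of $D$ are organized counterclockwise. An additional line $P$ also passes through $O$ and intersects $C$ transversally. Blow up $O$ to get $F_1$. Apply $n_i$ elementary transformations of the first type on the proper transform of $Q_i$ for all $i$, reaching $F_{(\sum n_i)+1}$. Then apply $\sum n_i$ elementary transformations of the second type on the proper transform of $P$, returning to $F_1$. Finally blow down the exceptional section to get $\mathbb{P}^2$. This defines the Cremona transformation $T_{(n_1,\dots,n_k)}$; the image of $C$ is its proper transform.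
   Formalization: The first point blown up by a second-type transformation on P's fiber is assumed to lie off the curve (otherwise the degree drops below the stated one); singularity types and the full list of singular points are claimed only for m ≥ 2, since types need entries > 1. *)

theory Defs
  imports "HOL-Complex_Analysis.Complex_Analysis"
begin

section \<open>Plane projective curves\<close>

text \<open>
  A point of the complex projective plane is given by a nonzero vector of homogeneous
  coordinates, and a subset of the plane by the set of all homogeneous coordinate vectors of
  its points, that is, by a subset of \<open>- {0}\<close> closed under nonzero scalars.
\<close>

definition pt :: "complex^3 \<Rightarrow> (complex^3) set" where
  "pt z = {c *s z | c. c \<noteq> 0}"

definition pairing :: "complex^3 \<Rightarrow> complex^3 \<Rightarrow> complex" where
  "pairing a z = (\<Sum>i\<in>UNIV. a $ i * z $ i)"

definition line :: "complex^3 \<Rightarrow> (complex^3) set" where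
  "line a = {z. z \<noteq> 0 \<and> pairing a z = 0}"

definition is_line :: "(complex^3) set \<Rightarrow> bool" where
  "is_line l \<longleftrightarrow> (\<exists>a. a \<noteq> 0 \<and> l = line a)"

definition general_position :: "(complex^3) set set \<Rightarrow> bool" where
  "general_position Ls \<longleftrightarrow> (\<forall>z. card {l \<in> Ls. z \<in> l} \<le> 2)"

definition crossings :: "(complex^3) set set \<Rightarrow> (complex^3) set set" where
  "crossings Ls = {pt z | z. \<exists>l\<in>Ls. \<exists>l'\<in>Ls. l \<noteq> l' \<and> z \<in> l \<inter> l'}"

definition form :: "nat \<Rightarrow> (complex^3 \<Rightarrow> complex) \<Rightarrow> bool" where
  "form d F \<longleftrightarrow> (\<exists>c :: nat \<Rightarrow> nat \<Rightarrow> complex. \<forall>z.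
     F z = (\<Sum>i\<le>d. \<Sum>j\<le>d - i. c i j * z $ 1 ^ i * z $ 2 ^ j * z $ 3 ^ (d - i - j)))"

definition squarefree_form :: "nat \<Rightarrow> (complex^3 \<Rightarrow> complex) \<Rightarrow> bool" where
  "squarefree_form d F \<longleftrightarrow> form d F \<and> F \<noteq> (\<lambda>_. 0) \<and>
     \<not> (\<exists>e G e' H. 0 < e \<and> form e G \<and> form e' H \<and> F = (\<lambda>z. (G z)\<^sup>2 * H z))"

text \<open>\<open>F\<close> is a reduced equation of \<open>C\<close>; in particular \<open>C\<close> is a plane curve of degree \<open>d\<close>.\<close>

definition curve_equation :: "(complex^3) set \<Rightarrow> nat \<Rightarrow> (complex^3 \<Rightarrow> complex) \<Rightarrow> bool" where
  "curve_equation C d F \<longleftrightarrow> squarefree_form d F \<and> C = {z. z \<noteq> 0 \<and> F z = 0}"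

text \<open>
  Transversality at \<open>z\<close>: the differential of a reduced equation of \<open>C\<close> at \<open>z\<close> does not vanish
  along the line. This includes that \<open>C\<close> is smooth at \<open>z\<close>.
\<close>

definition meets_transversally :: "(complex^3) set \<Rightarrow> (complex^3) set \<Rightarrow> bool" where
  "meets_transversally l C \<longleftrightarrow> (\<exists>d F. curve_equation C d F \<and>
     (\<forall>z\<in>l \<inter> C. \<exists>w\<in>l. deriv (\<lambda>x. F (z + x *s w)) 0 \<noteq> 0))"


section \<open>Singularities\<close>

text \<open>
  A germ at the origin of an affine plane curve is given by a polynomial
  \<open>f \<in> \<complex>[x][y]\<close>; the inner variable is \<open>x\<close>, the outer one is \<open>y\<close>.
\<close>

type_synonym cpoly2 = "complex poly poly"

definition pX :: cpoly2 where "pX = [:[:0, 1:]:]"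
definition pY :: cpoly2 where "pY = [:0, 1:]"
definition pC :: "complex \<Rightarrow> cpoly2" where "pC c = [:[:c:]:]"

definition eval2 :: "cpoly2 \<Rightarrow> complex \<Rightarrow> complex \<Rightarrow> complex" where
  "eval2 f x y = poly (poly f [:y:]) x"

text \<open>The substitution \<open>f(a, b)\<close>.\<close>

definition subst2 :: "cpoly2 \<Rightarrow> cpoly2 \<Rightarrow> cpoly2 \<Rightarrow> cpoly2" where
  "subst2 f a b = poly (map_poly (\<lambda>c. poly (map_poly pC c) a) f) b"

text \<open>Multiplicity at the origin of the curve \<open>f = 0\<close>; only meaningful for \<open>f \<noteq> 0\<close>.\<close>

definition mult0 :: "cpoly2 \<Rightarrow> nat" where
  "mult0 f = (LEAST d. \<exists>i j. d = i + j \<and> coeff (coeff f j) i \<noteq> 0)"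

text \<open>
  The proper transform of \<open>f = 0\<close> under the blow-up of the origin, in coordinates centred at a
  point of the exceptional curve. The exceptional curve is \<open>\<complex> \<union> {\<infinity>}\<close>: \<open>Some c\<close> is the tangent
  direction \<open>y = c x\<close> and \<open>None\<close> is the direction \<open>x = 0\<close>.
  The divisions are exact.
\<close>

fun proper_transform :: "cpoly2 \<Rightarrow> complex option \<Rightarrow> cpoly2" where
  "proper_transform f (Some c) = subst2 f pX (pX * (pY + pC c)) div pX ^ mult0 f"
| "proper_transform f None = subst2 f (pX * pY) pY div pY ^ mult0 f"

text \<open>
  \<open>sing_type ts f\<close>: the origin is a singularity of type \<open>ts\<close>. Each blow-up in the list takes
  place at a singular point of multiplicity \<open>t > 1\<close>, and at most one point of its exceptional
  curve (where the rest of the list continues) is singular on the proper transform.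
\<close>

fun sing_type :: "nat list \<Rightarrow> cpoly2 \<Rightarrow> bool" where
  "sing_type [] f \<longleftrightarrow> mult0 f \<le> 1"
| "sing_type (t # ts) f \<longleftrightarrow> 1 < t \<and> mult0 f = t \<and>
     (\<exists>e. sing_type ts (proper_transform f e) \<and>
          (\<forall>e'. e' \<noteq> e \<longrightarrow> mult0 (proper_transform f e') \<le> 1))"

text \<open>
  \<open>tacnode m k f\<close>: after a linear change of coordinates the curve is, near the origin, the
  union of \<open>m\<close> graphs \<open>y = \<phi> j x\<close> of holomorphic functions whose derivatives agree
  up to order \<open>k\<close> and, for any two of them, differ in order \<open>k + 1\<close>. For \<open>k = 0\<close> this is
  an ordinary \<open>m\<close>-fold point, for \<open>k = 1\<close> and \<open>m = 2\<close> the usual tacnode.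
\<close>

definition tacnode :: "nat \<Rightarrow> nat \<Rightarrow> cpoly2 \<Rightarrow> bool" where
  "tacnode m k f \<longleftrightarrow> (\<exists>a b c d (\<phi> :: nat \<Rightarrow> complex \<Rightarrow> complex) r.
     a * d - b * c \<noteq> 0 \<and> 0 < r \<and>
     (\<forall>j<m. \<phi> j holomorphic_on ball 0 r \<and> \<phi> j 0 = 0) \<and>
     (\<forall>x y. norm x < r \<longrightarrow> norm y < r \<longrightarrow>
        (eval2 f (a * x + b * y) (c * x + d * y) = 0 \<longleftrightarrow> (\<exists>j<m. y = \<phi> j x))) \<and>
     (\<forall>i<m. \<forall>j<m. i \<noteq> j \<longrightarrow>
        (\<forall>l\<le>k. (deriv ^^ l) (\<phi> i) 0 = (deriv ^^ l) (\<phi> j) 0) \<and>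
        (deriv ^^ Suc k) (\<phi> i) 0 \<noteq> (deriv ^^ Suc k) (\<phi> j) 0))"

text \<open>
  A blow-down of an \<open>m\<close>-tacnode of order \<open>k\<close>: the proper transform under the blow-up of the
  origin meets the exceptional curve in exactly one point and has an \<open>m\<close>-tacnode of order \<open>k\<close>
  there. Multiplicity \<open>0\<close> means that the point is not on the curve.
\<close>

definition blow_down_tacnode :: "nat \<Rightarrow> nat \<Rightarrow> cpoly2 \<Rightarrow> bool" where
  "blow_down_tacnode m k f \<longleftrightarrow> (\<exists>e. tacnode m k (proper_transform f e) \<and>
     (\<forall>e'. e' \<noteq> e \<longrightarrow> mult0 (proper_transform f e') = 0))"

text \<open>
  \<open>f\<close> is the equation \<open>F = 0\<close> written in affine coordinates of the plane centred at the point
  \<open>p\<close>, and \<open>has_at F p S\<close> says that the germ of \<open>F = 0\<close> at \<open>p\<close> has the property \<open>S\<close>.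
\<close>

definition local_equation :: "(complex^3 \<Rightarrow> complex) \<Rightarrow> (complex^3) set \<Rightarrow> cpoly2 \<Rightarrow> bool" where
  "local_equation F p f \<longleftrightarrow> (\<exists>z w w'. p = pt z \<and> det (vector [z, w, w'] :: complex^3^3) \<noteq> 0 \<and>
     (\<forall>x y. F (z + x *s w + y *s w') = eval2 f x y))"

definition has_at :: "(complex^3 \<Rightarrow> complex) \<Rightarrow> (complex^3) set \<Rightarrow> (cpoly2 \<Rightarrow> bool) \<Rightarrow> bool" where
  "has_at F p S \<longleftrightarrow> (\<exists>f. local_equation F p f \<and> S f)"

definition singular_points :: "(complex^3 \<Rightarrow> complex) \<Rightarrow> (complex^3) set set" where
  "singular_points F = {p. has_at F p (\<lambda>f. 1 < mult0 f)}"


section \<open>Hirzebruch surfaces and elementary transformations\<close>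

text \<open>
  The Hirzebruch surface \<open>F\<^sub>n\<close> is the quotient of the set \<open>hcarrier\<close> of all \<open>(s,t,u,v)\<close> with
  \<open>(s,t) \<noteq> 0\<close> and \<open>(u,v) \<noteq> 0\<close> by the action of pairs \<open>(c,e)\<close> of nonzero scalars,
    \<open>(s,t,u,v) \<mapsto> (c s, c t, e c^n u, e v)\<close>.
  The bundle map to the projective line is \<open>(s,t,u,v) \<mapsto> [s:t]\<close>, and \<open>v = 0\<close> is the
  exceptional section, of self-intersection \<open>-n\<close>. Subsets of \<open>F\<^sub>n\<close> are represented by their
  preimages in \<open>hcarrier\<close>; \<open>hsat n S\<close> is the set of all coordinates of the points of
  \<open>F\<^sub>n\<close> that have coordinates in \<open>S\<close>. As quotient maps by group actions are open, closures may
  be formed in \<open>hcarrier\<close>.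
\<close>

type_synonym hcoords = "complex \<times> complex \<times> complex \<times> complex"

definition hcarrier :: "hcoords set" where
  "hcarrier = {(s, t, u, v). (s, t) \<noteq> (0, 0) \<and> (u, v) \<noteq> (0, 0)}"

definition hsat :: "nat \<Rightarrow> hcoords set \<Rightarrow> hcoords set" where
  "hsat n S = {(c * s, c * t, e * c ^ n * u, e * v) | c e s t u v.
     c \<noteq> 0 \<and> e \<noteq> 0 \<and> (s, t, u, v) \<in> S}"

text \<open>
  The blow-up of the point with equations \<open>l = h = 0\<close>, where \<open>l\<close> is a linear form in \<open>s, t\<close>
  (so \<open>l = 0\<close> is a fiber) and \<open>h\<close> is the equation of a section: the surface
  \<open>a h = b l\<close> with \<open>[a:b]\<close> in the projective line.
\<close>

definition hblowup :: "(complex \<Rightarrow> complex \<Rightarrow> complex) \<Rightarrow> (hcoords \<Rightarrow> complex)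
    \<Rightarrow> (hcoords \<times> complex \<times> complex) set" where
  "hblowup l h = {((s, t, u, v), (a, b)) | s t u v a b.
     (s, t, u, v) \<in> hcarrier \<and> (a, b) \<noteq> (0, 0) \<and> a * h (s, t, u, v) = b * l s t}"

definition hproper :: "(complex \<Rightarrow> complex \<Rightarrow> complex) \<Rightarrow> (hcoords \<Rightarrow> complex)
    \<Rightarrow> hcoords set \<Rightarrow> (hcoords \<times> complex \<times> complex) set" where
  "hproper l h C = hblowup l h \<inter> closure {((s, t, u, v), (a, b)) | s t u v a b.
     ((s, t, u, v), (a, b)) \<in> hblowup l h \<and> (s, t, u, v) \<in> C \<and>
     \<not> (l s t = 0 \<and> h (s, t, u, v) = 0)}"

text \<open>
  First type, \<open>F\<^sub>n\<close> to \<open>F\<^sub>n\<^sub>+\<^sub>1\<close> on the fiber \<open>l = 0\<close>. The blown-up point is \<open>l = v = 0\<close>. The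
  morphism \<open>(s,t,a u,b)\<close> from the blow-up to \<open>F\<^sub>n\<^sub>+\<^sub>1\<close> contracts the proper transform of the
  fiber, which is \<open>l = a = 0\<close>, to the point \<open>l = u = 0\<close>, and it is an isomorphism elsewhere.
\<close>

definition elem_first :: "nat \<Rightarrow> (complex \<Rightarrow> complex \<Rightarrow> complex) \<Rightarrow> hcoords set \<Rightarrow> hcoords set" where
  "elem_first n l C = hsat (n + 1)
     ((\<lambda>((s, t, u, v), (a, b)). (s, t, a * u, b)) ` hproper l (\<lambda>(s, t, u, v). v) C)"

text \<open>
  Second type, \<open>F\<^sub>n\<close> to \<open>F\<^sub>n\<^sub>-\<^sub>1\<close> on the fiber \<open>l = 0\<close>. The blown-up point is \<open>l = 0\<close>,
  \<open>u = g(s,t) v\<close> with a binary form \<open>g\<close> of degree \<open>n\<close>; every point of the fiber outside the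
  exceptional section is of this kind, and another \<open>g\<close> with the same value on the fiber only
  changes the result by an automorphism of \<open>F\<^sub>n\<^sub>-\<^sub>1\<close>. The morphism \<open>(s,t,b,a v)\<close> contracts the
  proper transform \<open>l = a = 0\<close> of the fiber to the point \<open>l = v = 0\<close>.
\<close>

definition elem_second :: "nat \<Rightarrow> (complex \<Rightarrow> complex \<Rightarrow> complex)
    \<Rightarrow> (complex \<Rightarrow> complex \<Rightarrow> complex) \<Rightarrow> hcoords set \<Rightarrow> hcoords set" where
  "elem_second n l g C = hsat (n - 1)
     ((\<lambda>((s, t, u, v), (a, b)). (s, t, b, a * v)) ` hproper l (\<lambda>(s, t, u, v). u - g s t * v) C)"

definition binary_form :: "nat \<Rightarrow> (complex \<Rightarrow> complex \<Rightarrow> complex) \<Rightarrow> bool" where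
  "binary_form d g \<longleftrightarrow> (\<exists>c :: nat \<Rightarrow> complex. \<forall>s t. g s t = (\<Sum>i\<le>d. c i * s ^ i * t ^ (d - i)))"

text \<open>
  For a basis \<open>A, B, R\<close> of \<open>\<complex>\<^sup>3\<close>, the map \<open>to_plane A B R\<close> identifies \<open>F\<^sub>1\<close> with the blow-up of
  the plane at \<open>[R]\<close>: the exceptional section \<open>v = 0\<close> goes to \<open>[R]\<close>, and the fiber over \<open>[s:t]\<close>
  goes to the line through \<open>[R]\<close> and \<open>[s A + t B]\<close>.
\<close>

definition to_plane :: "complex^3 \<Rightarrow> complex^3 \<Rightarrow> complex^3 \<Rightarrow> hcoords \<Rightarrow> complex^3" where
  "to_plane A B R = (\<lambda>(s, t, u, v). (v * s) *s A + (v * t) *s B + u *s R)"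

definition plane_blow_up :: "complex^3 \<Rightarrow> complex^3 \<Rightarrow> complex^3 \<Rightarrow> (complex^3) set \<Rightarrow> hcoords set" where
  "plane_blow_up A B R C = hcarrier \<inter>
     closure {(s, t, u, v). (s, t, u, v) \<in> hcarrier \<and> v \<noteq> 0 \<and> to_plane A B R (s, t, u, v) \<in> C}"

definition plane_blow_down :: "hcoords set \<Rightarrow> (complex^3) set" where
  "plane_blow_down C = to_plane (axis 1 1) (axis 2 1) (axis 3 1) ` C"

text \<open>The equation in \<open>s, t\<close> of the fiber that corresponds to a line \<open>line a\<close> through \<open>[R]\<close>.\<close>

definition fiber_eq :: "complex^3 \<Rightarrow> complex^3 \<Rightarrow> complex^3 \<Rightarrow> complex \<Rightarrow> complex \<Rightarrow> complex" where
  "fiber_eq A B a s t = pairing a (s *s A + t *s B)"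


section \<open>The Cremona transformation\<close>

primrec first_steps :: "nat \<Rightarrow> (complex \<Rightarrow> complex \<Rightarrow> complex) list \<Rightarrow> hcoords set \<Rightarrow> hcoords set" where
  "first_steps n [] C = C"
| "first_steps n (l # ls) C = first_steps (n + 1) ls (elem_first n l C)"

primrec second_steps :: "nat \<Rightarrow> (complex \<Rightarrow> complex \<Rightarrow> complex)
    \<Rightarrow> (complex \<Rightarrow> complex \<Rightarrow> complex) list \<Rightarrow> hcoords set \<Rightarrow> hcoords set" where
  "second_steps n l [] C = C"
| "second_steps n l (g # gs) C = second_steps (n - 1) l gs (elem_second n l g C)"

text \<open>
  \<open>to_top\<close> is the part of the construction from the plane to \<open>F\<^sub>N\<^sub>+\<^sub>1\<close>, where \<open>N\<close> is the sum of
  the \<open>n i\<close>. The transformations of the second type depend on the choice of the blown-up points,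
  given by \<open>g 0, \<dots>, g (N - 1)\<close>; \<open>g j\<close> is used on \<open>F\<^sub>N\<^sub>+\<^sub>1\<^sub>-\<^sub>j\<close>. Indices run over \<open>{..<k}\<close>.
\<close>

definition to_top :: "complex^3 \<Rightarrow> complex^3 \<Rightarrow> complex^3 \<Rightarrow> nat \<Rightarrow> (nat \<Rightarrow> nat)
    \<Rightarrow> (nat \<Rightarrow> complex^3) \<Rightarrow> (complex^3) set \<Rightarrow> hcoords set" where
  "to_top A B R k n Q C =
     first_steps 1 (concat (map (\<lambda>i. replicate (n i) (fiber_eq A B (Q i))) [0..<k]))
       (plane_blow_up A B R C)"

definition cremona_T :: "complex^3 \<Rightarrow> complex^3 \<Rightarrow> complex^3 \<Rightarrow> nat \<Rightarrow> (nat \<Rightarrow> nat)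
    \<Rightarrow> (nat \<Rightarrow> complex^3) \<Rightarrow> complex^3 \<Rightarrow> (nat \<Rightarrow> complex \<Rightarrow> complex \<Rightarrow> complex)
    \<Rightarrow> (complex^3) set \<Rightarrow> (complex^3) set" where
  "cremona_T A B R k n Q P g C =
     plane_blow_down
       (second_steps ((\<Sum>i<k. n i) + 1) (fiber_eq A B P) (map g [0..<(\<Sum>i<k. n i)])
         (to_top A B R k n Q C))"

end

theory Submission
  imports Defs "HOL-Computational_Algebra.Fundamental_Theorem_Algebra"
begin

text \<open>
  In coordinates in which the base point of the pencil is \<open>[0:0:1]\<close>, the \<open>j\<close>-th line is the section
  \<open>u = h\<^sub>j(s,t) v\<close> of \<open>F\<^sub>1\<close> with \<open>h\<^sub>j\<close> linear. An elementary transformation of the first type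
  multiplies the right-hand side by the equation of the fiber, and one of the second type replaces
  \<open>l\<^sup>e u = G v\<close> by \<open>l\<^sup>e\<^sup>+\<^sup>1 u = (G - l\<^sup>e g) v\<close>. Hence the final curve is
  \<open>\<Prod>\<^sub>j (p\<^sup>N w - H h\<^sub>j + K) = 0\<close>, where \<open>p\<close> is the equation of \<open>P\<close>,
  \<open>H = \<Prod>\<^sub>i l\<^sub>i\<^sup>n\<^sup>i\<close> for the equations \<open>l\<^sub>i\<close> of the \<open>Q\<^sub>i\<close>, and \<open>K\<close> does not depend on \<open>j\<close>.
  Away from \<open>p = 0\<close> the branches are graphs, and two of them differ by
  \<open>H (h\<^sub>i - h\<^sub>j) / p\<^sup>N\<close>: they meet to order \<open>n\<^sub>i\<close> over \<open>Q\<^sub>i\<close> and simply over the old nodes. Over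
  \<open>[0:0:1]\<close> one blow-up turns \<open>p\<^sup>N - G\<^sub>j\<close> into \<open>x\<^sup>N - y G\<^sub>j\<close>, which again is a family of graphs,
  pairwise tangent to order \<open>N\<close>.
\<close>

section \<open>Binary and ternary forms\<close>

text \<open>The images are defined through closures, so additional limit points are the main danger.
  They do not occur: each set involved is relatively closed in \<open>hcarrier\<close> and misses
  the point that is blown up, so its proper transform is its full preimage. For the first type this
  is automatic, because a section \<open>u = G v\<close> never meets \<open>v = 0\<close>. For the
  second type it is what \<open>centre\<close> asserts, and asking it of the first step suffices:
  afterwards all branches meet the fiber of \<open>P\<close> only on the exceptional section, while
  the later blown-up points lie outside that section. The same fact brings all \<open>m\<close>
  branches together at the vertex. Transversality enters as the statement that no crossing lies on a
  \<open>Q i\<close> or on \<open>P\<close>; this makes the contact orders exact. Squarefreeness and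
  completeness of the list of singular points rest on a single derivative, the one towards
  \<open>[0:0:1]\<close>: in that direction each of the \<open>m\<close> factors is linear, so a
  point where the derivative vanishes lies on two branches or is the vertex.\<close>

lemma binary_form_monomial: "binary_form (i + j) (\<lambda>s t. c * s ^ i * t ^ j)"
proof -
  have "c * s ^ i * t ^ j = (\<Sum>a\<le>i + j. (if a = i then c else 0) * s ^ a * t ^ (i + j - a))" for s t
  proof -
    have "(\<Sum>a\<le>i + j. (if a = i then c else 0) * s ^ a * t ^ (i + j - a))
        = (\<Sum>a\<le>i + j. if a = i then c * s ^ i * t ^ j else 0)"
      by (intro sum.cong) auto
    then show ?thesis by simp
  qed
  then show ?thesis unfolding binary_form_def by (intro exI[of _ "\<lambda>a. if a = i then c else 0"]) simp
qed

lemma binary_form_add: "binary_form d f \<Longrightarrow> binary_form d g \<Longrightarrow> binary_form d (\<lambda>s t. f s t + g s t)"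
  unfolding binary_form_def
proof (elim exE)
  fix a b :: "nat \<Rightarrow> complex"
  assume "\<forall>s t. f s t = (\<Sum>i\<le>d. a i * s ^ i * t ^ (d - i))" "\<forall>s t. g s t = (\<Sum>i\<le>d. b i * s ^ i * t ^ (d - i))"
  then show "\<exists>c. \<forall>s t. f s t + g s t = (\<Sum>i\<le>d. c i * s ^ i * t ^ (d - i))"
    by (intro exI[of _ "\<lambda>i. a i + b i"]) (simp add: sum.distrib algebra_simps)
qed

lemma binary_form_cmult: "binary_form d f \<Longrightarrow> binary_form d (\<lambda>s t. c * f s t)"
  unfolding binary_form_def
proof (elim exE)
  fix a :: "nat \<Rightarrow> complex"
  assume "\<forall>s t. f s t = (\<Sum>i\<le>d. a i * s ^ i * t ^ (d - i))"
  then show "\<exists>b. \<forall>s t. c * f s t = (\<Sum>i\<le>d. b i * s ^ i * t ^ (d - i))"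
    by (intro exI[of _ "\<lambda>i. c * a i"]) (simp add: sum_distrib_left algebra_simps)
qed

lemma binary_form_diff: "binary_form d f \<Longrightarrow> binary_form d g \<Longrightarrow> binary_form d (\<lambda>s t. f s t - g s t)"
  using binary_form_add[OF _ binary_form_cmult[of d g "-1"]] by simp

lemma binary_form_sum:
  "finite I \<Longrightarrow> (\<And>i. i \<in> I \<Longrightarrow> binary_form d (f i)) \<Longrightarrow> binary_form d (\<lambda>s t. \<Sum>i\<in>I. f i s t)"
proof (induction I rule: finite_induct)
  case empty
  then show ?case unfolding binary_form_def by (intro exI[of _ "\<lambda>i. 0"]) simp
next
  case (insert x I)
  then show ?case by (simp add: binary_form_add)
qed

lemma binary_form_mult:
  assumes "binary_form d f" "binary_form e g"
  shows "binary_form (d + e) (\<lambda>s t. f s t * g s t)"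
proof -
  obtain a where a: "\<And>s t. f s t = (\<Sum>i\<le>d. a i * s ^ i * t ^ (d - i))"
    using assms(1) unfolding binary_form_def by auto
  obtain b where b: "\<And>s t. g s t = (\<Sum>i\<le>e. b i * s ^ i * t ^ (e - i))"
    using assms(2) unfolding binary_form_def by auto
  have "binary_form (d + e) (\<lambda>s t. \<Sum>i\<le>d. \<Sum>j\<le>e. a i * b j * s ^ (i + j) * t ^ (d - i + (e - j)))"
  proof (intro binary_form_sum finite_atMost)
    fix i j assume "i \<in> {..d}" "j \<in> {..e}"
    then have "d + e = (i + j) + (d - i + (e - j))" by auto
    then show "binary_form (d + e) (\<lambda>s t. a i * b j * s ^ (i + j) * t ^ (d - i + (e - j)))"
      using binary_form_monomial[of "i + j" "d - i + (e - j)" "a i * b j"] by (simp only:)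
  qed
  moreover have "(\<lambda>s t. f s t * g s t)
      = (\<lambda>s t. \<Sum>i\<le>d. \<Sum>j\<le>e. a i * b j * s ^ (i + j) * t ^ (d - i + (e - j)))"
    unfolding a b sum_product by (intro ext sum.cong refl) (simp only: power_add mult_ac)
  ultimately show ?thesis by simp
qed

lemma binary_form_const: "binary_form 0 (\<lambda>s t. c)"
  using binary_form_monomial[of 0 0 c] by simp

lemma binary_form_linear: "binary_form 1 (\<lambda>s t. a * s + b * t)"
  using binary_form_add[of 1 "\<lambda>s t. a * s" "\<lambda>s t. b * t"] binary_form_monomial[of 1 0 a] binary_form_monomial[of 0 1 b]
  by simp

lemma binary_form_power: "binary_form d f \<Longrightarrow> binary_form (d * e) (\<lambda>s t. f s t ^ e)"
proof (induction e)
  case 0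
  then show ?case by (simp add: binary_form_const)
next
  case (Suc e)
  then show ?case using binary_form_mult[of d f "d * e" "\<lambda>s t. f s t ^ e"] by simp
qed

lemma binary_form_prod:
  "finite I \<Longrightarrow> (\<And>i. i \<in> I \<Longrightarrow> binary_form (d i) (f i)) \<Longrightarrow>
    binary_form (\<Sum>i\<in>I. d i) (\<lambda>s t. \<Prod>i\<in>I. f i s t)"
  by (induction I rule: finite_induct) (simp_all add: binary_form_const binary_form_mult)

lemma binary_form_homogeneous:
  assumes "binary_form d g" shows "g (c * s) (c * t) = c ^ d * g s t"
proof -
  obtain a where a: "\<And>s t. g s t = (\<Sum>i\<le>d. a i * s ^ i * t ^ (d - i))"
    using assms unfolding binary_form_def by auto
  have "a i * (c * s) ^ i * (c * t) ^ (d - i) = c ^ d * (a i * s ^ i * t ^ (d - i))" if "i \<le> d" for i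
  proof -
    have "c ^ d = c ^ i * c ^ (d - i)" using that by (simp flip: power_add)
    then show ?thesis by (simp add: power_mult_distrib)
  qed
  then show ?thesis unfolding a sum_distrib_left by (intro sum.cong) auto
qed

lemma binary_form_continuous:
  assumes "binary_form d g" shows "continuous_on S (\<lambda>x. g (fst x) (snd x))"
proof -
  obtain a where a: "\<And>s t. g s t = (\<Sum>i\<le>d. a i * s ^ i * t ^ (d - i))"
    using assms unfolding binary_form_def by auto
  show ?thesis unfolding a by (intro continuous_intros)
qed

section \<open>Ternary forms, and forms restricted to lines\<close>

lemma form_monomial: "form (a + b + e) (\<lambda>z. c * z $ 1 ^ a * z $ 2 ^ b * z $ 3 ^ e)"
proof -
  let ?c = "\<lambda>i j. if i = a then if j = b then c else 0 else 0"
  have "c * z $ 1 ^ a * z $ 2 ^ b * z $ 3 ^ e = (\<Sum>i\<le>a + b + e. \<Sum>j\<le>a + b + e - i.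
      ?c i j * z $ 1 ^ i * z $ 2 ^ j * z $ 3 ^ (a + b + e - i - j))" (is "?l = ?r") for z :: "complex^3"
  proof -
    have "(\<Sum>j\<le>a + b + e - i. ?c i j * z $ 1 ^ i * z $ 2 ^ j * z $ 3 ^ (a + b + e - i - j))
        = (if i = a then c * z $ 1 ^ a * z $ 2 ^ b * z $ 3 ^ e else 0)" for i
    proof (cases "i = a")
      case True
      then have "(\<Sum>j\<le>a + b + e - i. ?c i j * z $ 1 ^ i * z $ 2 ^ j * z $ 3 ^ (a + b + e - i - j))
          = (\<Sum>j\<le>b + e. if j = b then c * z $ 1 ^ a * z $ 2 ^ b * z $ 3 ^ e else 0)"
        by (intro sum.cong) auto
      then show ?thesis using True by simp
    qed simp
    then have "?r = ?l" by simp
    then show ?thesis by simp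
  qed
  then show ?thesis unfolding form_def by (intro exI[of _ ?c]) simp
qed

lemma form_add: "form d f \<Longrightarrow> form d g \<Longrightarrow> form d (\<lambda>z. f z + g z)"
  unfolding form_def
proof (elim exE)
  fix a b :: "nat \<Rightarrow> nat \<Rightarrow> complex"
  assume "\<forall>z. f z = (\<Sum>i\<le>d. \<Sum>j\<le>d - i. a i j * z $ 1 ^ i * z $ 2 ^ j * z $ 3 ^ (d - i - j))"
    "\<forall>z. g z = (\<Sum>i\<le>d. \<Sum>j\<le>d - i. b i j * z $ 1 ^ i * z $ 2 ^ j * z $ 3 ^ (d - i - j))"
  then show "\<exists>c. \<forall>z. f z + g z = (\<Sum>i\<le>d. \<Sum>j\<le>d - i. c i j * z $ 1 ^ i * z $ 2 ^ j * z $ 3 ^ (d - i - j))"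
    by (intro exI[of _ "\<lambda>i j. a i j + b i j"]) (simp add: sum.distrib algebra_simps)
qed

lemma form_sum:
  "finite I \<Longrightarrow> (\<And>i. i \<in> I \<Longrightarrow> form d (f i)) \<Longrightarrow> form d (\<lambda>z. \<Sum>i\<in>I. f i z)"
proof (induction I rule: finite_induct)
  case empty
  then show ?case unfolding form_def by (intro exI[of _ "\<lambda>i j. 0"]) simp
next
  case (insert x I)
  then show ?case by (simp add: form_add)
qed

lemma form_mult:
  assumes "form d f" "form e g"
  shows "form (d + e) (\<lambda>z. f z * g z)"
proof -
  obtain a where a: "\<And>z. f z = (\<Sum>i\<le>d. \<Sum>j\<le>d - i. a i j * z $ 1 ^ i * z $ 2 ^ j * z $ 3 ^ (d - i - j))"
    using assms(1) unfolding form_def by auto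
  obtain b where b: "\<And>z. g z = (\<Sum>i\<le>e. \<Sum>j\<le>e - i. b i j * z $ 1 ^ i * z $ 2 ^ j * z $ 3 ^ (e - i - j))"
    using assms(2) unfolding form_def by auto
  have "form (d + e) (\<lambda>z. \<Sum>i\<le>d. \<Sum>i'\<le>e. \<Sum>j\<le>d - i. \<Sum>j'\<le>e - i'.
      a i j * b i' j' * z $ 1 ^ (i + i') * z $ 2 ^ (j + j') * z $ 3 ^ (d - i - j + (e - i' - j')))"
  proof (intro form_sum finite_atMost)
    fix i i' j j' assume "i \<in> {..d}" "j \<in> {..d - i}" "i' \<in> {..e}" "j' \<in> {..e - i'}"
    then have "d + e = (i + i') + (j + j') + (d - i - j + (e - i' - j'))" by auto
    then show "form (d + e) (\<lambda>z. a i j * b i' j' * z $ 1 ^ (i + i') * z $ 2 ^ (j + j')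
        * z $ 3 ^ (d - i - j + (e - i' - j')))"
      using form_monomial[of "i + i'" "j + j'" "d - i - j + (e - i' - j')" "a i j * b i' j'"] by (simp only:)
  qed
  moreover have "(\<lambda>z. f z * g z) = (\<lambda>z. \<Sum>i\<le>d. \<Sum>i'\<le>e. \<Sum>j\<le>d - i. \<Sum>j'\<le>e - i'.
      a i j * b i' j' * z $ 1 ^ (i + i') * z $ 2 ^ (j + j') * z $ 3 ^ (d - i - j + (e - i' - j')))"
    unfolding a b sum_product by (intro ext sum.cong refl) (simp only: power_add mult_ac)
  ultimately show ?thesis by simp
qed

lemma form_prod:
  assumes "finite I" "\<And>i. i \<in> I \<Longrightarrow> form d (f i)"
  shows "form (card I * d) (\<lambda>z. \<Prod>i\<in>I. f i z)"
  using assms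
proof (induction I rule: finite_induct)
  case empty
  then show ?case using form_monomial[of 0 0 0 1] by simp
next
  case (insert x I)
  then show ?case using form_mult[of d "f x" "card I * d"] by simp
qed

lemma form_binary:
  assumes "binary_form d g" shows "form d (\<lambda>z. g (z $ 1) (z $ 2))"
proof -
  obtain a where a: "\<And>s t. g s t = (\<Sum>i\<le>d. a i * s ^ i * t ^ (d - i))"
    using assms unfolding binary_form_def by auto
  have "form d (\<lambda>z. a i * z $ 1 ^ i * z $ 2 ^ (d - i))" if "i \<le> d" for i
    using form_monomial[of i "d - i" 0 "a i"] that by simp
  then show ?thesis unfolding a by (intro form_sum) auto
qed

lemma form_homogeneous:
  assumes "form d F" shows "F (c *s z) = c ^ d * F z"
proof -
  obtain a where a: "\<And>z. F z = (\<Sum>i\<le>d. \<Sum>j\<le>d - i. a i j * z $ 1 ^ i * z $ 2 ^ j * z $ 3 ^ (d - i - j))"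
    using assms unfolding form_def by auto
  have "a i j * (c * z $ 1) ^ i * (c * z $ 2) ^ j * (c * z $ 3) ^ (d - i - j)
      = c ^ d * (a i j * z $ 1 ^ i * z $ 2 ^ j * z $ 3 ^ (d - i - j))" if "i \<le> d" "j \<le> d - i" for i j
  proof -
    have "c ^ d = c ^ i * c ^ j * c ^ (d - i - j)" using that by (simp flip: power_add)
    then show ?thesis by (simp add: power_mult_distrib)
  qed
  then show ?thesis unfolding a sum_distrib_left by (intro sum.cong) auto
qed

lemma poly_form_on_line:
  assumes "form d F" shows "\<exists>p. \<forall>x. F (z + x *s w) = poly p x"
proof -
  obtain a where a: "\<And>z. F z = (\<Sum>i\<le>d. \<Sum>j\<le>d - i. a i j * z $ 1 ^ i * z $ 2 ^ j * z $ 3 ^ (d - i - j))"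
    using assms unfolding form_def by auto
  show ?thesis unfolding a
    by (intro exI[of _ "\<Sum>i\<le>d. \<Sum>j\<le>d - i. [:a i j:] * [:z $ 1, w $ 1:] ^ i * [:z $ 2, w $ 2:] ^ j
        * [:z $ 3, w $ 3:] ^ (d - i - j)"]) (simp add: poly_sum mult.assoc)
qed

lemma poly_binary_form:
  assumes "binary_form d g" shows "\<exists>p. \<forall>x. poly p x = g (poly a x) (poly b x)"
proof -
  obtain c where c: "\<And>s t. g s t = (\<Sum>i\<le>d. c i * s ^ i * t ^ (d - i))"
    using assms unfolding binary_form_def by auto
  show ?thesis unfolding c
    by (intro exI[of _ "\<Sum>i\<le>d. [:c i:] * a ^ i * b ^ (d - i)"]) (simp add: poly_sum mult.assoc)
qed

section \<open>Polynomial germs\<close>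

lemma eval2_simps [simp]:
  "eval2 0 x y = 0" "eval2 1 x y = 1" "eval2 pX x y = x" "eval2 pY x y = y" "eval2 (pC c) x y = c"
  "eval2 (f + g) x y = eval2 f x y + eval2 g x y" "eval2 (f - g) x y = eval2 f x y - eval2 g x y"
  "eval2 (- f) x y = - eval2 f x y"
  "eval2 (f * g) x y = eval2 f x y * eval2 g x y" "eval2 (f ^ n) x y = eval2 f x y ^ n"
  "eval2 (pCons p f) x y = poly p x + y * eval2 f x y"
  by (simp_all add: eval2_def pX_def pY_def pC_def)

lemma eval2_sum [simp]: "eval2 (\<Sum>i\<in>I. f i) x y = (\<Sum>i\<in>I. eval2 (f i) x y)"
  by (induction I rule: infinite_finite_induct) simp_all

lemma eval2_prod [simp]: "eval2 (\<Prod>i\<in>I. f i) x y = (\<Prod>i\<in>I. eval2 (f i) x y)"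
  by (induction I rule: infinite_finite_induct) simp_all

text \<open>A nonzero polynomial over the domain \<open>complex poly\<close> has finitely many
  roots, whereas agreement at all points makes every constant \<open>[:y:]\<close> a root of
  \<open>f - g\<close>. Identities between germs are proved below by evaluating both sides.\<close>

lemma eval2_eqI:
  assumes "\<And>x y. eval2 f x y = eval2 g x y" shows "f = g"
proof (rule ccontr)
  assume "f \<noteq> g"
  then have "finite {y. poly (f - g) y = 0}" by (intro poly_roots_finite) simp
  moreover have "range (\<lambda>y. [:y:]) \<subseteq> {y. poly (f - g) y = 0}"
  proof clarify
    fix y
    have "poly (poly f [:y:]) = poly (poly g [:y:])" using assms by (auto simp: eval2_def)
    then show "poly (f - g) [:y:] = 0" by (simp add: poly_eq_poly_eq_iff)
  qed
  ultimately have "finite (range (\<lambda>y::complex. [:y:]))" by (rule rev_finite_subset)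
  then have "finite (UNIV :: complex set)" by (rule finite_imageD) (auto intro: injI)
  then show False by (simp add: infinite_UNIV_char_0)
qed

lemma eval2_binary_form:
  assumes "binary_form d g" shows "\<exists>f. \<forall>x y. eval2 f x y = g (eval2 a x y) (eval2 b x y)"
proof -
  obtain c where c: "\<And>s t. g s t = (\<Sum>i\<le>d. c i * s ^ i * t ^ (d - i))"
    using assms unfolding binary_form_def by auto
  show ?thesis unfolding c
    by (intro exI[of _ "\<Sum>i\<le>d. pC (c i) * a ^ i * b ^ (d - i)"]) simp
qed

lemma eval2_form:
  assumes "form d F" shows "\<exists>f. \<forall>x y. F (z + x *s w + y *s w') = eval2 f x y"
proof -
  obtain a where a: "\<And>z. F z = (\<Sum>i\<le>d. \<Sum>j\<le>d - i. a i j * z $ 1 ^ i * z $ 2 ^ j * z $ 3 ^ (d - i - j))"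
    using assms unfolding form_def by auto
  let ?l = "\<lambda>i. pC (z $ i) + pX * pC (w $ i) + pY * pC (w' $ i)"
  show ?thesis unfolding a
    by (intro exI[of _ "\<Sum>i\<le>d. \<Sum>j\<le>d - i. pC (a i j) * ?l 1 ^ i * ?l 2 ^ j * ?l 3 ^ (d - i - j)"]) simp
qed

lemma subst2_pCons: "subst2 (pCons p f) a b = poly (map_poly pC p) a + b * subst2 f a b"
  by (simp add: subst2_def map_poly_pCons)

lemma subst2_0 [simp]: "subst2 0 a b = 0"
  by (simp add: subst2_def)

lemma pC_0 [simp]: "pC 0 = 0"
  by (simp add: pC_def)

lemma eval2_poly_pC: "eval2 (poly (map_poly pC p) a) x y = poly p (eval2 a x y)"
  by (induction p) (simp_all add: map_poly_pCons)

lemma eval2_subst2 [simp]: "eval2 (subst2 f a b) x y = eval2 f (eval2 a x y) (eval2 b x y)"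
  by (induction f) (simp_all add: subst2_pCons eval2_poly_pC)

lemma coeff_pY_mult: "coeff (pY * f) d = (if d = 0 then 0 else coeff f (d - 1))"
  by (cases d) (simp_all add: pY_def)

lemma coeff_pX_mult: "coeff (coeff (pX * f) d) i = (if i = 0 then 0 else coeff (coeff f d) (i - 1))"
  by (cases i) (simp_all add: pX_def)

lemma coeff_poly_pC_blow_up:
  "coeff (coeff (poly (map_poly pC p) (pX * pY)) d) i = (if i = d then coeff p i else 0)"
proof (induction p arbitrary: d i)
  case 0
  then show ?case by simp
next
  case (pCons a p)
  have [simp]: "coeff (coeff (pC a) d) i = (if i = 0 \<and> d = 0 then a else 0)" for d i
    by (cases d; cases i) (simp_all add: pC_def)
  show ?case
    by (cases d; cases i)
      (simp_all add: map_poly_pCons mult.assoc coeff_pX_mult coeff_pY_mult pCons.IH)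
qed

text \<open>The substitution relabels monomials injectively, so nothing cancels and the coefficients
  of \<open>f\<close> are only moved.\<close>

lemma coeff_subst2_blow_up:
  "coeff (coeff (subst2 f (pX * pY) pY) d) i = (if i \<le> d then coeff (coeff f (d - i)) i else 0)"
proof (induction f arbitrary: d)
  case 0
  then show ?case by simp
next
  case (pCons p f)
  have "coeff (coeff (pY * subst2 f (pX * pY) pY) d) i = (if i < d then coeff (coeff f (d - 1 - i)) i else 0)"
    using pCons.IH by (auto simp: coeff_pY_mult)
  moreover have "d - i = Suc (d - 1 - i)" if "i < d" using that by simp
  ultimately show ?case
    by (cases "i < d") (auto simp: subst2_pCons coeff_poly_pC_blow_up)
qed

lemma mult0_eq_0: assumes "eval2 f 0 0 \<noteq> 0" shows "mult0 f = 0"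
proof -
  have "coeff (coeff f 0) 0 \<noteq> 0" using assms by (simp add: eval2_def poly_0_coeff_0)
  then show ?thesis unfolding mult0_def by (intro Least_eq_0) auto
qed

text \<open>
  The monomial \<open>x\<^sup>i y\<^sup>j\<close> of \<open>f\<close> becomes \<open>x\<^sup>i y\<^sup>i\<^sup>+\<^sup>j\<close> in \<open>f(xy, y)\<close>, so the multiplicity is the order in
  \<open>y\<close> of the latter. This makes multiplicities of products computable.
\<close>

lemma mult0_eqI:
  assumes eq: "subst2 f (pX * pY) pY = pY ^ d * g" and g: "eval2 g x 0 \<noteq> 0"
  shows "mult0 f = d"
proof -
  have "pY ^ d = monom 1 d" by (simp add: pY_def monom_altdef)
  then have c: "coeff (subst2 f (pX * pY) pY) e = (if e < d then 0 else coeff g (e - d))" for e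
    by (simp add: eq coeff_monom_mult)
  \<comment> \<open>Nonvanishing at one point of the exceptional curve \<open>y = 0\<close> is
    enough, not necessarily at the origin: it leaves some nonzero coefficient in
    \<open>g(x, 0)\<close>.\<close>
  have "coeff g 0 \<noteq> 0" using g by (auto simp: eval2_def poly_0_coeff_0)
  then obtain i where i: "coeff (coeff g 0) i \<noteq> 0" by (metis leading_coeff_0_iff)
  show ?thesis unfolding mult0_def
  proof (rule Least_equality)
    have "coeff (coeff (subst2 f (pX * pY) pY) d) i \<noteq> 0" using c[of d] i by simp
    then show "\<exists>i j. d = i + j \<and> coeff (coeff f j) i \<noteq> 0"
      by (intro exI[of _ i] exI[of _ "d - i"]) (auto simp: coeff_subst2_blow_up split: if_splits)
  next
    fix e assume "\<exists>i j. e = i + j \<and> coeff (coeff f j) i \<noteq> 0"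
    then obtain i j where ij: "e = i + j" "coeff (coeff f j) i \<noteq> 0" by auto
    then have "coeff (coeff (subst2 f (pX * pY) pY) e) i \<noteq> 0" by (simp add: coeff_subst2_blow_up)
    then show "d \<le> e" using c[of e] by (auto split: if_splits)
  qed
qed

lemma pX_neq_0: "pX \<noteq> 0" and pY_neq_0: "pY \<noteq> 0"
  by (simp_all add: pX_def pY_def)

lemma eval2_differentiable:
  assumes "a field_differentiable at 0" "b field_differentiable at (0::complex)"
  shows "(\<lambda>x. eval2 f (a x) (b x)) field_differentiable at 0"
proof (induction f)
  case 0
  then show ?case by simp
next
  case (pCons p f)
  have "(\<lambda>x. poly p (a x)) field_differentiable at 0"
    using assms(1) unfolding field_differentiable_def by (auto intro: DERIV_chain2[OF poly_DERIV])
  then show ?case using pCons assms(2)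
    by (simp add: field_differentiable_add field_differentiable_mult)
qed

text \<open>Chain rule, with the coefficients of \<open>x\<close> and \<open>y\<close> as the
  partial derivatives at the origin. The curve \<open>(a, b)\<close> is only required to be
  differentiable at 0, so that rational parametrizations can be inserted.\<close>

lemma eval2_DERIV:
  assumes "(a has_field_derivative a') (at 0)" "(b has_field_derivative b') (at (0::complex))"
    and "a 0 = 0" "b 0 = 0"
  shows "((\<lambda>x. eval2 f (a x) (b x)) has_field_derivative
    a' * coeff (coeff f 0) 1 + b' * coeff (coeff f 1) 0) (at 0)"
proof -
  obtain f0 f1 f2 where f: "f = pCons f0 (pCons f1 f2)" by (metis pCons_cases)
  obtain D where D: "((\<lambda>x. eval2 f2 (a x) (b x)) has_field_derivative D) (at 0)"
    using eval2_differentiable[of a b] assms unfolding field_differentiable_def by blast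
  have p: "((\<lambda>x. poly q (a x)) has_field_derivative poly (pderiv q) 0 * a') (at 0)" for q
    using DERIV_chain2[OF poly_DERIV assms(1), of q] assms(3) by simp
  show ?thesis unfolding f
    using DERIV_add[OF p[of f0] DERIV_mult[OF assms(2) DERIV_add[OF p[of f1] DERIV_mult[OF assms(2) D]]]]
    by (simp add: assms(3,4) poly_0_coeff_0 coeff_pderiv mult.commute)
qed

lemma coeffs_eq_0_if_singular:
  assumes "1 < mult0 f"
  shows "coeff (coeff f 0) 0 = 0" "coeff (coeff f 0) 1 = 0" "coeff (coeff f 1) 0 = 0"
proof -
  have "coeff (coeff f j) i = 0" if "i + j \<le> 1" for i j
  proof (rule ccontr)
    assume "coeff (coeff f j) i \<noteq> 0"
    then have "mult0 f \<le> i + j" unfolding mult0_def by (intro Least_le) blast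
    then show False using assms that by simp
  qed
  then show "coeff (coeff f 0) 0 = 0" "coeff (coeff f 0) 1 = 0" "coeff (coeff f 1) 0 = 0" by simp_all
qed

section \<open>Families of graphs\<close>

lemma proper_transform_NoneI:
  assumes "subst2 f (pX * pY) pY = pY ^ d * g" "eval2 g x 0 \<noteq> 0"
  shows "proper_transform f None = g"
  using mult0_eqI[OF assms] assms(1) pY_neq_0 by simp

lemma proper_transform_SomeI:
  assumes "subst2 f pX (pX * (pY + pC c)) = pX ^ mult0 f * g"
  shows "proper_transform f (Some c) = g"
  using assms pX_neq_0 by simp

text \<open>Each factor is \<open>p j * y - x * q j\<close>, a smooth branch through the origin
  whose tangent is not \<open>x = 0\<close>. Under \<open>(x y, y)\<close> it yields exactly one
  factor \<open>y\<close>, and what remains takes the value \<open>p j 0\<close> at the origin, so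
  the direction \<open>None\<close> is off the curve.\<close>

lemma mult0_branches:
  assumes "finite J" "eval2 u 0 0 \<noteq> 0" "\<And>j. j \<in> J \<Longrightarrow> poly (p j) 0 \<noteq> 0"
    and f: "f = u * (\<Prod>j\<in>J. [:- pCons 0 (q j), p j:])"
  shows "mult0 f = card J" "mult0 (proper_transform f None) = 0"
proof -
  let ?g = "subst2 u (pX * pY) pY * (\<Prod>j\<in>J. subst2 [:p j:] (pX * pY) pY - pX * subst2 [:q j:] (pX * pY) pY)"
  have s: "subst2 f (pX * pY) pY = pY ^ card J * ?g"
  proof (rule eval2_eqI)
    fix x y
    have "(\<Prod>j\<in>J. y * poly (p j) (x * y) - x * y * poly (q j) (x * y))
        = (\<Prod>j\<in>J. y * (poly (p j) (x * y) - x * poly (q j) (x * y)))"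
      by (intro prod.cong) (auto simp: algebra_simps)
    then show "eval2 (subst2 f (pX * pY) pY) x y = eval2 (pY ^ card J * ?g) x y"
      unfolding f by (simp add: prod.distrib)
  qed
  have g: "eval2 ?g 0 0 \<noteq> 0" using assms by simp
  show "mult0 f = card J" by (rule mult0_eqI[OF s g])
  show "mult0 (proper_transform f None) = 0"
    unfolding proper_transform_NoneI[OF s g] by (rule mult0_eq_0[OF g])
qed

lemma proper_transform_branches:
  assumes "finite J" "eval2 u 0 0 \<noteq> 0" "\<And>j. j \<in> J \<Longrightarrow> poly (p j) 0 \<noteq> 0"
  shows "proper_transform (u * (\<Prod>j\<in>J. [:- pCons 0 (q j), p j:])) (Some c)
    = subst2 u pX (pX * (pY + pC c)) * (\<Prod>j\<in>J. [:- (q j - smult c (p j)), p j:])"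
proof (rule proper_transform_SomeI, subst mult0_branches(1)[OF assms refl], simp, rule eval2_eqI)
  fix x y
  have "(\<Prod>j\<in>J. x * (y + c) * poly (p j) x - x * poly (q j) x)
      = (\<Prod>j\<in>J. x * (c * poly (p j) x - poly (q j) x + y * poly (p j) x))"
    by (intro prod.cong) (auto simp: algebra_simps)
  then show "eval2 (subst2 (u * (\<Prod>j\<in>J. [:- pCons 0 (q j), p j:])) pX (pX * (pY + pC c))) x y
      = eval2 (pX ^ card J * (subst2 u pX (pX * (pY + pC c)) * (\<Prod>j\<in>J. [:- (q j - smult c (p j)), p j:]))) x y"
    by (simp add: prod.distrib)
qed

text \<open>A branch with \<open>q j\<close> nonzero at 0 misses the origin and can be counted as
  part of the unit. At most one branch is left, and it is smooth.\<close>

lemma mult0_branches_le_1: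
  assumes J: "finite J" and u: "eval2 u 0 0 \<noteq> 0" and p: "\<And>j. j \<in> J \<Longrightarrow> poly (p j) 0 \<noteq> 0"
    and q: "\<And>i j. i \<in> J \<Longrightarrow> j \<in> J \<Longrightarrow> poly (q i) 0 = 0 \<Longrightarrow> poly (q j) 0 = 0 \<Longrightarrow> i = j"
  shows "mult0 (u * (\<Prod>j\<in>J. [:- q j, p j:])) \<le> 1"
proof (cases "\<exists>j\<in>J. poly (q j) 0 = 0")
  case True
  then obtain j where j: "j \<in> J" "poly (q j) 0 = 0" by blast
  then obtain q' where q': "q j = pCons 0 q'" by (metis pCons_cases poly_pCons mult_zero_left add.right_neutral)
  let ?u = "u * (\<Prod>i\<in>J - {j}. [:- q i, p i:])"
  have "u * (\<Prod>j\<in>J. [:- q j, p j:]) = ?u * (\<Prod>i\<in>{j}. [:- pCons 0 q', p i:])"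
    using J j q' by (simp add: prod.remove mult.commute mult.left_commute)
  moreover have "eval2 ?u 0 0 \<noteq> 0" using J u q j by auto
  ultimately have "mult0 (u * (\<Prod>j\<in>J. [:- q j, p j:])) = card {j}"
    using p[OF j(1)] by (intro mult0_branches(1)[where u = ?u and p = p and q = "\<lambda>_. q'"]) auto
  then show ?thesis by simp
next
  case False
  then show ?thesis using J u by (subst mult0_eq_0) auto
qed

text \<open>
  The branches are \<open>y = q j / p j\<close>. Blowing up replaces \<open>q j\<close> by \<open>q j / x - c p j\<close> and therefore divides
  every cross determinant \<open>p i q j - p j q i\<close> by \<open>x\<close>. Keeping the \<open>p j\<close> distinct and the unit \<open>u\<close>
  arbitrary allows the lemma to be used at the vertex and at the nodes as well.
\<close>

lemma sing_type_branches:
  assumes J: "finite J" "2 \<le> card J" and "eval2 u 0 0 \<noteq> 0" and p: "\<And>j. j \<in> J \<Longrightarrow> poly (p j) 0 \<noteq> 0"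
    and "\<And>j. j \<in> J \<Longrightarrow> 0 < n \<Longrightarrow> poly (q j) 0 = 0"
    and "\<And>i j. i \<in> J \<Longrightarrow> j \<in> J \<Longrightarrow> i \<noteq> j \<Longrightarrow>
      \<exists>r. p i * q j - p j * q i = [:0, 1:] ^ n * r \<and> poly r 0 \<noteq> 0"
  shows "sing_type (replicate n (card J)) (u * (\<Prod>j\<in>J. [:- q j, p j:]))"
  using assms(3,5,6)
proof (induction n arbitrary: u q)
  case 0
  \<comment> \<open>For \<open>n = 0\<close> the cross determinant of two branches is nonzero at 0,
    so they cannot both pass through the origin.\<close>
  have "i = j" if ij: "i \<in> J" "j \<in> J" "poly (q i) 0 = 0" "poly (q j) 0 = 0" for i j
  proof (rule ccontr)
    assume "i \<noteq> j"
    then obtain r where r: "p i * q j - p j * q i = r" "poly r 0 \<noteq> 0"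
      using 0(3)[OF ij(1,2)] by auto
    have "poly (p i * q j - p j * q i) 0 = 0" using ij by simp
    then show False using r by simp
  qed
  then show ?case using mult0_branches_le_1[OF J(1) 0(1) p] by simp
next
  case (Suc n)
  have "\<forall>j\<in>J. \<exists>q'. q j = pCons 0 q'"
    using Suc.prems(2) by (metis pCons_cases poly_pCons mult_zero_left add.right_neutral zero_less_Suc)
  then obtain q' where q': "\<And>j. j \<in> J \<Longrightarrow> q j = pCons 0 (q' j)" by metis
  define f where "f = u * (\<Prod>j\<in>J. [:- q j, p j:])"
  have f: "f = u * (\<Prod>j\<in>J. [:- pCons 0 (q' j), p j:])" unfolding f_def using q' by (auto cong: prod.cong)
  define v where "v c = subst2 u pX (pX * (pY + pC c))" for c
  define w where "w c j = q' j - smult c (p j)" for c j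
  have v: "eval2 (v c) 0 0 \<noteq> 0" for c using Suc.prems(1) by (simp add: v_def)
  have pt: "proper_transform f (Some c) = v c * (\<Prod>j\<in>J. [:- w c j, p j:])" for c
    unfolding f v_def w_def by (rule proper_transform_branches[OF J(1) Suc.prems(1) p])
  have cross: "\<exists>r. p i * w c j - p j * w c i = [:0, 1:] ^ n * r \<and> poly r 0 \<noteq> 0"
    if ij: "i \<in> J" "j \<in> J" "i \<noteq> j" for i j c
  proof -
    obtain r where r: "p i * q j - p j * q i = [:0, 1:] ^ Suc n * r" "poly r 0 \<noteq> 0"
      using Suc.prems(3)[OF ij] by blast
    have "[:0, 1:] * (p i * q' j - p j * q' i) = p i * q j - p j * q i"
      using ij by (simp add: q' algebra_simps)
    also have "\<dots> = [:0, 1:] * ([:0, 1:] ^ n * r)" by (simp only: r power_Suc mult.assoc)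
    finally have "p i * q' j - p j * q' i = [:0, 1:] ^ n * r"
      by (subst (asm) mult_cancel_left) auto
    then show ?thesis using r(2) by (intro exI[of _ r]) (simp add: w_def algebra_simps)
  qed
  obtain j0 where j0: "j0 \<in> J" using J(2) by fastforce
  \<comment> \<open>The slope of an arbitrary branch \<open>j0\<close>. While \<open>n > 0\<close>
    the cross determinants force all branches to share it. At the last blow-up the slopes are
    pairwise distinct, and any point of the exceptional curve may serve as the end of the
    list.\<close>
  define c where "c = poly (q' j0) 0 / poly (p j0) 0"
  have None: "mult0 (proper_transform f None) = 0" and m: "mult0 f = card J"
    using mult0_branches[OF J(1) Suc.prems(1) p f] by auto
  have le: "mult0 (proper_transform f e) \<le> 1" if e: "e \<noteq> Some c \<or> n = 0" for e
  proof (cases e)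
    case None
    then show ?thesis using \<open>mult0 (proper_transform f None) = 0\<close> by simp
  next
    case (Some d)
    have "i = j" if ij: "i \<in> J" "j \<in> J" "poly (w d i) 0 = 0" "poly (w d j) 0 = 0" for i j
    proof (rule ccontr)
      assume ne: "i \<noteq> j"
      have z: "poly (p a * w d b - p b * w d a) 0 = 0" if ab: "0 < n" "a \<in> J" "b \<in> J" for a b
      proof (cases "a = b")
        case False
        then obtain r where "p a * w d b - p b * w d a = [:0, 1:] ^ n * r" using cross ab(2,3) by blast
        then show ?thesis using ab(1) by simp
      qed simp
      show False
      proof (cases "n = 0")
        case True
        then show False using cross[OF ij(1,2) ne, of d] ij(3,4) by (auto dest!: arg_cong[where f = "\<lambda>r. poly r 0"])
      next
        case False
        \<comment> \<open>The cross determinant of \<open>i\<close> and \<open>j0\<close> vanishes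
          at 0, so a branch \<open>i\<close> of slope \<open>d\<close> forces slope \<open>d\<close>
          on \<open>j0\<close> as well.\<close>
        then have "poly (p i) 0 * poly (w d j0) 0 = 0" using z[of i j0] ij j0 by simp
        then have "poly (w d j0) 0 = 0" using p[OF ij(1)] by simp
        then have "d = c" using p[OF j0] by (simp add: w_def c_def field_simps)
        then show False using e False Some by simp
      qed
    qed
    then show ?thesis unfolding Some pt by (intro mult0_branches_le_1[OF J(1) v p]) auto
  qed
  have "sing_type (replicate n (card J)) (v c * (\<Prod>j\<in>J. [:- w c j, p j:]))"
  proof (rule Suc.IH[OF v])
    fix j assume j: "j \<in> J" "0 < n"
    show "poly (w c j) 0 = 0"
    proof (cases "j = j0")
      case True
      then show ?thesis using p[OF j0] by (simp add: w_def c_def)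
    next
      case False
      then obtain r where r: "p j0 * w c j - p j * w c j0 = [:0, 1:] ^ n * r" using cross j0 j by blast
      have "poly (p j0 * w c j - p j * w c j0) 0 = 0" unfolding r using j(2) by simp
      moreover have "poly (w c j0) 0 = 0" using p[OF j0] by (simp add: w_def c_def)
      ultimately show ?thesis using p[OF j0] by simp
    qed
  qed (use cross in blast)
  then have "sing_type (replicate n (card J)) (proper_transform f (Some c))" unfolding pt .
  then have "sing_type (replicate (Suc n) (card J)) f"
    using m J(2) le by (auto intro!: exI[of _ "Some c"])
  then show ?case unfolding f_def .
qed

text \<open>In the Leibniz formula at 0 only the term with all \<open>n\<close> derivatives on
  \<open>x ^ n\<close> survives.\<close>

lemma higher_deriv_monomial_mult:
  assumes "r holomorphic_on S" "open S" "(0::complex) \<in> S" "l \<le> n"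
  shows "(deriv ^^ l) (\<lambda>x. x ^ n * r x) 0 = (if l = n then fact n * r 0 else 0)"
proof -
  have d: "(deriv ^^ i) (\<lambda>x::complex. x ^ n) 0 = (if i = n then fact n else 0)" if "i \<le> n" for i
    using higher_deriv_power[of i 0 n 0] that by (auto simp: pochhammer_fact)
  have "(deriv ^^ l) (\<lambda>x. x ^ n * r x) 0
      = (\<Sum>i = 0..l. of_nat (l choose i) * (deriv ^^ i) (\<lambda>x. x ^ n) 0 * (deriv ^^ (l - i)) r 0)"
    using assms by (intro higher_deriv_mult[of _ S]) (auto intro!: holomorphic_intros)
  also have "\<dots> = (\<Sum>i = 0..l. if i = l then if l = n then fact n * r 0 else 0 else 0)"
    using assms(4) by (intro sum.cong) (auto simp: d)
  finally show ?thesis by simp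
qed

lemma eval2_continuous: "continuous_on UNIV (\<lambda>z. eval2 f (fst z) (snd z))"
proof (induction f)
  case (pCons p f)
  then show ?case by (simp, intro continuous_intros)
qed simp

text \<open>The branches are the graphs of \<open>q j / p j\<close>, and two of them differ by their
  cross determinant over \<open>p i * p j\<close>, which is \<open>x ^ Suc k\<close> times a
  function that is nonzero at 0. So the derivatives agree through order \<open>k\<close> and differ
  in order \<open>k + 1\<close>.\<close>

lemma tacnode_branches:
  assumes u: "eval2 u 0 0 \<noteq> 0" and p: "\<And>j. j < m \<Longrightarrow> poly (p j) 0 \<noteq> 0"
    and q: "\<And>j. j < m \<Longrightarrow> poly (q j) 0 = 0"
    and cross: "\<And>i j. i < m \<Longrightarrow> j < m \<Longrightarrow> i \<noteq> j \<Longrightarrow>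
      \<exists>r. p i * q j - p j * q i = [:0, 1:] ^ Suc k * r \<and> poly r 0 \<noteq> 0"
  shows "tacnode m k (u * (\<Prod>j<m. [:- q j, p j:]))"
proof -
  \<comment> \<open>All that must not vanish near the origin, the unit and every denominator, in one
    function, so that a single radius serves.\<close>
  define h where "h z = eval2 u (fst z) (snd z) * (\<Prod>j<m. poly (p j) (fst z))" for z
  have "isCont h (0, 0)"
    using eval2_continuous[of u] unfolding h_def
    by (intro continuous_intros) (auto simp: continuous_on_eq_continuous_at)
  moreover have "h (0, 0) \<noteq> 0" using u p by (simp add: h_def)
  ultimately obtain d where d: "0 < d" "\<And>z. dist (0, 0) z < d \<Longrightarrow> h z \<noteq> 0"
    using continuous_at_avoid[of "(0, 0)" h 0] by auto
  define r where "r = d / 2"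
  have r: "0 < r" using d by (simp add: r_def)
  have nz: "h (x, y) \<noteq> 0" if "norm x < r" "norm y < r" for x y
  proof (rule d(2))
    have "dist (0, 0) (x, y) = sqrt ((norm x)\<^sup>2 + (norm y)\<^sup>2)" by (simp add: dist_Pair_Pair)
    also have "\<dots> \<le> norm x + norm y" by (rule sqrt_sum_squares_le_sum) auto
    finally show "dist (0, 0) (x, y) < d" using that by (simp add: r_def)
  qed
  have pnz: "poly (p j) x \<noteq> 0" if "norm x < r" "j < m" for x j
    using nz[of x 0] that r by (auto simp: h_def)
  define \<phi> where "\<phi> j x = poly (q j) x / poly (p j) x" for j x
  have hol: "\<phi> j holomorphic_on ball 0 r" if "j < m" for j
    unfolding \<phi>_def using pnz that by (intro holomorphic_intros) auto
  have der: "(deriv ^^ l) (\<phi> i) 0 = (deriv ^^ l) (\<phi> j) 0 \<longleftrightarrow> l \<noteq> Suc k"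
    if ij: "i < m" "j < m" "i \<noteq> j" and l: "l \<le> Suc k" for i j l
  proof -
    obtain s where s: "p i * q j - p j * q i = [:0, 1:] ^ Suc k * s" "poly s 0 \<noteq> 0"
      using cross ij by blast
    define \<rho> where "\<rho> x = poly s x / (poly (p i) x * poly (p j) x)" for x
    have \<rho>: "\<rho> holomorphic_on ball 0 r" unfolding \<rho>_def using pnz ij by (intro holomorphic_intros) auto
    have eq: "\<phi> j x - \<phi> i x = x ^ Suc k * \<rho> x" if "x \<in> ball 0 r" for x
    proof -
      have "poly (p i) x * poly (q j) x - poly (p j) x * poly (q i) x = x ^ Suc k * poly s x"
        using arg_cong[OF s(1), of "\<lambda>a. poly a x"] by (simp del: power_Suc)
      then show ?thesis using pnz[of x i] pnz[of x j] that ij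
        by (simp add: \<phi>_def \<rho>_def diff_frac_eq mult.commute del: power_Suc)
    qed
    have "(deriv ^^ l) (\<phi> j) 0 - (deriv ^^ l) (\<phi> i) 0 = (deriv ^^ l) (\<lambda>x. \<phi> j x - \<phi> i x) 0"
      using hol ij r by (subst higher_deriv_diff[of _ "ball 0 r"]) auto
    also have "\<dots> = (deriv ^^ l) (\<lambda>x. x ^ Suc k * \<rho> x) 0"
      using hol ij r \<rho> eq by (intro higher_deriv_transform_within_open[of _ "ball 0 r"]) (auto intro!: holomorphic_intros)
    also have "\<dots> = (if l = Suc k then fact (Suc k) * \<rho> 0 else 0)"
      using \<rho> r l by (intro higher_deriv_monomial_mult[of _ "ball 0 r"]) auto
    finally have "(deriv ^^ l) (\<phi> j) 0 - (deriv ^^ l) (\<phi> i) 0 = (if l = Suc k then fact (Suc k) * \<rho> 0 else 0)" .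
    moreover have "\<rho> 0 \<noteq> 0" using s(2) p ij by (simp add: \<rho>_def)
    ultimately show ?thesis by (auto simp del: fact_Suc)
  qed
  have zero: "eval2 (u * (\<Prod>j<m. [:- q j, p j:])) x y = 0 \<longleftrightarrow> (\<exists>j<m. y = \<phi> j x)"
    if "norm x < r" "norm y < r" for x y
  proof -
    have "eval2 u x y \<noteq> 0" using nz[OF that] by (simp add: h_def)
    moreover have "y * poly (p j) x = poly (q j) x \<longleftrightarrow> y = \<phi> j x" if "j < m" for j
      using pnz[OF \<open>norm x < r\<close> that] by (simp add: \<phi>_def field_simps)
    ultimately show ?thesis by auto
  qed
  show ?thesis unfolding tacnode_def
    by (intro exI[of _ 1] exI[of _ 0] exI[of _ \<phi>] exI[of _ r] conjI allI impI)
      (use r hol zero der q in \<open>auto simp: \<phi>_def simp del: funpow.simps\<close>)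
qed

section \<open>Elementary transformations of sections\<close>

text \<open>The preimage of a relatively closed set is relatively closed in the blow-up, and no
  point of it lies over the centre; so neither removing the exceptional curve nor taking the closure
  changes it.\<close>

lemma hproper_eq:
  assumes C: "C = hcarrier \<inter> X" "closed X"
    and avoid: "\<And>s t u v. (s, t, u, v) \<in> C \<Longrightarrow> \<not> (l s t = 0 \<and> h (s, t, u, v) = 0)"
  shows "hproper l h C = {p \<in> hblowup l h. fst p \<in> C}"
proof -
  let ?A = "{((s, t, u, v), (a, b)) | s t u v a b.
    ((s, t, u, v), (a, b)) \<in> hblowup l h \<and> (s, t, u, v) \<in> C \<and> \<not> (l s t = 0 \<and> h (s, t, u, v) = 0)}"
  have A: "?A = {p \<in> hblowup l h. fst p \<in> C}"
    using avoid by (auto simp: hblowup_def)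
  have "closed (fst -` X :: (hcoords \<times> complex \<times> complex) set)"
    using C(2) by (intro continuous_closed_vimage) (auto intro: continuous_intros)
  then have "closure ?A \<subseteq> fst -` X"
    by (intro closure_minimal) (use C in \<open>auto simp: A\<close>)
  moreover have "hblowup l h \<subseteq> fst -` hcarrier" by (auto simp: hblowup_def)
  ultimately have "hblowup l h \<inter> closure ?A \<subseteq> {p \<in> hblowup l h. fst p \<in> C}"
    unfolding C(1) by auto
  moreover have "{p \<in> hblowup l h. fst p \<in> C} \<subseteq> hblowup l h \<inter> closure ?A"
    using closure_subset[of ?A] A by auto
  ultimately show ?thesis unfolding hproper_def by (rule subset_antisym)
qed

lemma hsat_eqI:
  assumes "I = S" "\<And>c e s t u v. c \<noteq> 0 \<Longrightarrow> e \<noteq> 0 \<Longrightarrow> (s, t, u, v) \<in> S \<Longrightarrow> (c * s, c * t, e * c ^ n * u, e * v) \<in> S"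
  shows "hsat n I = S"
proof
  show "hsat n I \<subseteq> S" using assms by (auto simp: hsat_def)
  show "S \<subseteq> hsat n I"
  proof clarify
    fix s t u v assume "(s, t, u, v) \<in> S"
    then show "(s, t, u, v) \<in> hsat n I" unfolding hsat_def assms(1)
      by (intro CollectI exI[of _ 1] exI[of _ s] exI[of _ t] exI[of _ u] exI[of _ v]) auto
  qed
qed

text \<open>
  The sets \<open>D j\<close> restrict the base: they are the whole plane for a curve, and a line through the
  origin for the transform of a single point.
\<close>

definition sections :: "(complex \<Rightarrow> complex \<Rightarrow> complex) \<Rightarrow> nat \<Rightarrow> 'i set \<Rightarrow> ('i \<Rightarrow> (complex \<times> complex) set)
    \<Rightarrow> ('i \<Rightarrow> complex \<Rightarrow> complex \<Rightarrow> complex) \<Rightarrow> hcoords set" where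
  "sections l e J D G = {(s, t, u, v). (s, t, u, v) \<in> hcarrier \<and>
     (\<exists>j\<in>J. (s, t) \<in> D j \<and> l s t ^ e * u = G j s t * v)}"

text \<open>Closedness lets \<open>sections\<close> be relatively closed; invariance under nonzero
  scalars makes it a union of orbits, hence a subset of the surface.\<close>

definition cone :: "(complex \<times> complex) set \<Rightarrow> bool" where
  "cone D \<longleftrightarrow> closed D \<and> (\<forall>c s t. c \<noteq> 0 \<longrightarrow> (s, t) \<in> D \<longrightarrow> (c * s, c * t) \<in> D)"

lemma sections_closed:
  assumes "finite J" and D: "\<And>j. j \<in> J \<Longrightarrow> cone (D j)"
    and l: "binary_form k l" and G: "\<And>j. j \<in> J \<Longrightarrow> binary_form d (G j)"
  shows "\<exists>X. closed X \<and> sections l e J D G = hcarrier \<inter> X"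
proof (intro exI conjI)
  let ?Y = "\<lambda>j. {x :: hcoords. (fst x, fst (snd x)) \<in> D j} \<inter> {x. l (fst x) (fst (snd x)) ^ e * fst (snd (snd x))
    = G j (fst x) (fst (snd x)) * snd (snd (snd x))}"
  have c: "continuous_on UNIV (\<lambda>x :: hcoords. g (fst x) (fst (snd x)))" if "binary_form k g" for k g
    using continuous_on_compose2[OF binary_form_continuous[OF that, of UNIV], of UNIV "\<lambda>x :: hcoords. (fst x, fst (snd x))"]
    by (simp add: continuous_intros)
  have "closed {x :: hcoords. (fst x, fst (snd x)) \<in> D j}" if "j \<in> J" for j
    using continuous_closed_vimage[of "D j" "\<lambda>x :: hcoords. (fst x, fst (snd x))"] D[OF that]
    unfolding vimage_def cone_def by (auto intro: continuous_intros)
  moreover have "closed {x :: hcoords. l (fst x) (fst (snd x)) ^ e * fst (snd (snd x))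
    = G j (fst x) (fst (snd x)) * snd (snd (snd x))}" if "j \<in> J" for j
    by (intro closed_Collect_eq continuous_intros c[OF l] c[OF G[OF that]])
  ultimately show "closed (\<Union>j\<in>J. ?Y j)" using assms(1) by (intro closed_UN closed_Int) auto
  show "sections l e J D G = hcarrier \<inter> (\<Union>j\<in>J. ?Y j)" by (auto simp: sections_def)
qed

text \<open>The degree \<open>n + e\<close> is dictated by the action: \<open>u\<close> has weight
  \<open>n\<close> in the base scalar and \<open>l ^ e\<close> has weight \<open>e\<close>. It stays
  constant under the second type, which lowers \<open>n\<close> and raises \<open>e\<close> by
  one.\<close>

lemma sections_scale:
  assumes D: "\<And>j. j \<in> J \<Longrightarrow> cone (D j)"
    and l: "binary_form 1 l" and G: "\<And>j. j \<in> J \<Longrightarrow> binary_form (n + e) (G j)"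
    and c: "c \<noteq> 0" "c' \<noteq> 0" and x: "(s, t, u, v) \<in> sections l e J D G"
  shows "(c * s, c * t, c' * c ^ n * u, c' * v) \<in> sections l e J D G"
proof -
  obtain j where j: "j \<in> J" "(s, t) \<in> D j" "l s t ^ e * u = G j s t * v"
    using x by (auto simp: sections_def)
  have "l (c * s) (c * t) ^ e * (c' * c ^ n * u) = c ^ (n + e) * c' * (l s t ^ e * u)"
    by (simp add: binary_form_homogeneous[OF l] power_mult_distrib power_add)
  also have "\<dots> = G j (c * s) (c * t) * (c' * v)"
    unfolding j(3) by (simp add: binary_form_homogeneous[OF G[OF j(1)]])
  finally show ?thesis
    using x c j D[OF j(1)] by (auto simp: sections_def hcarrier_def cone_def)
qed

text \<open>On the blow-up \<open>a * v = b * l\<close>. Multiplying \<open>u = G j * v\<close> by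
  \<open>a\<close> therefore gives \<open>a * u = l * G j * b\<close>, an equation in the new fiber
  coordinates \<open>(a * u, b)\<close>.\<close>

lemma elem_first_sections:
  assumes J: "finite J" and D: "\<And>j. j \<in> J \<Longrightarrow> cone (D j)"
    and p: "binary_form 1 p" and l: "binary_form 1 l" and G: "\<And>j. j \<in> J \<Longrightarrow> binary_form n (G j)"
  shows "elem_first n l (sections p 0 J D G) = sections p 0 J D (\<lambda>j s t. l s t * G j s t)"
proof -
  obtain X where X: "closed X" "sections p 0 J D G = hcarrier \<inter> X"
    using sections_closed[of J D 1 p n G 0] J D p G by auto
  let ?S = "sections p 0 J D (\<lambda>j s t. l s t * G j s t)"
  have pr: "hproper l (\<lambda>(s, t, u, v). v) (sections p 0 J D G)
      = {x \<in> hblowup l (\<lambda>(s, t, u, v). v). fst x \<in> sections p 0 J D G}"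
  proof (rule hproper_eq[OF X(2,1)])
    fix s t u v assume x: "(s, t, u, v) \<in> sections p 0 J D G"
    then obtain j where "(u, v) \<noteq> (0, 0)" "u = G j s t * v"
      by (auto simp: sections_def hcarrier_def)
    then show "\<not> (l s t = 0 \<and> (case (s, t, u, v) of (s, t, u, v) \<Rightarrow> v) = 0)" by auto
  qed
  have "(\<lambda>((s, t, u, v), (a, b)). (s, t, a * u, b)) ` hproper l (\<lambda>(s, t, u, v). v) (sections p 0 J D G) = ?S"
    (is "?f ` ?P = _")
  proof
    show "?f ` ?P \<subseteq> ?S"
    proof clarify
      fix s t u v a b assume "((s, t, u, v), (a, b)) \<in> ?P"
      then obtain j where j: "j \<in> J" "(s, t) \<in> D j" "(s, t) \<noteq> (0, 0)" "(u, v) \<noteq> (0, 0)" "(a, b) \<noteq> (0, 0)"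
          "u = G j s t * v" "a * v = b * l s t"
        unfolding pr by (auto simp: sections_def hcarrier_def hblowup_def)
      have "a * u = l s t * G j s t * b" using j(6,7) by (simp add: mult_ac)
      moreover have "b \<noteq> 0" using j by auto
      ultimately show "(s, t, a * u, b) \<in> ?S" using j(1-3) by (auto simp: sections_def hcarrier_def)
    qed
    show "?S \<subseteq> ?f ` ?P"
    proof clarify
      fix s t u v assume x: "(s, t, u, v) \<in> ?S"
      then obtain j where j: "j \<in> J" "(s, t) \<in> D j" "u = l s t * G j s t * v" "(s, t) \<noteq> (0, 0)" "v \<noteq> 0"
        by (auto simp: sections_def hcarrier_def)
      \<comment> \<open>The old section has one point over each base point, and the equation of the
        blow-up then forces \<open>[a:b] = [l:v]\<close>.\<close>
      have "((s, t, G j s t * v, v), (l s t, v)) \<in> ?P"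
        unfolding pr using j by (auto simp: hblowup_def sections_def hcarrier_def)
      moreover have "?f ((s, t, G j s t * v, v), (l s t, v)) = (s, t, u, v)" using j by simp
      ultimately show "(s, t, u, v) \<in> ?f ` ?P" by (metis (no_types, lifting) image_eqI)
    qed
  qed
  moreover have "binary_form (n + 1 + 0) (\<lambda>s t. l s t * G j s t)" if "j \<in> J" for j
    using binary_form_mult[OF l G[OF that]] by simp
  ultimately show ?thesis unfolding elem_first_def
    by (intro hsat_eqI sections_scale[OF D p]) auto
qed

text \<open>On the blow-up \<open>a * (u - g * v) = b * l\<close>; multiplying by
  \<open>l ^ e\<close> and inserting the old equation gives the new one in the coordinates
  \<open>(b, a * v)\<close>. The condition \<open>avoid\<close> keeps the centre off the curve: on
  the fiber it reads \<open>G j \<noteq> g\<close> for \<open>e = 0\<close> and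
  \<open>G j \<noteq> 0\<close> for \<open>e > 0\<close>.\<close>

lemma elem_second_sections:
  assumes J: "finite J" and D: "\<And>j. j \<in> J \<Longrightarrow> cone (D j)" and n: "0 < n"
    and l: "binary_form 1 l" and g: "binary_form n g" and G: "\<And>j. j \<in> J \<Longrightarrow> binary_form (n + e) (G j)"
    and avoid: "\<And>j s t. j \<in> J \<Longrightarrow> (s, t) \<in> D j \<Longrightarrow> (s, t) \<noteq> (0, 0) \<Longrightarrow> l s t = 0 \<Longrightarrow> G j s t \<noteq> l s t ^ e * g s t"
  shows "elem_second n l g (sections l e J D G) = sections l (Suc e) J D (\<lambda>j s t. G j s t - l s t ^ e * g s t)"
proof -
  obtain X where X: "closed X" "sections l e J D G = hcarrier \<inter> X"
    using sections_closed[of J D 1 l "n + e" G e] J D l G by auto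
  let ?h = "\<lambda>(s, t, u, v). u - g s t * v"
  let ?S = "sections l (Suc e) J D (\<lambda>j s t. G j s t - l s t ^ e * g s t)"
  have pr: "hproper l ?h (sections l e J D G) = {x \<in> hblowup l ?h. fst x \<in> sections l e J D G}"
  proof (rule hproper_eq[OF X(2,1)], clarify)
    fix s t u v assume x: "(s, t, u, v) \<in> sections l e J D G" "l s t = 0" "u - g s t * v = 0"
    then obtain j where j: "j \<in> J" "(s, t) \<in> D j" "(s, t) \<noteq> (0, 0)" "(u, v) \<noteq> (0, 0)" "l s t ^ e * u = G j s t * v"
      by (auto simp: sections_def hcarrier_def)
    have u: "u = g s t * v" using x(3) by simp
    have "(G j s t - l s t ^ e * g s t) * v = 0" using j(5) unfolding u by (auto simp: left_diff_distrib mult.assoc)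
    then show False using avoid[OF j(1,2,3) x(2)] x(3) j(4) by auto
  qed
  have "(\<lambda>((s, t, u, v), (a, b)). (s, t, b, a * v)) ` hproper l ?h (sections l e J D G) = ?S"
    (is "?f ` ?P = _")
  proof
    show "?f ` ?P \<subseteq> ?S"
    proof clarify
      fix s t u v a b assume "((s, t, u, v), (a, b)) \<in> ?P"
      then obtain j where j: "j \<in> J" "(s, t) \<in> D j" "(s, t) \<noteq> (0, 0)" "(u, v) \<noteq> (0, 0)" "(a, b) \<noteq> (0, 0)"
          "l s t ^ e * u = G j s t * v" "a * (u - g s t * v) = b * l s t"
        unfolding pr by (auto simp: sections_def hcarrier_def hblowup_def)
      have "l s t ^ Suc e * b = l s t ^ e * (a * (u - g s t * v))" using j(7) by simp
      also have "\<dots> = a * (l s t ^ e * u) - l s t ^ e * g s t * (a * v)" by (simp add: algebra_simps)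
      also have "\<dots> = (G j s t - l s t ^ e * g s t) * (a * v)" unfolding j(6) by (simp add: algebra_simps)
      finally show "(s, t, b, a * v) \<in> ?S"
        using j by (auto simp: sections_def hcarrier_def)
    qed
    show "?S \<subseteq> ?f ` ?P"
    proof clarify
      fix s t u v assume x: "(s, t, u, v) \<in> ?S"
      then obtain j where j: "j \<in> J" "(s, t) \<in> D j" "(s, t) \<noteq> (0, 0)" "(u, v) \<noteq> (0, 0)"
          "l s t ^ Suc e * u = (G j s t - l s t ^ e * g s t) * v"
        by (auto simp: sections_def hcarrier_def)
      show "(s, t, u, v) \<in> ?f ` ?P"
      proof (cases "l s t = 0")
        case True
        then have "v = 0" using j(5) avoid[OF j(1,2,3)] by auto
        then have "u \<noteq> 0" using j(4) by simp
        \<comment> \<open>Over the fiber \<open>[G j : l ^ e]\<close> is the point of the old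
          branch, a genuine point by \<open>avoid\<close>. It lies on the contracted curve
          \<open>a = 0\<close>, so its image is the point \<open>l = v = 0\<close>.\<close>
        have "G j s t \<noteq> 0 \<or> l s t ^ e \<noteq> 0" using avoid[OF j(1,2,3) True] by auto
        then have "((s, t, G j s t, l s t ^ e), (0, u)) \<in> ?P"
          unfolding pr using j True \<open>u \<noteq> 0\<close> by (auto simp: hblowup_def sections_def hcarrier_def)
        then show ?thesis using \<open>v = 0\<close> by (force intro!: image_eqI)
      next
        case False
        \<comment> \<open>Off the fiber the transformation is
          \<open>u \<mapsto> (u - g * v) / l\<close> and is inverted explicitly, normalized by
          \<open>a = 1\<close>.\<close>
        have "((s, t, l s t * u + g s t * v, v), (1, u)) \<in> ?P"
          unfolding pr using j False by (auto simp: hblowup_def sections_def hcarrier_def algebra_simps)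
        then show ?thesis by (force intro!: image_eqI)
      qed
    qed
  qed
  moreover have "binary_form (n - 1 + Suc e) (\<lambda>s t. G j s t - l s t ^ e * g s t)" if "j \<in> J" for j
    using binary_form_diff[OF G[OF that] binary_form_mult[OF binary_form_power[OF l, of e] g, unfolded mult_1 add.commute[of e]]]
      n by simp
  ultimately show ?thesis unfolding elem_second_def
    by (intro hsat_eqI sections_scale[OF D l]) auto
qed

section \<open>Iterated elementary transformations and the return to the plane\<close>

lemma first_steps_sections:
  assumes J: "finite J" and D: "\<And>j. j \<in> J \<Longrightarrow> cone (D j)" and p: "binary_form 1 p"
    and "\<And>l. l \<in> set ls \<Longrightarrow> binary_form 1 l" and "\<And>j. j \<in> J \<Longrightarrow> binary_form n (G j)"
  shows "first_steps n ls (sections p 0 J D G) = sections p 0 J D (\<lambda>j s t. (\<Prod>l\<leftarrow>ls. l s t) * G j s t)"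
  using assms(4,5)
proof (induction ls arbitrary: n G)
  case Nil
  then show ?case by simp
next
  case (Cons l ls)
  have "binary_form (n + 1) (\<lambda>s t. l s t * G j s t)" if "j \<in> J" for j
    using binary_form_mult[of 1 l n "G j"] Cons.prems that by simp
  then show ?case
    using Cons.prems elem_first_sections[of J D p l n G] J D p
      Cons.IH[of "n + 1" "\<lambda>j s t. l s t * G j s t"] by (simp add: mult_ac)
qed

lemma second_steps_sections:
  assumes J: "finite J" and D: "\<And>j. j \<in> J \<Longrightarrow> cone (D j)" and l: "binary_form 1 l"
    and "length gs \<le> n" "\<And>i. i < length gs \<Longrightarrow> binary_form (n - i) (gs ! i)"
    and "\<And>j. j \<in> J \<Longrightarrow> binary_form (n + e) (G j)"
    and "\<And>j s t. j \<in> J \<Longrightarrow> (s, t) \<in> D j \<Longrightarrow> (s, t) \<noteq> (0, 0) \<Longrightarrow> l s t = 0 \<Longrightarrow>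
      gs \<noteq> [] \<Longrightarrow> G j s t \<noteq> l s t ^ e * hd gs s t"
  shows "second_steps n l gs (sections l e J D G) = sections l (e + length gs) J D
    (\<lambda>j s t. G j s t - (\<Sum>i<length gs. l s t ^ (e + i) * (gs ! i) s t))"
  using assms(4-)
proof (induction gs arbitrary: n e G)
  case Nil
  then show ?case by simp
next
  case (Cons g gs)
  let ?G = "\<lambda>j s t. G j s t - l s t ^ e * g s t"
  have g: "binary_form n g" using Cons.prems(2)[of 0] by simp
  have "elem_second n l g (sections l e J D G) = sections l (Suc e) J D ?G"
    using Cons.prems(1,4) by (intro elem_second_sections[OF J D _ l g Cons.prems(3)]) auto
  moreover have "second_steps (n - 1) l gs (sections l (Suc e) J D ?G) = sections l (Suc e + length gs) J D
      (\<lambda>j s t. ?G j s t - (\<Sum>i<length gs. l s t ^ (Suc e + i) * (gs ! i) s t))"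
  proof (rule Cons.IH)
    show "length gs \<le> n - 1" using Cons.prems(1) by simp
    show "binary_form (n - 1 - i) (gs ! i)" if "i < length gs" for i
      using Cons.prems(2)[of "Suc i"] that by simp
    show "binary_form (n - 1 + Suc e) (?G j)" if "j \<in> J" for j
      using binary_form_diff[OF Cons.prems(3)[OF that] binary_form_mult[OF binary_form_power[OF l, of e] g, unfolded mult_1 add.commute[of e]]]
        Cons.prems(1) by simp
    \<comment> \<open>The exponent is now positive, so the right-hand side vanishes on
      \<open>l = 0\<close> and the claim is that the previous \<open>G j\<close> differed from its
      centre. This is why only the first centre has to be constrained.\<close>
    show "?G j s t \<noteq> l s t ^ Suc e * hd gs s t"
      if "j \<in> J" "(s, t) \<in> D j" "(s, t) \<noteq> (0, 0)" "l s t = 0" for j s t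
      using Cons.prems(4)[OF that] that(4) by simp
  qed
  ultimately show ?case by (simp add: sum.lessThan_Suc_shift algebra_simps del: sum.lessThan_Suc)
qed

text \<open>Where \<open>v \<noteq> 0\<close> the plane coordinates are
  \<open>(v s, v t, u)\<close>, and degree \<open>Suc e\<close> of \<open>G j\<close> against degree
  \<open>e\<close> of \<open>l ^ e\<close> absorbs the powers of \<open>v\<close>. Points with
  \<open>v = 0\<close> occur exactly over \<open>l = 0\<close>, and all of them go to
  \<open>[0:0:1]\<close>.\<close>

lemma plane_blow_down_sections:
  assumes D: "\<And>j. j \<in> J \<Longrightarrow> cone (D j)"
    and l: "binary_form 1 l" and G: "\<And>j. j \<in> J \<Longrightarrow> binary_form (Suc e) (G j)" and e: "0 < e"
    and nz: "\<And>j s t. j \<in> J \<Longrightarrow> (s, t) \<in> D j \<Longrightarrow> (s, t) \<noteq> (0, 0) \<Longrightarrow> l s t = 0 \<Longrightarrow> G j s t \<noteq> 0"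
  shows "plane_blow_down (sections l e J D G) =
    {z. (z $ 1, z $ 2) \<noteq> (0, 0) \<and> (\<exists>j\<in>J. (z $ 1, z $ 2) \<in> D j \<and> l (z $ 1) (z $ 2) ^ e * z $ 3 = G j (z $ 1) (z $ 2))} \<union>
    {z. z \<noteq> 0 \<and> z $ 1 = 0 \<and> z $ 2 = 0 \<and> (\<exists>j\<in>J. \<exists>s t. (s, t) \<in> D j \<and> (s, t) \<noteq> (0, 0) \<and> l s t = 0)}"
    (is "_ = ?A \<union> ?B")
proof -
  let ?f = "to_plane (axis 1 1) (axis 2 1) (axis 3 1)"
  have f: "?f (s, t, u, v) $ 1 = v * s" "?f (s, t, u, v) $ 2 = v * t" "?f (s, t, u, v) $ 3 = u" for s t u v
    by (simp_all add: to_plane_def axis_def)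
  have feq: "z = ?f (s, t, u, v)" if "z $ 1 = v * s" "z $ 2 = v * t" "z $ 3 = u" for z :: "complex^3" and s t u v
    using that f by (simp add: vec_eq_iff forall_3)
  show ?thesis unfolding plane_blow_down_def
  proof
    show "?f ` sections l e J D G \<subseteq> ?A \<union> ?B"
    proof (intro image_subsetI)
      fix x assume x: "x \<in> sections l e J D G"
      show "?f x \<in> ?A \<union> ?B"
      proof (cases "?f x \<in> ?B")
        case nB: False
        obtain s t u v where x': "x = (s, t, u, v)" by (metis prod.exhaust)
        from x obtain j where j: "j \<in> J" "(s, t) \<in> D j" "(s, t) \<noteq> (0, 0)" "(u, v) \<noteq> (0, 0)"
            "l s t ^ e * u = G j s t * v"
          by (auto simp: sections_def hcarrier_def x')
        have v: "v \<noteq> 0"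
        proof
          assume v: "v = 0"
          then have "u \<noteq> 0" "l s t = 0" using j by auto
          moreover from this have "?f (s, t, u, v) \<noteq> 0" using f(3)[of s t u v] by (auto simp del: f)
          ultimately show False using nB j v f unfolding x' by auto
        qed
        have "l (v * s) (v * t) ^ e * u = v ^ e * (l s t ^ e * u)"
          by (simp add: binary_form_homogeneous[OF l] power_mult_distrib)
        also have "\<dots> = G j (v * s) (v * t)"
          unfolding j(5) by (simp add: binary_form_homogeneous[OF G[OF j(1)]])
        finally have "(?f (s, t, u, v) $ 1, ?f (s, t, u, v) $ 2) \<noteq> (0, 0) \<and> (\<exists>j\<in>J. (?f (s, t, u, v) $ 1, ?f (s, t, u, v) $ 2) \<in> D j
            \<and> l (?f (s, t, u, v) $ 1) (?f (s, t, u, v) $ 2) ^ e * ?f (s, t, u, v) $ 3 = G j (?f (s, t, u, v) $ 1) (?f (s, t, u, v) $ 2))"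
          using j v D[OF j(1)] unfolding f cone_def by auto
        then show ?thesis unfolding x' by blast
      qed blast
    qed
    show "?A \<union> ?B \<subseteq> ?f ` sections l e J D G"
    proof (intro Un_least subsetI)
      fix z assume z: "z \<in> ?A"
      then have "(z $ 1, z $ 2, z $ 3, 1) \<in> sections l e J D G" by (auto simp: sections_def hcarrier_def)
      moreover have "z = ?f (z $ 1, z $ 2, z $ 3, 1)" by (rule feq) auto
      ultimately show "z \<in> ?f ` sections l e J D G" by (metis image_eqI)
    next
      fix z assume z: "z \<in> ?B"
      then obtain j s t where j: "j \<in> J" "(s, t) \<in> D j" "(s, t) \<noteq> (0, 0)" "l s t = 0" by blast
      have "z $ 3 \<noteq> 0" using z by (auto simp: vec_eq_iff forall_3)
      then have "(s, t, z $ 3, 0) \<in> sections l e J D G" using j e by (auto simp: sections_def hcarrier_def)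
      moreover have "z = ?f (s, t, z $ 3, 0)" using z by (intro feq) auto
      ultimately show "z \<in> ?f ` sections l e J D G" by (metis image_eqI)
    qed
  qed
qed

section \<open>Points, lines and singularities of plane curves\<close>

abbreviation vec3 :: "complex \<Rightarrow> complex \<Rightarrow> complex \<Rightarrow> complex^3" where
  "vec3 s t u \<equiv> vector [s, t, u]"

lemma vec3_eq_iff: "z = z' \<longleftrightarrow> z $ 1 = z' $ 1 \<and> z $ 2 = z' $ 2 \<and> z $ 3 = z' $ 3" for z z' :: "complex^3"
  by (simp add: vec_eq_iff forall_3)

lemma pt_scale: "c \<noteq> 0 \<Longrightarrow> pt (c *s z) = pt z"
proof -
  assume c: "c \<noteq> 0"
  have "d *s z = (d / c) *s (c *s z)" for d using c by (simp add: vec_eq_iff)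
  then show ?thesis unfolding pt_def using c
    by (auto simp: vec_eq_iff) (metis divide_eq_0_iff nonzero_eq_divide_eq mult.assoc)
qed

lemma pt_self: "z \<in> pt z"
  unfolding pt_def by (intro CollectI exI[of _ 1]) simp

lemma pt_eqE:
  assumes "pt z = pt z'" obtains c where "c \<noteq> 0" "z = c *s z'"
  using pt_self[of z] assms unfolding pt_def by auto

lemma frame_coordinates:
  fixes A B R z :: "complex^3"
  assumes "det (vector [A, B, R] :: complex^3^3) \<noteq> 0"
  shows "\<exists>s t u. z = s *s A + t *s B + u *s R"
proof -
  let ?M = "vector [A, B, R] :: complex^3^3"
  obtain M' where M': "M' ** ?M = mat 1"
    using assms invertible_det_nz unfolding invertible_def by blast
  have "z = (z v* M') v* ?M" by (simp add: vector_matrix_mul_assoc M')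
  also have "\<dots> = (z v* M') $ 1 *s A + (z v* M') $ 2 *s B + (z v* M') $ 3 *s R"
    by (simp add: vec_eq_iff vector_matrix_mult_def sum_3 algebra_simps)
  finally show ?thesis by blast
qed

lemma frame_independent:
  fixes A B R :: "complex^3"
  assumes "det (vector [A, B, R] :: complex^3^3) \<noteq> 0" "s *s A + t *s B + u *s R = 0"
  shows "s = 0 \<and> t = 0 \<and> u = 0"
proof -
  let ?M = "vector [A, B, R] :: complex^3^3"
  obtain M' where M': "?M ** M' = mat 1"
    using assms invertible_det_nz unfolding invertible_def by blast
  have "vec3 s t u v* ?M = s *s A + t *s B + u *s R"
    by (simp add: vec_eq_iff vector_matrix_mult_def sum_3 algebra_simps)
  then have "(vec3 s t u v* ?M) v* M' = 0" using assms(2) by simp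
  then have "vec3 s t u = 0" by (simp add: vector_matrix_mul_assoc M')
  then show ?thesis by (simp add: vec3_eq_iff)
qed

section \<open>Linear forms in two variables and their roots\<close>

lemma linear_formE:
  assumes "binary_form 1 f" obtains a b where "\<And>s t. f s t = a * s + b * t"
proof -
  obtain c where "\<And>s t. f s t = (\<Sum>i\<le>1. c i * s ^ i * t ^ (1 - i))"
    using assms unfolding binary_form_def by blast
  then show ?thesis using that[of "c 1" "c 0"] by simp
qed

lemma linear_form_root:
  assumes "binary_form 1 f" obtains s t where "(s, t) \<noteq> (0, 0)" "f s t = 0"
proof -
  obtain a b where f: "\<And>s t. f s t = a * s + b * t" using linear_formE[OF assms] by blast
  show ?thesis
  proof (cases "a = 0 \<and> b = 0")
    case True
    then show ?thesis using f that[of 1 0] by simp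
  next
    case False
    then show ?thesis using f that[of "- b" a] by auto
  qed
qed

text \<open>At a root the form is the local parameter \<open>x\<close> times a constant; this is the
  source of every power of \<open>x\<close> in the contact orders.\<close>

lemma linear_form_pencil:
  assumes "binary_form 1 f" "f s t = 0" shows "f (s + x * s') (t + x * t') = x * f s' t'"
  using assms by (elim linear_formE) (simp add: algebra_simps)

text \<open>By Cramer's rule a linear form vanishing at two independent vectors is zero.\<close>

lemma linear_form_nonzero:
  assumes "binary_form 1 f" "f s t = 0" "s * t' - t * s' \<noteq> 0" "f a b \<noteq> 0"
  shows "f s' t' \<noteq> 0"
proof
  assume "f s' t' = 0"
  obtain c d where f: "\<And>s t. f s t = c * s + d * t" using linear_formE[OF assms(1)] by blast
  have "c * (s * t' - t * s') = t' * f s t - t * f s' t'" "d * (s * t' - t * s') = s * f s' t' - s' * f s t"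
    by (simp_all add: f algebra_simps)
  then show False using assms \<open>f s' t' = 0\<close> f by simp
qed

lemma linear_form_roots_proportional:
  assumes "binary_form 1 f" "f a b \<noteq> 0" "f s t = 0" "f s' t' = 0" "(s, t) \<noteq> (0, 0)" "(s', t') \<noteq> (0, 0)"
  obtains c where "c \<noteq> 0" "s' = c * s" "t' = c * t"
proof -
  have e: "s * t' = t * s'" using linear_form_nonzero[OF assms(1,3) _ assms(2)] assms(4) by auto
  show ?thesis
  proof (cases "s = 0")
    case True
    then show ?thesis using e assms(5,6) that[of "t' / t"] by auto
  next
    case False
    then have "s' \<noteq> 0" using e assms(6) by auto
    then show ?thesis using e False that[of "s' / s"] by (simp add: field_simps)
  qed
qed

lemma complementary_direction:
  assumes "(s, t) \<noteq> (0, 0 :: complex)" obtains s' t' where "s * t' - t * s' \<noteq> 0"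
  using assms that[of 1 0] that[of 0 1] by (cases "s = 0") auto

text \<open>The lines with coordinates \<open>(1, t, t^2)\<close> run through a conic in the dual
  plane. A given point lies on finitely many of them, since its incidence condition is a nonzero
  polynomial in \<open>t\<close>.\<close>

lemma line_avoiding_points:
  fixes S :: "(complex^3) set set"
  assumes "finite S" "\<And>p. p \<in> S \<Longrightarrow> \<exists>z. z \<noteq> 0 \<and> p = pt z"
  shows "\<exists>t. \<forall>z\<in>\<Union>S. z $ 1 + t * z $ 2 + t\<^sup>2 * z $ 3 \<noteq> 0"
proof -
  have "finite {t. \<exists>z\<in>p. z $ 1 + t * z $ 2 + t\<^sup>2 * z $ 3 = 0}" if p: "p \<in> S" for p :: "(complex^3) set"
  proof -
    obtain z where z: "z \<noteq> 0" "p = pt z" using assms(2)[OF p] by blast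
    have "[:z $ 1, z $ 2, z $ 3:] \<noteq> 0" using z(1) by (auto simp: vec3_eq_iff)
    then have "finite {t. poly [:z $ 1, z $ 2, z $ 3:] t = 0}" by (rule poly_roots_finite)
    moreover have "poly [:z $ 1, z $ 2, z $ 3:] t = 0"
      if "w \<in> p" "w $ 1 + t * w $ 2 + t\<^sup>2 * w $ 3 = 0" for w :: "complex^3" and t
    proof -
      obtain c where c: "c \<noteq> 0" "w = c *s z" using \<open>w \<in> p\<close> z by (auto simp: pt_def)
      have "c * poly [:z $ 1, z $ 2, z $ 3:] t = w $ 1 + t * w $ 2 + t\<^sup>2 * w $ 3"
        unfolding c(2) by (simp add: algebra_simps power2_eq_square)
      then have "c * poly [:z $ 1, z $ 2, z $ 3:] t = 0"
        unfolding \<open>w $ 1 + t * w $ 2 + t\<^sup>2 * w $ 3 = 0\<close> .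
      then show ?thesis using c(1) by (metis mult_eq_0_iff)
    qed
    ultimately show ?thesis by (elim rev_finite_subset) blast
  qed
  then have "finite (\<Union>p\<in>S. {t. \<exists>z\<in>p. z $ 1 + t * z $ 2 + t\<^sup>2 * z $ 3 = 0})" using assms(1) by blast
  then obtain t where "t \<notin> (\<Union>p\<in>S. {t. \<exists>z\<in>p. z $ 1 + t * z $ 2 + t\<^sup>2 * z $ 3 = 0})"
    using ex_new_if_finite infinite_UNIV_char_0 by blast
  then show ?thesis by blast
qed

text \<open>If the affine part of the line carries no zero, the restriction is a constant by the
  fundamental theorem of algebra; homogeneity of positive degree \<open>e\<close> then puts a zero
  at the missing point \<open>b\<close>.\<close>

lemma form_vanishes_on_line:
  assumes G: "form e G" "0 < e"
  obtains x y where "(x, y) \<noteq> (0, 0)" "G (x *s a + y *s b) = 0"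
proof -
  obtain g where g: "\<And>x. G (a + x *s b) = poly g x" using poly_form_on_line[OF G(1), of a b] by auto
  show ?thesis
  proof (cases "\<exists>x. poly g x = 0")
    case True
    then show ?thesis using that[of 1] g by auto
  next
    case False
    then obtain d where "g = [:d:]" using fundamental_theorem_of_algebra_alt[of g] by auto
    then have c: "poly g x = poly g 0" for x by simp
    obtain g' where g': "\<And>x. G (b + x *s a) = poly g' x" using poly_form_on_line[OF G(1), of b a] by auto
    \<comment> \<open>Homogeneity compares the two charts only for \<open>x \<noteq> 0\<close>. The
      extra factor \<open>x\<close> makes the sides agree at 0 too and is cancelled
      afterwards.\<close>
    have "[:0, 1:] * g' = [:0, 1:] * ([:0, 1:] ^ e * [:poly g 0:])"
    proof (subst poly_eq_poly_eq_iff[symmetric], rule ext)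
      fix x
      have "poly g' x = x ^ e * poly g 0" if "x \<noteq> 0"
      proof -
        have "b + x *s a = x *s (a + (1 / x) *s b)" using that by (simp add: vec_eq_iff field_simps)
        then show ?thesis using form_homogeneous[OF G(1)] g g' c by metis
      qed
      then show "poly ([:0, 1:] * g') x = poly ([:0, 1:] * ([:0, 1:] ^ e * [:poly g 0:])) x"
        by (cases "x = 0") (auto simp: mult.commute)
    qed
    then have "g' = [:0, 1:] ^ e * [:poly g 0:]" by (subst (asm) mult_cancel_left) auto
    then have "G b = 0" using g'[of 0] G(2) by simp
    then show ?thesis using that[of 0 1] by simp
  qed
qed

text \<open>
  A curve \<open>G\<^sup>2 H = 0\<close> is singular along \<open>G = 0\<close>, which meets every line, in particular a line that
  avoids \<open>S\<close>.
\<close>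

lemma squarefree_formI:
  assumes F: "form d F" "F \<noteq> (\<lambda>_. 0)" and S: "finite S" "\<And>p. p \<in> S \<Longrightarrow> \<exists>z. z \<noteq> 0 \<and> p = pt z"
    and sing: "\<And>z. z \<noteq> 0 \<Longrightarrow> F z = 0 \<Longrightarrow> ((\<lambda>x. F (z + x *s v)) has_field_derivative 0) (at 0) \<Longrightarrow> pt z \<in> S"
  shows "squarefree_form d F"
  unfolding squarefree_form_def
proof (intro conjI F notI)
  assume "\<exists>e G e' H. 0 < e \<and> form e G \<and> form e' H \<and> F = (\<lambda>z. (G z)\<^sup>2 * H z)"
  then obtain e G e' H where G: "0 < e" "form e G" and H: "form e' H" and eq: "F = (\<lambda>z. (G z)\<^sup>2 * H z)" by blast
  obtain t where t: "\<And>z. z \<in> \<Union>S \<Longrightarrow> z $ 1 + t * z $ 2 + t\<^sup>2 * z $ 3 \<noteq> 0"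
    using line_avoiding_points[OF S] by auto
  \<comment> \<open>The two vectors span the line with coordinates
    \<open>(1, t, t^2)\<close>.\<close>
  obtain x y where xy: "(x, y) \<noteq> (0, 0)" "G (x *s vec3 (- t) 1 0 + y *s vec3 (- (t\<^sup>2)) 0 1) = 0"
    using form_vanishes_on_line[OF G(2,1)] by blast
  define z where "z = x *s vec3 (- t) 1 0 + y *s vec3 (- (t\<^sup>2)) 0 1"
  have z: "z \<noteq> 0" "z $ 1 + t * z $ 2 + t\<^sup>2 * z $ 3 = 0"
    using xy(1) by (auto simp: z_def vec3_eq_iff)
  obtain g h where g: "\<And>x. G (z + x *s v) = poly g x" and h: "\<And>x. H (z + x *s v) = poly h x"
    using poly_form_on_line[OF G(2), of z v] poly_form_on_line[OF H, of z v] by auto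
  have g0: "poly g 0 = 0" using g[of 0] xy(2) by (simp add: z_def)
  have "(poly (g\<^sup>2 * h) has_field_derivative poly (pderiv (g\<^sup>2 * h)) 0) (at 0)" by (rule poly_DERIV)
  moreover have "poly (pderiv (g\<^sup>2 * h)) 0 = 0" using g0 by (simp add: pderiv_mult power2_eq_square)
  moreover have "(\<lambda>x. F (z + x *s v)) = poly (g\<^sup>2 * h)" by (simp add: eq g h fun_eq_iff)
  moreover have "F z = 0" using xy(2) by (simp add: eq z_def)
  ultimately have "pt z \<in> S" using sing[OF z(1)] by simp
  then show False using t[of z] z(2) pt_self by blast
qed

text \<open>
  The third basis direction besides \<open>w\<close> and \<open>w'\<close> is \<open>z\<close> itself, where homogeneity takes the place of
  the local equation.
\<close>

lemma singular_point_derivative: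
  assumes F: "form d F" and "p \<in> singular_points F"
  obtains z where "z \<noteq> 0" "p = pt z" "F z = 0" "((\<lambda>x. F (z + x *s v)) has_field_derivative 0) (at 0)"
proof -
  obtain f z w w' where p: "p = pt z" and d: "det (vector [z, w, w'] :: complex^3^3) \<noteq> 0"
    and f: "\<And>x y. F (z + x *s w + y *s w') = eval2 f x y" and s: "1 < mult0 f"
    using assms(2) by (auto simp: singular_points_def has_at_def local_equation_def)
  obtain a b c where v: "v = a *s z + b *s w + c *s w'" using frame_coordinates[OF d] by blast
  have Fz: "F z = 0" using f[of 0 0] coeffs_eq_0_if_singular(1)[OF s] by (simp add: eval2_def poly_0_coeff_0)
  have "z \<noteq> 0" using frame_independent[OF d, of 1 0 0] by auto
  \<comment> \<open>The component \<open>a\<close> of \<open>v\<close> along \<open>z\<close> moves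
    \<open>z + x *s v\<close> out of the affine chart. Dividing by \<open>1 + a * x\<close> returns
    it there, with affine coordinates of this shape and derivatives \<open>b\<close>,
    \<open>c\<close> at 0; homogeneity accounts for the factor
    \<open>(1 + a * x) ^ d\<close>.\<close>
  have D: "((\<lambda>x. x * q / (1 + a * x)) has_field_derivative q) (at 0)" for q
    by (auto intro!: derivative_eq_intros)
  have "((\<lambda>x. (1 + a * x) ^ d) has_field_derivative of_nat d * a) (at 0)"
    by (auto intro!: derivative_eq_intros)
  from DERIV_mult[OF this eval2_DERIV[OF D[of b] D[of c], of f]]
  have D0: "((\<lambda>x. (1 + a * x) ^ d * eval2 f (x * b / (1 + a * x)) (x * c / (1 + a * x))) has_field_derivative 0) (at 0)"
    using coeffs_eq_0_if_singular[OF s] by (simp add: eval2_def poly_0_coeff_0)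
  have ev: "\<forall>\<^sub>F x in nhds 0. (1 + a * x) ^ d * eval2 f (x * b / (1 + a * x)) (x * c / (1 + a * x)) = F (z + x *s v)"
  proof -
    have "open {x. 1 + a * x \<noteq> 0}" by (intro open_Collect_neq continuous_intros)
    then have "\<forall>\<^sub>F x in nhds 0. 1 + a * x \<noteq> 0"
      using eventually_nhds_in_open[of "{x. 1 + a * x \<noteq> 0}" 0] by simp
    then show ?thesis
    proof eventually_elim
      case (elim x)
      then have "(1 + a * x) *s ((x * b / (1 + a * x)) *s w) = (x * b) *s w"
          "(1 + a * x) *s ((x * c / (1 + a * x)) *s w') = (x * c) *s w'"
        by simp_all
      then have "z + x *s v = (1 + a * x) *s (z + (x * b / (1 + a * x)) *s w + (x * c / (1 + a * x)) *s w')"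
        unfolding vector_add_ldistrib by (simp add: v vec_eq_iff algebra_simps)
      then show ?case by (simp only: form_homogeneous[OF F] f)
    qed
  qed
  have "((\<lambda>x. F (z + x *s v)) has_field_derivative 0) (at 0)"
    by (rule iffD1[OF DERIV_cong_ev[OF refl ev refl] D0])
  then show ?thesis using that p Fz \<open>z \<noteq> 0\<close> by blast
qed

section \<open>The transformed arrangement\<close>

text \<open>What remains of the geometry once everything is expressed over the base of the pencil.
  \<open>h_l\<close> and \<open>h_p\<close> record transversality (no crossing on a
  \<open>Q i\<close> or on \<open>P\<close>), \<open>h_h\<close> general position,
  \<open>p_l\<close> and \<open>l_l\<close> that the chosen fibers are distinct, and
  \<open>centre\<close> that the first blown-up point of the second type is off the curve.\<close>

locale twisted_lines =
  fixes m k N :: nat and n :: "nat \<Rightarrow> nat" and h l :: "nat \<Rightarrow> complex \<Rightarrow> complex \<Rightarrow> complex"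
    and p K :: "complex \<Rightarrow> complex \<Rightarrow> complex"
  assumes m: "1 \<le> m" and k: "1 \<le> k" and n: "\<And>i. i < k \<Longrightarrow> 1 \<le> n i" and N: "N = (\<Sum>i<k. n i)"
    and h: "\<And>j. j < m \<Longrightarrow> binary_form 1 (h j)"
    and l: "\<And>i. i < k \<Longrightarrow> binary_form 1 (l i)" "\<And>i. i < k \<Longrightarrow> \<exists>s t. l i s t \<noteq> 0"
    and p: "binary_form 1 p" "\<exists>s t. p s t \<noteq> 0"
    and K: "binary_form (Suc N) K"
    and p_l: "\<And>i s t. i < k \<Longrightarrow> (s, t) \<noteq> (0, 0) \<Longrightarrow> l i s t = 0 \<Longrightarrow> p s t \<noteq> 0"
    and l_l: "\<And>i j s t. i < k \<Longrightarrow> j < k \<Longrightarrow> (s, t) \<noteq> (0, 0) \<Longrightarrow> l i s t = 0 \<Longrightarrow> l j s t = 0 \<Longrightarrow> i = j"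
    and h_l: "\<And>i a b s t. i < k \<Longrightarrow> a < m \<Longrightarrow> b < m \<Longrightarrow> (s, t) \<noteq> (0, 0) \<Longrightarrow> l i s t = 0 \<Longrightarrow>
      h a s t = h b s t \<Longrightarrow> a = b"
    and h_p: "\<And>a b s t. a < m \<Longrightarrow> b < m \<Longrightarrow> (s, t) \<noteq> (0, 0) \<Longrightarrow> p s t = 0 \<Longrightarrow> h a s t = h b s t \<Longrightarrow> a = b"
    and h_h: "\<And>a b c s t. a < m \<Longrightarrow> b < m \<Longrightarrow> c < m \<Longrightarrow> (s, t) \<noteq> (0, 0) \<Longrightarrow>
      h a s t = h b s t \<Longrightarrow> h b s t = h c s t \<Longrightarrow> a = b \<or> b = c \<or> a = c"
    and centre: "\<And>j s t. j < m \<Longrightarrow> (s, t) \<noteq> (0, 0) \<Longrightarrow> p s t = 0 \<Longrightarrow> (\<Prod>i<k. l i s t ^ n i) * h j s t \<noteq> K s t"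
begin

definition H :: "complex \<Rightarrow> complex \<Rightarrow> complex" where
  "H s t = (\<Prod>i<k. l i s t ^ n i)"

definition G :: "nat \<Rightarrow> complex \<Rightarrow> complex \<Rightarrow> complex" where
  "G j s t = H s t * h j s t - K s t"

definition F :: "complex^3 \<Rightarrow> complex" where
  "F z = (\<Prod>j<m. p (z $ 1) (z $ 2) ^ N * z $ 3 - G j (z $ 1) (z $ 2))"

lemma N_pos: "0 < N"
proof -
  have "n 0 \<le> N" unfolding N using k by (intro member_le_sum) auto
  then show ?thesis using n[of 0] k by simp
qed

lemma H_form: "binary_form N H"
  unfolding H_def[abs_def] N
proof (rule binary_form_prod)
  show "binary_form (n i) (\<lambda>s t. l i s t ^ n i)" if "i \<in> {..<k}" for i
    using binary_form_power[OF l(1), of i "n i"] that by simp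
qed simp

lemma G_form: "j < m \<Longrightarrow> binary_form (Suc N) (G j)"
  unfolding G_def[abs_def] using binary_form_diff[OF binary_form_mult[OF H_form h, simplified] K] by simp

lemma p_N_form: "binary_form N (\<lambda>s t. p s t ^ N)"
  using binary_form_power[OF p(1), of N] by simp

lemma H_eq_0_iff: "H s t = 0 \<longleftrightarrow> (\<exists>i<k. l i s t = 0)"
  using n by (force simp: H_def)

lemma G_nonzero: "j < m \<Longrightarrow> (s, t) \<noteq> (0, 0) \<Longrightarrow> p s t = 0 \<Longrightarrow> G j s t \<noteq> 0"
  using centre by (simp add: G_def H_def)

lemma p_root: obtains s t where "(s, t) \<noteq> (0, 0)" "p s t = 0"
  using linear_form_root[OF p(1)] by blast

lemma h_diff:
  assumes "a < m" "b < m" "a \<noteq> b"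
  shows "binary_form 1 (\<lambda>s t. h b s t - h a s t)" "\<exists>s t. h b s t - h a s t \<noteq> 0"
proof -
  show "binary_form 1 (\<lambda>s t. h b s t - h a s t)" using h assms by (intro binary_form_diff)
  obtain s t where "(s, t) \<noteq> (0, 0)" "p s t = 0" by (rule p_root)
  then show "\<exists>s t. h b s t - h a s t \<noteq> 0" using h_p[of a b s t] assms by fastforce
qed

lemma F_form: "form (m * (N + 1)) F"
proof -
  have "form (Suc N) (\<lambda>z. p (z $ 1) (z $ 2) ^ N * z $ 3 - G j (z $ 1) (z $ 2))" if "j < m" for j
  proof -
    have "form (N + 1) (\<lambda>z. p (z $ 1) (z $ 2) ^ N * z $ 3)"
      using form_mult[OF form_binary[OF p_N_form], of 1 "\<lambda>z :: complex^3. z $ 3"] form_monomial[of 0 0 1 1] by simp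
    moreover have "form (Suc N) (\<lambda>z. (- 1) * G j (z $ 1) (z $ 2))"
      using binary_form_cmult[OF G_form[OF that], of "-1"] by (rule form_binary)
    ultimately show ?thesis using form_add by fastforce
  qed
  then have "form (card {..<m} * Suc N) F" unfolding F_def[abs_def] by (intro form_prod) auto
  then show ?thesis by simp
qed

lemma F_zero_iff:
  "F z = 0 \<longleftrightarrow> (\<exists>j<m. p (z $ 1) (z $ 2) ^ N * z $ 3 = G j (z $ 1) (z $ 2))"
  by (auto simp: F_def)

lemma F_nonzero: "F \<noteq> (\<lambda>_. 0)"
proof
  obtain s t where st: "(s, t) \<noteq> (0, 0)" "p s t = 0" by (rule p_root)
  assume "F = (\<lambda>_. 0)"
  then have "F (vec3 s t 0) = 0" by simp
  then show False using st G_nonzero[OF _ st] N_pos by (auto simp: F_zero_iff)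
qed

text \<open>On the line \<open>p = 0\<close> the branch equations become \<open>G j = 0\<close>,
  because \<open>N > 0\<close>, and \<open>centre\<close> excludes this. Hence the curve meets that
  line only in \<open>[0:0:1]\<close>.\<close>

lemma F_zero_base:
  fixes z :: "complex^3"
  assumes "F z = 0" "(z $ 1, z $ 2) \<noteq> (0, 0)" shows "p (z $ 1) (z $ 2) \<noteq> 0"
  using assms G_nonzero[of _ "z $ 1" "z $ 2"] N_pos
  by (auto simp: F_zero_iff zero_power)

text \<open>The coordinate \<open>x\<close> moves the base point in an independent direction
  \<open>(s', t')\<close> and \<open>y\<close> moves along the fiber, so in these coordinates all
  branches are graphs \<open>y = Q j / P\<close> with the common denominator
  \<open>p ^ N\<close>.\<close>

lemma chart:
  assumes d: "s * t' - t * s' \<noteq> 0"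
  obtains P Q where "\<And>x. poly P x = p (s + x * s') (t + x * t') ^ N"
    "\<And>j x. j < m \<Longrightarrow> poly (Q j) x = G j (s + x * s') (t + x * t') - w * p (s + x * s') (t + x * t') ^ N"
    "local_equation F (pt (vec3 s t w)) (\<Prod>j<m. [:- Q j, P:])"
proof -
  obtain P where P: "\<And>x. poly P x = p (s + x * s') (t + x * t') ^ N"
    using poly_binary_form[OF p_N_form, of "[:s, s':]" "[:t, t':]"] by auto
  have "\<forall>j. \<exists>q. j < m \<longrightarrow> (\<forall>x. poly q x = G j (s + x * s') (t + x * t'))"
    using poly_binary_form[OF G_form, of _ "[:s, s':]" "[:t, t':]"] by auto
  then obtain q where q: "\<And>j x. j < m \<Longrightarrow> poly (q j) x = G j (s + x * s') (t + x * t')" by metis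
  define Q where "Q j = q j - smult w P" for j
  have Q: "poly (Q j) x = G j (s + x * s') (t + x * t') - w * p (s + x * s') (t + x * t') ^ N" if "j < m" for j x
    using q P that by (simp add: Q_def)
  have "local_equation F (pt (vec3 s t w)) (\<Prod>j<m. [:- Q j, P:])"
    unfolding local_equation_def
  proof (intro exI conjI allI)
    show "det (vector [vec3 s t w, vec3 s' t' 0, vec3 0 0 1] :: complex^3^3) \<noteq> 0"
      using d by (simp add: det_3)
    fix x y
    show "F (vec3 s t w + x *s vec3 s' t' 0 + y *s vec3 0 0 1) = eval2 (\<Prod>j<m. [:- Q j, P:]) x y"
      unfolding F_def eval2_prod by (intro prod.cong) (auto simp: Q P algebra_simps)
  qed simp
  then show ?thesis using that P Q by blast
qed

text \<open>Over a root of \<open>l i\<close> the factor \<open>H\<close> vanishes, so every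
  \<open>G j\<close> takes the value \<open>- K\<close> and all branches pass through one point.
  Their differences are multiples of \<open>H * (h b - h a)\<close>, in which only
  \<open>l i ^ n i\<close> vanishes at that root.\<close>

lemma has_at_tacnode:
  assumes i: "i < k" and st: "(s, t) \<noteq> (0, 0)" "l i s t = 0"
  defines "z \<equiv> vec3 s t (- K s t / p s t ^ N)"
  shows "has_at F (pt z) (tacnode m (n i - 1))"
    and "2 \<le> m \<Longrightarrow> has_at F (pt z) (sing_type (replicate (n i) m))"
proof -
  obtain s' t' where d: "s * t' - t * s' \<noteq> 0" using complementary_direction[OF st(1)] by blast
  define w where "w = - K s t / p s t ^ N"
  have p0: "p s t \<noteq> 0" by (rule p_l[OF i st])
  obtain P Q where P: "\<And>x. poly P x = p (s + x * s') (t + x * t') ^ N"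
    and Q: "\<And>j x. j < m \<Longrightarrow> poly (Q j) x = G j (s + x * s') (t + x * t') - w * p (s + x * s') (t + x * t') ^ N"
    and loc: "local_equation F (pt (vec3 s t w)) (\<Prod>j<m. [:- Q j, P:])"
    using chart[OF d] by blast
  have H0: "H s t = 0" using st(2) i by (auto simp: H_eq_0_iff)
  have Q0: "poly (Q j) 0 = 0" if "j < m" for j
    using Q[OF that, of 0] p0 H0 by (simp add: w_def G_def)
  have cross: "\<exists>r. P * Q b - P * Q a = [:0, 1:] ^ n i * r \<and> poly r 0 \<noteq> 0" if ab: "a < m" "b < m" "a \<noteq> b" for a b
  proof -
    \<comment> \<open>The part of \<open>H * (h b - h a)\<close> left after splitting off
      \<open>l i ^ n i\<close>; it is nonzero at \<open>(s, t)\<close>. The split factor becomes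
      \<open>x ^ n i\<close> times the constant \<open>l i s' t' ^ n i\<close>.\<close>
    let ?f = "\<lambda>s t. (\<Prod>j\<in>{..<k} - {i}. l j s t ^ n j) * (h b s t - h a s t)"
    have "binary_form (n j) (\<lambda>s t. l j s t ^ n j)" if "j \<in> {..<k} - {i}" for j
      using binary_form_power[OF l(1), of j "n j"] that by simp
    then have f: "binary_form ((\<Sum>j\<in>{..<k} - {i}. n j) + 1) ?f"
      using h_diff[OF ab] by (intro binary_form_mult binary_form_prod) auto
    obtain R where R: "\<And>x. poly R x = ?f (s + x * s') (t + x * t')"
      using poly_binary_form[OF f, of "[:s, s':]" "[:t, t':]"] by auto
    define r where "r = smult (l i s' t' ^ n i) (P * R)"
    have "P * Q b - P * Q a = [:0, 1:] ^ n i * r"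
    proof (subst poly_eq_poly_eq_iff[symmetric], rule ext)
      fix x
      have "H (s + x * s') (t + x * t') = (x * l i s' t') ^ n i * (\<Prod>j\<in>{..<k} - {i}. l j (s + x * s') (t + x * t') ^ n j)"
        unfolding H_def using i by (subst prod.remove[of _ i]) (auto simp: linear_form_pencil[OF l(1)[OF i] st(2)])
      moreover have "poly (P * Q b - P * Q a) x = poly P x * (H (s + x * s') (t + x * t')
          * (h b (s + x * s') (t + x * t') - h a (s + x * s') (t + x * t')))"
        using ab(1,2) by (simp add: Q G_def algebra_simps)
      ultimately show "poly (P * Q b - P * Q a) x = poly ([:0, 1:] ^ n i * r) x"
        by (simp add: r_def R power_mult_distrib mult_ac)
    qed
    moreover have "l i s' t' \<noteq> 0" using l(2)[OF i] linear_form_nonzero[OF l(1)[OF i] st(2) d] by blast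
    moreover have "\<forall>j\<in>{..<k} - {i}. l j s t \<noteq> 0" using l_l[OF i _ st] by blast
    moreover have "h b s t - h a s t \<noteq> 0" using h_l[OF i ab(1,2) st] ab(3) by auto
    ultimately show ?thesis using p0 by (intro exI[of _ r]) (simp add: r_def R P)
  qed
  have P0: "poly P 0 \<noteq> 0" using P[of 0] p0 by simp
  \<comment> \<open>Contact exponent \<open>Suc k = n i\<close>; the subtraction is genuine since
    \<open>n i \<ge> 1\<close>.\<close>
  have "tacnode m (n i - 1) (1 * (\<Prod>j<m. [:- Q j, P:]))"
    using n[OF i] by (intro tacnode_branches[where p = "\<lambda>_. P"]) (auto simp: Q0 P0 cross)
  then show "has_at F (pt z) (tacnode m (n i - 1))"
    unfolding has_at_def z_def using loc by (auto simp: w_def)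
  assume "2 \<le> m"
  then have "sing_type (replicate (n i) (card {..<m})) (1 * (\<Prod>j<m. [:- Q j, P:]))"
    by (intro sing_type_branches[where p = "\<lambda>_. P"]) (auto simp: Q0 P0 cross)
  then show "has_at F (pt z) (sing_type (replicate (n i) m))"
    unfolding has_at_def z_def using loc by (auto simp: w_def)
qed

text \<open>By general position exactly two branches pass through the point, and the others go into
  the unit. As no crossing lies on a \<open>Q i\<close>, \<open>H\<close> is nonzero there and the
  two branches differ by a simple zero.\<close>

lemma has_at_node:
  assumes ab: "a < m" "b < m" "a \<noteq> b" and st: "(s, t) \<noteq> (0, 0)" "h a s t = h b s t"
  defines "z \<equiv> vec3 s t (G a s t / p s t ^ N)"
  shows "has_at F (pt z) (tacnode 2 0)" and "has_at F (pt z) (sing_type [2])"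
proof -
  obtain s' t' where d: "s * t' - t * s' \<noteq> 0" using complementary_direction[OF st(1)] by blast
  define w where "w = G a s t / p s t ^ N"
  have p0: "p s t \<noteq> 0" using h_p[OF ab(1,2) st(1) _ st(2)] ab(3) by blast
  have H0: "H s t \<noteq> 0" using h_l[OF _ ab(1,2) st(1) _ st(2)] ab(3) by (auto simp: H_eq_0_iff)
  obtain P Q where P: "\<And>x. poly P x = p (s + x * s') (t + x * t') ^ N"
    and Q: "\<And>j x. j < m \<Longrightarrow> poly (Q j) x = G j (s + x * s') (t + x * t') - w * p (s + x * s') (t + x * t') ^ N"
    and loc: "local_equation F (pt (vec3 s t w)) (\<Prod>j<m. [:- Q j, P:])"
    using chart[OF d] by blast
  \<comment> \<open>Numbers the two branches by 0 and 1, the index set expected for a tacnode with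
    two branches.\<close>
  define c where "c j = (if j = 0 then a else b)" for j :: nat
  define u where "u = (\<Prod>j\<in>{..<m} - {a, b}. [:- Q j, P:])"
  have eq: "(\<Prod>j<m. [:- Q j, P:]) = u * (\<Prod>j<2. [:- Q (c j), P:])"
  proof -
    have "(\<Prod>j<m. [:- Q j, P:]) = u * (\<Prod>j\<in>{a, b}. [:- Q j, P:])"
      unfolding u_def using ab by (intro prod.subset_diff) auto
    then show ?thesis using ab(3) by (simp add: c_def numeral_2_eq_2)
  qed
  have w: "w * p s t ^ N = G a s t" using p0 by (simp add: w_def)
  have u: "eval2 u 0 0 \<noteq> 0"
  proof -
    have "poly (Q j) 0 \<noteq> 0" if j: "j \<in> {..<m} - {a, b}" for j
    proof
      assume "poly (Q j) 0 = 0"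
      then have "h a s t = h j s t" using Q[of j 0] j H0 w by (simp add: G_def)
      then show False using h_h[OF ab(1,2) _ st(1,2), of j] j ab(3) st(2) by auto
    qed
    then show ?thesis by (simp add: u_def)
  qed
  have Q0: "poly (Q (c j)) 0 = 0" for j
    using Q[OF ab(1), of 0] Q[OF ab(2), of 0] st(2) w by (simp add: c_def G_def)
  have cross: "\<exists>r. P * Q (c j) - P * Q (c i) = pCons 0 r \<and> poly r 0 \<noteq> 0"
    if ij: "i < 2" "j < 2" "i \<noteq> j" for i j
  proof -
    have c: "c i < m" "c j < m" "c i \<noteq> c j" "h (c i) s t = h (c j) s t"
      using ab ij st(2) by (auto simp: c_def less_2_cases_iff)
    let ?h = "\<lambda>s t. h (c j) s t - h (c i) s t"
    obtain R where R: "\<And>x. poly R x = H (s + x * s') (t + x * t')"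
      using poly_binary_form[OF H_form, of "[:s, s':]" "[:t, t':]"] by auto
    define r where "r = smult (?h s' t') (P * R)"
    have "P * Q (c j) - P * Q (c i) = pCons 0 r"
    proof (subst poly_eq_poly_eq_iff[symmetric], rule ext)
      fix x
      have "?h (s + x * s') (t + x * t') = x * ?h s' t'"
        using linear_form_pencil[OF h_diff(1)[OF c(1-3)], of s t x s' t'] c(4) by simp
      moreover have "poly (P * Q (c j) - P * Q (c i)) x = poly P x * (H (s + x * s') (t + x * t') * ?h (s + x * s') (t + x * t'))"
        using c(1,2) by (simp add: Q G_def algebra_simps)
      ultimately show "poly (P * Q (c j) - P * Q (c i)) x = poly (pCons 0 r) x"
        by (simp add: r_def R mult_ac)
    qed
    moreover have "?h s' t' \<noteq> 0"
      using h_diff[OF c(1-3)] linear_form_nonzero[OF h_diff(1)[OF c(1-3)] _ d] c(4) by auto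
    ultimately show ?thesis using p0 H0 by (intro exI[of _ r]) (simp add: r_def R P)
  qed
  have P0: "poly P 0 \<noteq> 0" using P[of 0] p0 by simp
  have "tacnode 2 0 (u * (\<Prod>j<2. [:- Q (c j), P:]))"
    by (intro tacnode_branches[where p = "\<lambda>_. P"] u) (auto simp: Q0 P0 cross)
  then show "has_at F (pt z) (tacnode 2 0)"
    unfolding has_at_def z_def using loc eq by (auto simp: w_def)
  have "sing_type (replicate 1 (card {..<2::nat})) (u * (\<Prod>j<2. [:- Q (c j), P:]))"
    by (intro sing_type_branches[where p = "\<lambda>_. P"] u) (auto simp: Q0 P0 cross)
  then show "has_at F (pt z) (sing_type [2])"
    unfolding has_at_def z_def using loc eq by (auto simp: w_def simp del: sing_type.simps)
qed

text \<open>The lowest term of every factor is \<open>x ^ N\<close>, with \<open>x\<close> the value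
  of \<open>p\<close>, since \<open>G j\<close> has degree \<open>N + 1\<close>. This gives
  multiplicity \<open>m * N\<close> and \<open>x = 0\<close> as the only tangent. After the blow-up
  the numerators coincide and the denominators differ, the reverse of the situation over a root of
  \<open>l i\<close>.\<close>

lemma has_at_vertex:
  "has_at F (pt (vec3 0 0 1)) (blow_down_tacnode m (N - 1))"
  "2 \<le> m \<Longrightarrow> has_at F (pt (vec3 0 0 1)) (sing_type (m * N # replicate N m))"
proof -
  obtain s t where st: "(s, t) \<noteq> (0, 0)" "p s t = 0" by (rule p_root)
  obtain s1 t1 where d1: "s * t1 - t * s1 \<noteq> 0" using complementary_direction[OF st(1)] by blast
  obtain x0 y0 where "p x0 y0 \<noteq> 0" using p(2) by blast
  then have p1: "p s1 t1 \<noteq> 0" by (rule linear_form_nonzero[OF p(1) st(2) d1])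
  \<comment> \<open>Normalized so that \<open>p\<close> becomes exactly the first affine coordinate
    at the vertex.\<close>
  define s' t' where "s' = s1 / p s1 t1" and "t' = t1 / p s1 t1"
  have p': "p s' t' = 1"
    using binary_form_homogeneous[OF p(1), of "1 / p s1 t1" s1 t1] p1 by (simp add: s'_def t'_def)
  have d: "s' * t - t' * s \<noteq> 0" using d1 p1 by (simp add: s'_def t'_def field_simps)
  have "\<forall>j. \<exists>g. j < m \<longrightarrow> (\<forall>x y. eval2 g x y = G j (x * s' + y * s) (x * t' + y * t))"
    using eval2_binary_form[OF G_form, of _ "pX * pC s' + pY * pC s" "pX * pC t' + pY * pC t"] by auto
  then obtain g where g: "\<And>j x y. j < m \<Longrightarrow> eval2 (g j) x y = G j (x * s' + y * s) (x * t' + y * t)" by metis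
  define f where "f = (\<Prod>j<m. pX ^ N - g j)"
  have ppow: "p (x * s' + y * s) (x * t' + y * t) = x" for x y
  proof -
    have "p (y * s + x * s') (y * t + x * t') = x * p s' t'"
      by (rule linear_form_pencil[OF p(1)]) (simp add: binary_form_homogeneous[OF p(1)] st(2))
    then show ?thesis using p' by (simp add: add.commute)
  qed
  have loc: "local_equation F (pt (vec3 0 0 1)) f"
    unfolding local_equation_def
  proof (intro exI conjI allI)
    show "det (vector [vec3 0 0 1, vec3 s' t' 0, vec3 s t 0] :: complex^3^3) \<noteq> 0"
      using d by (simp add: det_3)
    fix x y
    show "F (vec3 0 0 1 + x *s vec3 s' t' 0 + y *s vec3 s t 0) = eval2 f x y"
      unfolding F_def f_def eval2_prod by (intro prod.cong) (auto simp: g ppow)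
  qed simp
  have "\<forall>j. \<exists>q. j < m \<longrightarrow> (\<forall>x. poly q x = - G j (x * s' + s) (x * t' + t))"
    using poly_binary_form[OF binary_form_cmult[OF G_form, of _ "-1"], of _ "[:s, s':]" "[:t, t':]"]
    by (simp add: add.commute)
  then obtain P where P: "\<And>j x. j < m \<Longrightarrow> poly (P j) x = - G j (x * s' + s) (x * t' + t)" by metis
  \<comment> \<open>The signs of \<open>P j\<close> and \<open>Q\<close> are chosen so that
    \<open>[:- Q, P j:]\<close> is \<open>x ^ N - y * G j\<close>, restricted to the pencil
    \<open>(x s' + s, x t' + t)\<close>.\<close>
  define Q :: "complex poly" where "Q = - ([:0, 1:] ^ N)"
  have hom: "G j (y * a) (y * b) = y ^ Suc N * G j a b" if "j < m" for j y a b
    by (rule binary_form_homogeneous[OF G_form[OF that]])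
  have sub: "subst2 f (pX * pY) pY = pY ^ (m * N) * (\<Prod>j<m. [:- Q, P j:])"
  proof (rule eval2_eqI)
    fix x y
    have "(x * y) ^ N - eval2 (g j) (x * y) y = y ^ N * eval2 [:- Q, P j:] x y" if "j < m" for j
      using hom[OF that, of y "x * s' + s" "x * t' + t"] g[OF that, of "x * y" y]
      by (simp add: Q_def P[OF that] algebra_simps power_mult_distrib)
    then have "(\<Prod>j<m. (x * y) ^ N - eval2 (g j) (x * y) y) = (\<Prod>j<m. y ^ N * eval2 [:- Q, P j:] x y)"
      by (intro prod.cong) auto
    also have "\<dots> = (y ^ N) ^ m * (\<Prod>j<m. eval2 [:- Q, P j:] x y)" by (simp only: prod.distrib prod_constant card_lessThan)
    finally show "eval2 (subst2 f (pX * pY) pY) x y = eval2 (pY ^ (m * N) * (\<Prod>j<m. [:- Q, P j:])) x y"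
      by (simp add: f_def power_mult mult.commute[of m] del: eval2_simps(11))
  qed
  \<comment> \<open>All branches vanish at the new origin, so nonvanishing along the exceptional
    curve is tested at \<open>x = 1\<close>.\<close>
  have nz: "eval2 (\<Prod>j<m. [:- Q, P j:]) 1 0 \<noteq> 0" by (simp add: Q_def)
  have mult: "mult0 f = m * N" by (rule mult0_eqI[OF sub nz])
  have None: "proper_transform f None = 1 * (\<Prod>j<m. [:- Q, P j:])"
    using proper_transform_NoneI[OF sub nz] by simp
  have Some: "mult0 (proper_transform f (Some c)) = 0" for c
  proof -
    have "\<forall>j. \<exists>g. j < m \<longrightarrow> (\<forall>x y. eval2 g x y = G j (s' + (y + c) * s) (t' + (y + c) * t))"
      using eval2_binary_form[OF G_form, of _ "pC s' + (pY + pC c) * pC s" "pC t' + (pY + pC c) * pC t"] by auto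
    then obtain g' where g': "\<And>j x y. j < m \<Longrightarrow> eval2 (g' j) x y = G j (s' + (y + c) * s) (t' + (y + c) * t)" by metis
    \<comment> \<open>At a finite slope each factor is \<open>x ^ N\<close> times
      \<open>1 - x * g' j\<close>, which equals 1 on the exceptional curve; the transform does not
      meet it there.\<close>
    have "subst2 f pX (pX * (pY + pC c)) = pX ^ mult0 f * (\<Prod>j<m. 1 - pX * g' j)"
    proof (rule eval2_eqI)
      fix x y
      have "x ^ N - eval2 (g j) x (x * (y + c)) = x ^ N * (1 - x * eval2 (g' j) x y)" if "j < m" for j
        using hom[OF that, of x "s' + (y + c) * s" "t' + (y + c) * t"] g[OF that, of x "x * (y + c)"]
        by (simp add: g'[OF that] algebra_simps)
      then have "(\<Prod>j<m. x ^ N - eval2 (g j) x (x * (y + c))) = (\<Prod>j<m. x ^ N * (1 - x * eval2 (g' j) x y))"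
        by (intro prod.cong) auto
      also have "\<dots> = (x ^ N) ^ m * (\<Prod>j<m. 1 - x * eval2 (g' j) x y)" by (simp only: prod.distrib prod_constant card_lessThan)
      finally show "eval2 (subst2 f pX (pX * (pY + pC c))) x y = eval2 (pX ^ mult0 f * (\<Prod>j<m. 1 - pX * g' j)) x y"
        by (simp add: f_def mult[unfolded f_def] power_mult mult.commute[of m])
    qed
    then have "proper_transform f (Some c) = (\<Prod>j<m. 1 - pX * g' j)" by (rule proper_transform_SomeI)
    then show ?thesis by (simp add: mult0_eq_0 del: proper_transform.simps)
  qed
  have other: "mult0 (proper_transform f e) = 0" if "e \<noteq> None" for e
    using Some that by (cases e) (auto simp del: proper_transform.simps)
  have P0: "poly (P j) 0 \<noteq> 0" if "j < m" for j
    using P[OF that, of 0] G_nonzero[OF that st] by simp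
  have Q0: "poly Q 0 = 0" using N_pos by (simp add: Q_def)
  have cross: "\<exists>r. P a * Q - P b * Q = [:0, 1:] ^ N * r \<and> poly r 0 \<noteq> 0" if ab: "a < m" "b < m" "a \<noteq> b" for a b
  proof (intro exI conjI)
    show "P a * Q - P b * Q = [:0, 1:] ^ N * (P b - P a)" by (simp add: Q_def algebra_simps)
    have "H s t \<noteq> 0" using p_l[OF _ st(1)] st(2) by (auto simp: H_eq_0_iff)
    then show "poly (P b - P a) 0 \<noteq> 0"
      using P[OF ab(1), of 0] P[OF ab(2), of 0] h_p[OF ab(1,2) st] ab(3) by (auto simp: G_def)
  qed
  have "tacnode m (N - 1) (1 * (\<Prod>j<m. [:- Q, P j:]))"
    using N_pos by (intro tacnode_branches[where q = "\<lambda>_. Q"]) (auto simp: Q0 P0 cross)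
  then have "blow_down_tacnode m (N - 1) f"
    unfolding blow_down_tacnode_def None[symmetric] using other by blast
  then show "has_at F (pt (vec3 0 0 1)) (blow_down_tacnode m (N - 1))" using loc by (auto simp: has_at_def)
  assume m2: "2 \<le> m"
  then have "sing_type (replicate N (card {..<m})) (1 * (\<Prod>j<m. [:- Q, P j:]))"
    by (intro sing_type_branches[where q = "\<lambda>_. Q"]) (auto simp: Q0 P0 cross)
  then have "sing_type (replicate N m) (proper_transform f None)" unfolding None by simp
  moreover have "1 < m * N" using m2 N_pos by (metis One_nat_def Suc_1 Suc_le_lessD less_le_trans mult.right_neutral mult_le_mono2 Suc_leI)
  ultimately have "sing_type (m * N # replicate N m) f"
    using other mult by (auto simp del: proper_transform.simps intro!: exI[of _ None])
  then show "has_at F (pt (vec3 0 0 1)) (sing_type (m * N # replicate N m))" using loc by (auto simp: has_at_def)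
qed

end

section \<open>The complete list of singular points\<close>

lemma singular_pointsI: "has_at F p (sing_type (t # ts)) \<Longrightarrow> p \<in> singular_points F"
  by (auto simp: singular_points_def has_at_def)

lemma finite_if_all_equal: "(\<And>x y. x \<in> A \<Longrightarrow> y \<in> A \<Longrightarrow> x = y) \<Longrightarrow> finite A"
  by (cases "A = {}") (metis finite.simps insertI1 singletonD subsetI finite_subset all_not_in_conv)+

context twisted_lines
begin

definition vertex :: "(complex^3) set" where
  "vertex = pt (vec3 0 0 1)"

text \<open>A choice of homogeneous coordinates; rescaling them does not change the point
  \<open>tac i\<close>.\<close>

definition root :: "nat \<Rightarrow> complex \<times> complex" where
  "root i = (SOME x. x \<noteq> (0, 0) \<and> l i (fst x) (snd x) = 0)"

definition tac :: "nat \<Rightarrow> (complex^3) set" where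
  "tac i = (case root i of (s, t) \<Rightarrow> pt (vec3 s t (- K s t / p s t ^ N)))"

text \<open>A set over all representatives, which avoids choosing a root of
  \<open>h b - h a\<close>. For distinct \<open>a, b < m\<close> its elements coincide.\<close>

definition node :: "nat \<Rightarrow> nat \<Rightarrow> (complex^3) set set" where
  "node a b = {pt (vec3 s t (G a s t / p s t ^ N)) | s t. (s, t) \<noteq> (0, 0) \<and> h a s t = h b s t}"

definition nodes :: "(complex^3) set set" where
  "nodes = (\<Union>a<m. \<Union>b\<in>{..<m} - {a}. node a b)"

lemma tacE:
  assumes "i < k"
  obtains s t where "(s, t) \<noteq> (0, 0)" "l i s t = 0" "tac i = pt (vec3 s t (- K s t / p s t ^ N))"
proof -
  obtain s t where "(s, t) \<noteq> (0, 0)" "l i s t = 0" by (rule linear_form_root[OF l(1)[OF assms]])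
  then have "\<exists>x. x \<noteq> (0, 0) \<and> l i (fst x) (snd x) = 0" by (intro exI[of _ "(s, t)"]) simp
  then have "root i \<noteq> (0, 0) \<and> l i (fst (root i)) (snd (root i)) = 0" unfolding root_def by (rule someI_ex)
  then show ?thesis using that[of "fst (root i)" "snd (root i)"] by (simp add: tac_def case_prod_beta)
qed

lemma nodesE:
  assumes "x \<in> nodes"
  obtains a b s t where "a < m" "b < m" "a \<noteq> b" "(s, t) \<noteq> (0, 0)" "h a s t = h b s t"
    "x = pt (vec3 s t (G a s t / p s t ^ N))" "p s t \<noteq> 0" "H s t \<noteq> 0"
proof -
  obtain a b s t where *: "a < m" "b < m" "a \<noteq> b" "(s, t) \<noteq> (0, 0)" "h a s t = h b s t"
    "x = pt (vec3 s t (G a s t / p s t ^ N))"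
    using assms by (auto simp: nodes_def node_def)
  moreover have "p s t \<noteq> 0" using h_p[of a b s t] * by blast
  moreover have "H s t \<noteq> 0" using h_l[of _ a b s t] * by (auto simp: H_eq_0_iff)
  ultimately show ?thesis by (rule that)
qed

text \<open>Solving \<open>p ^ N * w = f\<close> gives \<open>w\<close> the weight
  \<open>(N + 1) - N = 1\<close>, so it rescales together with the base coordinates.\<close>

lemma pt_eq_scaled:
  fixes z :: "complex^3"
  assumes "c \<noteq> 0" "z $ 1 = c * s" "z $ 2 = c * t" "p s t \<noteq> 0" "binary_form (Suc N) f"
    "p (z $ 1) (z $ 2) ^ N * z $ 3 = f (z $ 1) (z $ 2)"
  shows "pt z = pt (vec3 s t (f s t / p s t ^ N))"
proof -
  have "c ^ N * (p s t ^ N * z $ 3) = c ^ N * (c * f s t)"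
    using assms(6) by (simp add: assms(2,3) binary_form_homogeneous[OF p(1)] binary_form_homogeneous[OF assms(5)]
      power_mult_distrib)
  then have "z $ 3 = c * (f s t / p s t ^ N)" using assms(1,4) by (simp add: field_simps)
  then have "z = c *s vec3 s t (f s t / p s t ^ N)" using assms(2,3) by (simp add: vec3_eq_iff)
  then show ?thesis using pt_scale[OF assms(1)] by simp
qed

lemma pt_eq_tac:
  fixes z :: "complex^3"
  assumes "i < k" "(z $ 1, z $ 2) \<noteq> (0, 0)" "l i (z $ 1) (z $ 2) = 0"
    "p (z $ 1) (z $ 2) ^ N * z $ 3 = - K (z $ 1) (z $ 2)"
  shows "pt z = tac i"
proof -
  obtain s t where st: "(s, t) \<noteq> (0, 0)" "l i s t = 0" "tac i = pt (vec3 s t (- K s t / p s t ^ N))"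
    using tacE[OF assms(1)] by blast
  obtain x y where "l i x y \<noteq> 0" using l(2)[OF assms(1)] by blast
  then obtain c where "c \<noteq> 0" "z $ 1 = c * s" "z $ 2 = c * t"
    using linear_form_roots_proportional[OF l(1)[OF assms(1)] _ st(2) assms(3) st(1) assms(2)] by blast
  then show ?thesis unfolding st(3)
    using p_l[OF assms(1) st(1,2)] binary_form_cmult[OF K, of "-1"] assms(4)
    by (intro pt_eq_scaled[where f = "\<lambda>s t. - K s t"]) auto
qed

lemma finite_nodes: "finite nodes"
proof -
  have "finite (node a b)" if ab: "a < m" "b < m" "a \<noteq> b" for a b
  proof (rule finite_if_all_equal)
    fix x y assume "x \<in> node a b" "y \<in> node a b"
    then obtain s t s' t' where st: "(s, t) \<noteq> (0, 0)" "h a s t = h b s t" "x = pt (vec3 s t (G a s t / p s t ^ N))"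
      "(s', t') \<noteq> (0, 0)" "h a s' t' = h b s' t'" "y = pt (vec3 s' t' (G a s' t' / p s' t' ^ N))"
      by (auto simp: node_def)
    obtain u v where "h b u v - h a u v \<noteq> 0" using h_diff(2)[OF ab] by blast
    then obtain c where "c \<noteq> 0" "s' = c * s" "t' = c * t"
      using linear_form_roots_proportional[OF h_diff(1)[OF ab], of u v s t s' t'] st by auto
    moreover have "p s t \<noteq> 0" "p s' t' \<noteq> 0" using h_p[OF ab(1,2)] st ab(3) by blast+
    ultimately show "x = y" unfolding st(3,6)
      by (intro pt_eq_scaled[OF _ _ _ _ G_form[OF ab(1)], symmetric, of c]) simp_all
  qed
  then show ?thesis unfolding nodes_def by auto
qed

text \<open>Away from the vertex every factor is linear in the third coordinate with slope
  \<open>p ^ N \<noteq> 0\<close>. If only one factor vanished, it would be a simple zero and the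
  derivative would not be 0. Two vanishing factors give \<open>H * (h a - h b) = 0\<close>, which
  separates the points over the roots of the \<open>l i\<close> from the nodes.\<close>

lemma singular_cases:
  fixes z :: "complex^3"
  assumes z: "z \<noteq> 0" "F z = 0" and D: "((\<lambda>x. F (z + x *s vec3 0 0 1)) has_field_derivative 0) (at 0)"
  shows "pt z \<in> tac ` {..<k} \<union> {vertex} \<union> nodes"
proof (cases "(z $ 1, z $ 2) = (0, 0)")
  case True
  then have "z = z $ 3 *s vec3 0 0 1" "z $ 3 \<noteq> 0" using z(1) by (auto simp: vec3_eq_iff)
  then have "pt z = vertex" unfolding vertex_def by (metis pt_scale)
  then show ?thesis by simp
next
  case base: False
  let ?s = "z $ 1" and ?t = "z $ 2"
  define E where "E j = p ?s ?t ^ N * z $ 3 - G j ?s ?t" for j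
  have p0: "p ?s ?t \<noteq> 0" by (rule F_zero_base[OF z(2) base])
  obtain a where a: "a < m" "E a = 0" using z(2) by (auto simp: F_zero_iff E_def)
  have "\<exists>b<m. b \<noteq> a \<and> E b = 0"
  proof (rule ccontr)
    assume none: "\<not> (\<exists>b<m. b \<noteq> a \<and> E b = 0)"
    define q where "q = (\<Prod>j\<in>{..<m} - {a}. [:E j, p ?s ?t ^ N:])"
    have "F (z + x *s vec3 0 0 1) = x * (p ?s ?t ^ N * poly q x)" for x
    proof -
      have "F (z + x *s vec3 0 0 1) = (\<Prod>j<m. E j + x * p ?s ?t ^ N)"
        unfolding F_def by (intro prod.cong) (auto simp: E_def algebra_simps)
      also have "\<dots> = (E a + x * p ?s ?t ^ N) * (\<Prod>j\<in>{..<m} - {a}. E j + x * p ?s ?t ^ N)"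
        using a(1) by (intro prod.remove) auto
      finally show ?thesis by (simp add: q_def a(2) poly_prod)
    qed
    moreover have "((\<lambda>x. x * (p ?s ?t ^ N * poly q x)) has_field_derivative p ?s ?t ^ N * poly q 0) (at 0)"
      using DERIV_mult[OF DERIV_ident DERIV_cmult[OF poly_DERIV[of q 0], of "p ?s ?t ^ N"]] by simp
    ultimately have "p ?s ?t ^ N * poly q 0 = 0" using D DERIV_unique by (metis (no_types, lifting) ext)
    then show False using p0 none by (auto simp: q_def poly_prod)
  qed
  then obtain b where b: "b < m" "b \<noteq> a" "E b = 0" by blast
  then have "H ?s ?t * (h a ?s ?t - h b ?s ?t) = 0" using a(2) by (auto simp: E_def G_def algebra_simps)
  then consider "H ?s ?t = 0" | "h a ?s ?t = h b ?s ?t" by auto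
  then show ?thesis
  proof cases
    case 1
    then obtain i where i: "i < k" "l i ?s ?t = 0" by (auto simp: H_eq_0_iff)
    have "pt z = tac i" using a(2) 1 by (intro pt_eq_tac i base) (simp add: E_def G_def eq_neg_iff_add_eq_0)
    then show ?thesis using i(1) by blast
  next
    case 2
    have "pt z = pt (vec3 ?s ?t (G a ?s ?t / p ?s ?t ^ N))"
      using a by (intro pt_eq_scaled[OF _ _ _ p0 G_form[OF a(1)], of 1]) (auto simp: E_def)
    then have "pt z \<in> node a b" unfolding node_def using base 2 by blast
    then show ?thesis using a(1) b(1,2) unfolding nodes_def by blast
  qed
qed

lemma squarefree_F: "squarefree_form (m * (N + 1)) F"
proof (rule squarefree_formI[OF F_form F_nonzero _ _ singular_cases])
  show "finite (tac ` {..<k} \<union> {vertex} \<union> nodes)" using finite_nodes by simp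
  fix x assume "x \<in> tac ` {..<k} \<union> {vertex} \<union> nodes"
  then consider i where "i < k" "x = tac i" | "x = vertex" | "x \<in> nodes" by blast
  then show "\<exists>z. z \<noteq> 0 \<and> x = pt z"
  proof cases
    case 1
    obtain s t where "(s, t) \<noteq> (0, 0)" "x = pt (vec3 s t (- K s t / p s t ^ N))"
      using tacE[OF 1(1)] 1(2) by metis
    then show ?thesis by (intro exI[of _ "vec3 s t (- K s t / p s t ^ N)"]) (auto simp: vec3_eq_iff)
  next
    case 2
    then show ?thesis unfolding vertex_def by (intro exI[of _ "vec3 0 0 1"]) (auto simp: vec3_eq_iff)
  next
    case 3
    then obtain a b s t where "(s, t) \<noteq> (0, 0)" "x = pt (vec3 s t (G a s t / p s t ^ N))" by (rule nodesE)
    then show ?thesis by (intro exI[of _ "vec3 s t (G a s t / p s t ^ N)"]) (auto simp: vec3_eq_iff)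
  qed
qed

lemma has_at_tac:
  assumes "i < k"
  shows "has_at F (tac i) (tacnode m (n i - 1))"
    and "2 \<le> m \<Longrightarrow> has_at F (tac i) (sing_type (replicate (n i) m))"
  using tacE[OF assms] has_at_tacnode[OF assms] by metis+

lemma has_at_nodes:
  assumes "x \<in> nodes"
  shows "has_at F x (tacnode 2 0)" "has_at F x (sing_type [2])"
  using nodesE[OF assms] has_at_node by metis+

lemma singular_points_F:
  assumes "2 \<le> m" shows "singular_points F = tac ` {..<k} \<union> {vertex} \<union> nodes"
proof
  show "singular_points F \<subseteq> tac ` {..<k} \<union> {vertex} \<union> nodes"
  proof
    fix x assume "x \<in> singular_points F"
    then obtain z where "z \<noteq> 0" "x = pt z" "F z = 0"
      "((\<lambda>x. F (z + x *s vec3 0 0 1)) has_field_derivative 0) (at 0)"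
      by (rule singular_point_derivative[OF F_form])
    then show "x \<in> tac ` {..<k} \<union> {vertex} \<union> nodes" using singular_cases by simp
  qed
  have "tac i \<in> singular_points F" if i: "i < k" for i
  proof -
    obtain r where "n i = Suc r" using n[OF i] by (cases "n i") auto
    then show ?thesis using has_at_tac(2)[OF i assms] by (auto intro: singular_pointsI)
  qed
  moreover have "vertex \<in> singular_points F"
    using has_at_vertex(2)[OF assms] unfolding vertex_def by (rule singular_pointsI)
  moreover have "x \<in> singular_points F" if "x \<in> nodes" for x
    using has_at_nodes(2)[OF that] by (rule singular_pointsI)
  ultimately show "tac ` {..<k} \<union> {vertex} \<union> nodes \<subseteq> singular_points F" by blast
qed

text \<open>Projection from \<open>[0:0:1]\<close> tells the points apart: it is undefined at the
  vertex, sends \<open>tac i\<close> to the root of \<open>l i\<close>, and sends nodes to places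
  where \<open>H\<close> is nonzero.\<close>

lemma singular_points_distinct:
  "inj_on tac {..<k}" "vertex \<notin> tac ` {..<k}" "(tac ` {..<k} \<union> {vertex}) \<inter> nodes = {}"
proof -
  have scale: "f (c * s) (c * t) = 0 \<longleftrightarrow> f s t = 0" if "binary_form d f" "c \<noteq> 0" for d f and c s t :: complex
    using binary_form_homogeneous[OF that(1), of c s t] that(2) by simp
  show "inj_on tac {..<k}"
  proof (rule inj_onI)
    fix i j assume ij: "i \<in> {..<k}" "j \<in> {..<k}" "tac i = tac j"
    obtain s t where st: "(s, t) \<noteq> (0, 0)" "l i s t = 0" "tac i = pt (vec3 s t (- K s t / p s t ^ N))"
      using tacE[of i] ij by auto
    obtain s' t' where st': "(s', t') \<noteq> (0, 0)" "l j s' t' = 0" "tac j = pt (vec3 s' t' (- K s' t' / p s' t' ^ N))"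
      using tacE[of j] ij by auto
    obtain c where "c \<noteq> 0" "vec3 s t (- K s t / p s t ^ N) = c *s vec3 s' t' (- K s' t' / p s' t' ^ N)"
      using st(3) st'(3) ij(3) pt_eqE by metis
    then have "l j s t = 0" using st'(2) scale[OF l(1), of j c s' t'] ij(2) by (simp add: vec3_eq_iff)
    then show "i = j" using l_l[OF _ _ st(1,2)] ij by simp
  qed
  show "vertex \<notin> tac ` {..<k}"
  proof
    assume "vertex \<in> tac ` {..<k}"
    then obtain i where i: "i < k" "vertex = tac i" by blast
    obtain s t where st: "(s, t) \<noteq> (0, 0)" "tac i = pt (vec3 s t (- K s t / p s t ^ N))"
      using tacE[OF i(1)] by metis
    obtain c where "c \<noteq> 0" "vec3 s t (- K s t / p s t ^ N) = c *s vec3 0 0 1"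
      using st(2) i(2) pt_eqE unfolding vertex_def by metis
    then show False using st(1) by (simp add: vec3_eq_iff)
  qed
  show "(tac ` {..<k} \<union> {vertex}) \<inter> nodes = {}"
  proof (rule ccontr)
    assume "(tac ` {..<k} \<union> {vertex}) \<inter> nodes \<noteq> {}"
    then obtain x where x: "x \<in> nodes" "x \<in> tac ` {..<k} \<union> {vertex}" by blast
    obtain a b s t where st: "(s, t) \<noteq> (0, 0)" "x = pt (vec3 s t (G a s t / p s t ^ N))" "H s t \<noteq> 0"
      using nodesE[OF x(1)] by metis
    show False
    proof (cases "x = vertex")
      case True
      then obtain c where "vec3 s t (G a s t / p s t ^ N) = c *s vec3 0 0 1"
        using st(2) pt_eqE unfolding vertex_def by metis
      then show False using st(1) by (simp add: vec3_eq_iff)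
    next
      case False
      then obtain i where i: "i < k" "x = tac i" using x(2) by blast
      obtain s' t' where st': "l i s' t' = 0" "tac i = pt (vec3 s' t' (- K s' t' / p s' t' ^ N))"
        using tacE[OF i(1)] by metis
      obtain c where "c \<noteq> 0" "vec3 s t (G a s t / p s t ^ N) = c *s vec3 s' t' (- K s' t' / p s' t' ^ N)"
        using st(2) st'(2) i(2) pt_eqE by metis
      then have "l i s t = 0" using st'(1) scale[OF l(1)[OF i(1)], of c s' t'] by (simp add: vec3_eq_iff)
      then show False using st(3) i(1) by (auto simp: H_eq_0_iff)
    qed
  qed
qed

end

section \<open>The Cremona transformation\<close>

lemma pairing_add: "pairing a (z + w) = pairing a z + pairing a w"
  and pairing_scale: "pairing a (c *s z) = c * pairing a z"
  by (simp_all add: pairing_def sum_3 algebra_simps)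

lemma pairing_diff: "pairing a (z - w) = pairing a z - pairing a w"
  by (simp add: pairing_def sum_3 algebra_simps)

lemma fiber_eq_linear: "fiber_eq A B a s t = pairing a A * s + pairing a B * t"
  by (simp add: fiber_eq_def pairing_add pairing_scale mult.commute)

lemma fiber_eq_form: "binary_form 1 (fiber_eq A B a)"
  using binary_form_linear[of "pairing a A" "pairing a B"] by (simp add: fiber_eq_linear[abs_def])

text \<open>
  At a common point of two lines of \<open>C\<close> the differential of an equation of \<open>C\<close> vanishes on both lines,
  hence everywhere.
\<close>

lemma not_transversal_at_crossing:
  assumes tr: "meets_transversally X C" and z: "z \<in> X" "z \<in> line a" "z \<in> line b"
    and C: "line a \<subseteq> C" "line b \<subseteq> C" and e: "pairing a e = 0" "pairing b e \<noteq> 0"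
  shows False
proof -
  obtain d F where F: "curve_equation C d F" and "\<forall>z\<in>X \<inter> C. \<exists>w\<in>X. deriv (\<lambda>x. F (z + x *s w)) 0 \<noteq> 0"
    using tr by (auto simp: meets_transversally_def)
  then obtain w where w: "deriv (\<lambda>x. F (z + x *s w)) 0 \<noteq> 0" using z C by blast
  have form: "form d F" and zero: "\<And>y. y \<in> C \<Longrightarrow> F y = 0"
    using F by (auto simp: curve_equation_def squarefree_form_def)
  \<comment> \<open>A line as a set omits the zero vector. The value there is needed because
    \<open>F\<close> is evaluated below on the full planes of both lines.\<close>
  have "F (0 *s z) = 0 ^ d * F z" by (rule form_homogeneous[OF form])
  then have F0: "F 0 = 0" using zero z C by auto
  have plane: "F y = 0" if "pairing a y = 0 \<or> pairing b y = 0" for y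
    using that zero C F0 by (cases "y = 0") (auto simp: line_def)
  \<comment> \<open>Splits \<open>w\<close> into a direction along each line: the multiple of
    \<open>e\<close> is chosen so that the rest lies in the plane of \<open>b\<close>. As
    \<open>F\<close> vanishes on both planes, both partial derivatives are 0.\<close>
  define w1 where "w1 = (pairing b w / pairing b e) *s e"
  define w2 where "w2 = w - w1"
  have w12: "pairing a w1 = 0" "pairing b w2 = 0"
    using e by (simp_all add: w1_def w2_def pairing_scale pairing_diff)
  obtain f where f: "\<And>x y. F (z + x *s w1 + y *s w2) = eval2 f x y"
    using eval2_form[OF form, of z w1 w2] by auto
  have z0: "pairing a z = 0" "pairing b z = 0" using z by (auto simp: line_def)
  have "eval2 f x 0 = 0" "eval2 f 0 x = 0" for x
    using f[of x 0] f[of 0 x] w12 z0 by (auto simp: plane pairing_add pairing_scale)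
  then have c: "coeff (coeff f 0) 1 = 0" "coeff (coeff f 1) 0 = 0"
    using eval2_DERIV[of "\<lambda>x. x" 1 "\<lambda>x. 0" 0 f] eval2_DERIV[of "\<lambda>x. 0" 0 "\<lambda>x. x" 1 f]
    by (auto dest: DERIV_unique[OF DERIV_const])
  have "z + x *s w = z + x *s w1 + x *s w2" for x
    by (simp add: w2_def vec_eq_iff right_diff_distrib)
  then have "F (z + x *s w) = eval2 f x x" for x by (simp only: f)
  then have "((\<lambda>x. F (z + x *s w)) has_field_derivative 0) (at 0)"
    using eval2_DERIV[of "\<lambda>x. x" 1 "\<lambda>x. x" 1 f] c by simp
  then show False using w DERIV_imp_deriv by blast
qed

text \<open>The set whose closure is taken already equals the family of sections, which has no
  points with \<open>v = 0\<close> and is relatively closed; so the closure adds nothing in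
  \<open>hcarrier\<close>.\<close>

lemma plane_blow_up_sections:
  assumes "finite J" "\<And>j. j \<in> J \<Longrightarrow> cone (D j)" "binary_form 1 p" "\<And>j. j \<in> J \<Longrightarrow> binary_form 1 (h j)"
    and eq: "\<And>s t u v. (s, t) \<noteq> (0, 0) \<Longrightarrow> v \<noteq> 0 \<Longrightarrow>
      (v * s) *s A + (v * t) *s B + u *s R \<in> C \<longleftrightarrow> (\<exists>j\<in>J. (s, t) \<in> D j \<and> u = h j s t * v)"
  shows "plane_blow_up A B R C = sections p 0 J D h"
proof -
  obtain X where X: "closed X" "sections p 0 J D h = hcarrier \<inter> X"
    using sections_closed[of J D 1 p 1 h 0] assms(1-4) by auto
  let ?A = "{(s, t, u, v). (s, t, u, v) \<in> hcarrier \<and> v \<noteq> 0 \<and> to_plane A B R (s, t, u, v) \<in> C}"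
  have "?A = sections p 0 J D h"
    using eq by (fastforce simp: sections_def hcarrier_def to_plane_def)
  then have A: "?A = hcarrier \<inter> X" using X(2) by simp
  have "closure ?A \<subseteq> X" unfolding A by (intro closure_minimal X(1)) auto
  moreover have "hcarrier \<inter> X \<subseteq> closure ?A" using closure_subset[of ?A] unfolding A .
  ultimately have "hcarrier \<inter> closure ?A = hcarrier \<inter> X" by auto
  then show ?thesis unfolding plane_blow_up_def X(2) .
qed

lemma prod_list_concat_replicate:
  "(\<Prod>f\<leftarrow>concat (map (\<lambda>i. replicate (n i) (l i)) [0..<k]). f s t) = (\<Prod>i<k. (l i s t :: complex) ^ n i)"
  by (induction k) (simp_all add: prod_list_replicate map_replicate)

lemma to_top_sections:
  assumes J: "finite J" "\<And>j. j \<in> J \<Longrightarrow> cone (D j)" "binary_form 1 p" "\<And>j. j \<in> J \<Longrightarrow> binary_form 1 (h j)"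
    and C: "plane_blow_up A B R C = sections p 0 J D h"
  shows "to_top A B R k n Q C = sections p 0 J D (\<lambda>j s t. (\<Prod>i<k. fiber_eq A B (Q i) s t ^ n i) * h j s t)"
proof -
  have "binary_form 1 f" if "f \<in> set (concat (map (\<lambda>i. replicate (n i) (fiber_eq A B (Q i))) [0..<k]))" for f
  proof -
    obtain i where "f = fiber_eq A B (Q i)" using \<open>f \<in> _\<close> by auto
    then show ?thesis by (simp only: fiber_eq_form)
  qed
  then show ?thesis unfolding to_top_def C
    by (subst first_steps_sections[OF J(1,2,3) _ J(4)]) (auto simp: prod_list_concat_replicate)
qed

lemma cremona_T_sections:
  assumes J: "finite J" "\<And>j. j \<in> J \<Longrightarrow> cone (D j)" "\<And>j. j \<in> J \<Longrightarrow> binary_form 1 (h j)"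
    and C: "plane_blow_up A B R C = sections (fiber_eq A B P) 0 J D h"
    and N: "N = (\<Sum>i<k. n i)" and g: "\<And>j. j < N \<Longrightarrow> binary_form (N + 1 - j) (g j)"
    and centre: "\<And>j s t. j \<in> J \<Longrightarrow> (s, t) \<in> D j \<Longrightarrow> (s, t) \<noteq> (0, 0) \<Longrightarrow> fiber_eq A B P s t = 0 \<Longrightarrow> 0 < N \<Longrightarrow>
      (\<Prod>i<k. fiber_eq A B (Q i) s t ^ n i) * h j s t \<noteq> g 0 s t"
  shows "cremona_T A B R k n Q P g C = plane_blow_down (sections (fiber_eq A B P) N J D
    (\<lambda>j s t. (\<Prod>i<k. fiber_eq A B (Q i) s t ^ n i) * h j s t - (\<Sum>i<N. fiber_eq A B P s t ^ i * g i s t)))"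
proof -
  have "binary_form (n i) (\<lambda>s t. fiber_eq A B (Q i) s t ^ n i)" for i
    using binary_form_power[OF fiber_eq_form, of "n i"] by simp
  then have "binary_form N (\<lambda>s t. \<Prod>i<k. fiber_eq A B (Q i) s t ^ n i)"
    unfolding N by (intro binary_form_prod) auto
  then have H: "binary_form (N + 1 + 0) (\<lambda>s t. (\<Prod>i<k. fiber_eq A B (Q i) s t ^ n i) * h j s t)" if "j \<in> J" for j
    using binary_form_mult[OF _ J(3)[OF that]] by simp
  let ?p = "fiber_eq A B P" and ?G = "\<lambda>j s t. (\<Prod>i<k. fiber_eq A B (Q i) s t ^ n i) * h j s t"
  have top: "to_top A B R k n Q C = sections ?p 0 J D ?G"
    using J C fiber_eq_form by (intro to_top_sections) auto
  have "second_steps (N + 1) ?p (map g [0..<N]) (sections ?p 0 J D ?G) = sections ?p (0 + length (map g [0..<N])) J D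
      (\<lambda>j s t. ?G j s t - (\<Sum>i<length (map g [0..<N]). ?p s t ^ (0 + i) * (map g [0..<N] ! i) s t))"
  proof (rule second_steps_sections[OF J(1,2) fiber_eq_form])
    show "?G j s t \<noteq> ?p s t ^ 0 * hd (map g [0..<N]) s t"
      if "j \<in> J" "(s, t) \<in> D j" "(s, t) \<noteq> (0, 0)" "?p s t = 0" "map g [0..<N] \<noteq> []" for j s t
      using centre[OF that(1-4)] that(5) by (simp add: hd_map)
  qed (use g H in auto)
  then show ?thesis unfolding cremona_T_def N[symmetric] top by simp
qed

text \<open>Taking intersections is a bijection from the two-element subsets of \<open>Ls\<close> to
  the crossings. It is injective because a subset is recovered as the set of all lines through its
  point, of which there are at most two.\<close>

lemma card_crossings:
  assumes Ls: "finite Ls" "general_position Ls"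
    and meet: "\<And>l l'. l \<in> Ls \<Longrightarrow> l' \<in> Ls \<Longrightarrow> l \<noteq> l' \<Longrightarrow> \<exists>z. l \<inter> l' = pt z"
  shows "card (crossings Ls) = card Ls choose 2"
proof -
  have two: "\<exists>z. \<Inter>B = pt z" if B: "B \<subseteq> Ls" "card B = 2" for B
  proof -
    obtain l l' where "B = {l, l'}" "l \<noteq> l'" using B(2) by (auto simp: card_2_iff)
    then show ?thesis using meet[of l l'] B(1) by simp
  qed
  have pt: "pt z = pt w" if w: "w \<in> pt z" for w z
  proof -
    obtain c where "c \<noteq> 0" "w = c *s z" using w by (auto simp: pt_def)
    then show ?thesis by (simp add: pt_scale)
  qed
  have "crossings Ls = Inter ` {B. B \<subseteq> Ls \<and> card B = 2}"
  proof
    show "crossings Ls \<subseteq> Inter ` {B. B \<subseteq> Ls \<and> card B = 2}"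
    proof
      fix x assume "x \<in> crossings Ls"
      then obtain z l l' where z: "x = pt z" "l \<in> Ls" "l' \<in> Ls" "l \<noteq> l'" "z \<in> l \<inter> l'"
        by (auto simp: crossings_def)
      obtain w where w: "l \<inter> l' = pt w" using meet z by blast
      then have "x = \<Inter>{l, l'}" using z pt[of z w] by simp
      moreover have "{l, l'} \<in> {B. B \<subseteq> Ls \<and> card B = 2}" using z by auto
      ultimately show "x \<in> Inter ` {B. B \<subseteq> Ls \<and> card B = 2}" by blast
    qed
    show "Inter ` {B. B \<subseteq> Ls \<and> card B = 2} \<subseteq> crossings Ls"
    proof clarify
      fix B assume B: "B \<subseteq> Ls" "card B = 2"
      obtain l l' where l: "B = {l, l'}" "l \<noteq> l'" using B(2) by (auto simp: card_2_iff)
      obtain z where z: "\<Inter>B = pt z" using two[OF B] by auto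
      then have "z \<in> l \<inter> l'" using pt_self[of z] l(1) by auto
      moreover have "l \<in> Ls" "l' \<in> Ls" using l(1) B(1) by auto
      ultimately show "\<Inter>B \<in> crossings Ls" unfolding crossings_def z
        using l(2) by (intro CollectI exI[of _ z] conjI refl bexI[of _ l] bexI[of _ l'])
    qed
  qed
  moreover have "inj_on Inter {B. B \<subseteq> Ls \<and> card B = 2}"
  proof (rule inj_onI, clarify)
    fix B B' assume B: "B \<subseteq> Ls" "card B = 2" and B': "B' \<subseteq> Ls" "card B' = 2" and eq: "\<Inter>B = \<Inter>B'"
    obtain z where z: "\<Inter>B = pt z" using two[OF B] by auto
    let ?M = "{l \<in> Ls. z \<in> l}"
    have M: "finite ?M" "card ?M \<le> 2" using Ls by (auto simp: general_position_def)
    have "z \<in> \<Inter>B" "z \<in> \<Inter>B'" using z eq pt_self[of z] by auto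
    then have "B \<subseteq> ?M" "B' \<subseteq> ?M" using B(1) B'(1) by auto
    then have "B = ?M" "B' = ?M" using M B(2) B'(2) card_seteq[of ?M] by auto
    then show "B = B'" by simp
  qed
  ultimately show ?thesis using n_subsets[OF Ls(1), of 2] by (simp add: card_image)
qed

theorem proposition5p11:
  fixes Ls :: "(complex^3) set set"
    and m k N :: nat
    and n :: "nat \<Rightarrow> nat"
    and A B R P :: "complex^3"
    and Q :: "nat \<Rightarrow> complex^3"
    and g :: "nat \<Rightarrow> complex \<Rightarrow> complex \<Rightarrow> complex"
    and T :: "(complex^3) set \<Rightarrow> (complex^3) set"
  assumes lines: "\<And>l. l \<in> Ls \<Longrightarrow> is_line l"
    and card: "finite Ls" "card Ls = m" "1 \<le> m"
    and gen: "general_position Ls"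
    and k: "1 \<le> k" and n: "\<And>i. i < k \<Longrightarrow> 1 \<le> n i"
    and N: "N = (\<Sum>i<k. n i)"
    and frame: "det (vector [A, B, R] :: complex^3^3) \<noteq> 0"
    and R: "R \<notin> \<Union>Ls"
    and Q: "\<And>i. i < k \<Longrightarrow> Q i \<noteq> 0 \<and> R \<in> line (Q i) \<and> meets_transversally (line (Q i)) (\<Union>Ls)"
    and Q_distinct: "inj_on (\<lambda>i. line (Q i)) {..<k}"
    and P: "P \<noteq> 0" "R \<in> line P" "meets_transversally (line P) (\<Union>Ls)"
    and P_distinct: "\<And>i. i < k \<Longrightarrow> line P \<noteq> line (Q i)"
    and g: "\<And>j. j < N \<Longrightarrow> binary_form (N + 1 - j) (g j)"
    and centre: "\<And>s t u v. (s, t, u, v) \<in> to_top A B R k n Q (\<Union>Ls) \<Longrightarrow>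
                   \<not> (fiber_eq A B P s t = 0 \<and> u = g 0 s t * v)"
    and T: "T = cremona_T A B R k n Q P g"
  shows "\<exists>F. curve_equation (T (\<Union>Ls)) (m * (N + 1)) F \<and>
    inj_on T (crossings Ls) \<and> card (crossings Ls) = m choose 2 \<and>
    (\<forall>p\<in>T ` crossings Ls. has_at F p (tacnode 2 0) \<and> has_at F p (sing_type [2])) \<and>
    (\<exists>q r. inj_on q {..<k} \<and> r \<notin> q ` {..<k} \<and> (q ` {..<k} \<union> {r}) \<inter> T ` crossings Ls = {} \<and>
      (\<forall>i<k. has_at F (q i) (tacnode m (n i - 1))) \<and>
      has_at F r (blow_down_tacnode m (N - 1)) \<and>
      (2 \<le> m \<longrightarrow>
        (\<forall>i<k. has_at F (q i) (sing_type (replicate (n i) m))) \<and>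
        has_at F r (sing_type (m * N # replicate N m)) \<and>
        singular_points F = q ` {..<k} \<union> {r} \<union> T ` crossings Ls))"
proof -
  obtain L where L: "bij_betw L {..<m} Ls"
    using ex_bij_betw_nat_finite[OF card(1)] card(2) by (auto simp: atLeast0LessThan)
  have L_in: "L j \<in> Ls" if "j < m" for j using L that by (auto simp: bij_betw_def)
  have L_inj: "i = j" if "i < m" "j < m" "L i = L j" for i j
    using L that by (auto simp: bij_betw_def inj_on_def)
  have Un: "\<Union>Ls = (\<Union>j<m. L j)" using L by (auto simp: bij_betw_def)
  define e where "e s t u = s *s A + t *s B + u *s R" for s t u
  have e_surj: "\<exists>s t u. z = e s t u" for z unfolding e_def by (rule frame_coordinates[OF frame])
  have e_scale: "c *s e s t u = e (c * s) (c * t) (c * u)" for c s t u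
    by (simp add: e_def vector_add_ldistrib)
  have e_0: "e s t u = 0 \<longleftrightarrow> s = 0 \<and> t = 0 \<and> u = 0" for s t u
    using frame_independent[OF frame, of s t u] by (auto simp: e_def)
  have e_inj: "e s t u = e s' t' u' \<longleftrightarrow> s = s' \<and> t = t' \<and> u = u'" for s t u s' t' u'
  proof
    assume "e s t u = e s' t' u'"
    then have "e (s - s') (t - t') (u - u') = 0" by (simp add: e_def vec_eq_iff algebra_simps)
    then show "s = s' \<and> t = t' \<and> u = u'" by (simp add: e_0)
  qed simp
  have e_pairing: "pairing c (e s t u) = pairing c A * s + pairing c B * t + pairing c R * u" for c s t u
    by (simp add: e_def pairing_add pairing_scale mult.commute)
  have "\<forall>j. \<exists>a. j < m \<longrightarrow> a \<noteq> 0 \<and> L j = line a" using lines L_in unfolding is_line_def by blast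
  then obtain a where a: "\<And>j. j < m \<Longrightarrow> a j \<noteq> 0" "\<And>j. j < m \<Longrightarrow> L j = line (a j)" by metis
  have "R \<noteq> 0" using e_0[of 0 0 1] by (simp add: e_def)
  then have aR: "pairing (a j) R \<noteq> 0" if "j < m" for j
    using R L_in[OF that] a(2)[OF that] by (auto simp: line_def)
  \<comment> \<open>The equation of the line solved for the coordinate along \<open>R\<close>,
    possible because \<open>R\<close> is not on the line.\<close>
  define h where "h j s t = (- pairing (a j) A / pairing (a j) R) * s + (- pairing (a j) B / pairing (a j) R) * t"
    for j s t
  have h_form: "binary_form 1 (h j)" for j unfolding h_def[abs_def] by (rule binary_form_linear)
  have h_scale: "h j (c * s) (c * t) = c * h j s t" for j c s t
    using binary_form_homogeneous[OF h_form] by simp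
  have mem_L: "e s t u \<in> L j \<longleftrightarrow> (s, t) \<noteq> (0, 0) \<and> u = h j s t" if "j < m" for j s t u
  proof -
    define x where "x = pairing (a j) A * s + pairing (a j) B * t"
    have "h j s t = - x / pairing (a j) R" by (simp add: h_def x_def add_divide_distrib diff_divide_distrib)
    moreover have "x + pairing (a j) R * u = 0 \<longleftrightarrow> u = - x / pairing (a j) R"
      unfolding nonzero_eq_divide_eq[OF aR[OF that]] add_eq_0_iff[of x] by (simp add: mult.commute)
    ultimately have "pairing (a j) (e s t u) = 0 \<longleftrightarrow> u = h j s t" unfolding e_pairing x_def by simp
    moreover have "h j 0 0 = 0" by (simp add: h_def)
    ultimately show ?thesis using a(2)[OF that] by (auto simp: line_def e_0)
  qed
  have h_distinct: "\<exists>s t. h i s t \<noteq> h j s t" if ij: "i < m" "j < m" "i \<noteq> j" for i j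
  proof (rule ccontr)
    assume "\<not> ?thesis"
    then have "z \<in> L i \<longleftrightarrow> z \<in> L j" for z using e_surj[of z] mem_L[OF ij(1)] mem_L[OF ij(2)] by auto
    then show False using L_inj[OF ij(1,2)] ij(3) by blast
  qed
  have mem_fiber: "e s t u \<in> line c \<longleftrightarrow> (s, t, u) \<noteq> (0, 0, 0) \<and> fiber_eq A B c s t = 0" if "R \<in> line c" for c s t u
    using that by (auto simp: line_def e_0 e_pairing fiber_eq_linear)
  have fiber_nonzero: "\<exists>s t. fiber_eq A B c s t \<noteq> 0" if c: "c \<noteq> 0" "R \<in> line c" for c
  proof (rule ccontr)
    assume zero: "\<not> ?thesis"
    have "pairing c z = 0" for z
    proof -
      obtain s t u where "z = e s t u" using e_surj by blast
      then show ?thesis using zero c(2) by (simp add: e_pairing fiber_eq_linear line_def)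
    qed
    moreover have "pairing c (vec3 1 0 0) = c $ 1" "pairing c (vec3 0 1 0) = c $ 2" "pairing c (vec3 0 0 1) = c $ 3"
      by (simp_all add: pairing_def sum_3)
    ultimately show False using c(1) by (simp add: vec3_eq_iff)
  qed
  \<comment> \<open>A line through \<open>[R]\<close> is determined by one root of its fiber
    equation, since all nonzero roots are proportional.\<close>
  have same_line: "line c = line c'"
    if c: "c \<noteq> 0" "R \<in> line c" "c' \<noteq> 0" "R \<in> line c'"
      and st: "(s, t) \<noteq> (0, 0)" "fiber_eq A B c s t = 0" "fiber_eq A B c' s t = 0" for c c' s t
  proof -
    have le: "fiber_eq A B d' s' t' = 0"
      if d: "d \<noteq> 0" "R \<in> line d" "fiber_eq A B d s t = 0" "fiber_eq A B d' s t = 0" "fiber_eq A B d s' t' = 0" for d d' s' t'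
    proof (cases "(s', t') = (0, 0)")
      case True
      then show ?thesis by (simp add: fiber_eq_linear)
    next
      case False
      obtain x y where "fiber_eq A B d x y \<noteq> 0" using fiber_nonzero[OF d(1,2)] by blast
      then obtain r where "s' = r * s" "t' = r * t"
        using linear_form_roots_proportional[OF fiber_eq_form _ d(3,5) st(1) False] by blast
      then show ?thesis using binary_form_homogeneous[OF fiber_eq_form, of A B d' r s t] d(4) by simp
    qed
    have "z \<in> line c \<longleftrightarrow> z \<in> line c'" for z
    proof -
      obtain s' t' u where "z = e s' t' u" using e_surj by blast
      then show ?thesis using mem_fiber[OF c(2)] mem_fiber[OF c(4)] le[OF c(1,2) st(2,3)] le[OF c(3,4) st(3,2)] by auto
    qed
    then show ?thesis by blast
  qed
  have no_node: "i = j"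
    if c: "R \<in> line c" "meets_transversally (line c) (\<Union>Ls)" and ij: "i < m" "j < m"
      and st: "(s, t) \<noteq> (0, 0)" "fiber_eq A B c s t = 0" "h i s t = h j s t" for c i j s t
  proof (rule ccontr)
    assume "i \<noteq> j"
    \<comment> \<open>Supplies a vector on line \<open>i\<close> but not on line \<open>j\<close>,
      the direction needed to split a tangent vector at their crossing.\<close>
    then obtain s' t' where st': "h i s' t' \<noteq> h j s' t'" using h_distinct[OF ij] by blast
    then have nz: "(s', t') \<noteq> (0, 0)" by (auto simp: h_def)
    show False
    proof (rule not_transversal_at_crossing[OF c(2)])
      show "e s t (h i s t) \<in> line c" using mem_fiber[OF c(1)] st by auto
      show "e s t (h i s t) \<in> line (a i)" "e s t (h i s t) \<in> line (a j)"
        using mem_L ij st a(2) by auto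
      show "line (a i) \<subseteq> \<Union>Ls" "line (a j) \<subseteq> \<Union>Ls" using L_in ij a(2) by blast+
      show "pairing (a i) (e s' t' (h i s' t')) = 0" "pairing (a j) (e s' t' (h i s' t')) \<noteq> 0"
        using mem_L[OF ij(1), of s' t' "h i s' t'"] mem_L[OF ij(2), of s' t' "h i s' t'"] st' nz a(2) ij e_0
        by (auto simp: line_def)
    qed
  qed
  have no_triple: "i = j \<or> j = c \<or> i = c"
    if ijc: "i < m" "j < m" "c < m" and st: "(s, t) \<noteq> (0, 0)" "h i s t = h j s t" "h j s t = h c s t" for i j c s t
  proof (rule ccontr)
    assume "\<not> ?thesis"
    then have "L i \<noteq> L j" "L j \<noteq> L c" "L i \<noteq> L c" using L_inj ijc by blast+
    then have "card {L i, L j, L c} = 3" by simp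
    moreover have "{L i, L j, L c} \<subseteq> {l \<in> Ls. e s t (h i s t) \<in> l}"
      using mem_L ijc st L_in by auto
    then have "card {L i, L j, L c} \<le> card {l \<in> Ls. e s t (h i s t) \<in> l}"
      using card(1) by (intro card_mono) auto
    moreover have "card {l \<in> Ls. e s t (h i s t) \<in> l} \<le> 2" using gen by (simp add: general_position_def)
    ultimately show False by simp
  qed
  let ?l = "\<lambda>i. fiber_eq A B (Q i)" and ?p = "fiber_eq A B P"
  have blow_Un: "plane_blow_up A B R (\<Union>Ls) = sections ?p 0 {..<m} (\<lambda>_. UNIV) h"
  proof (rule plane_blow_up_sections[OF _ _ fiber_eq_form h_form])
    fix s t u v :: complex assume "(s, t) \<noteq> (0, 0)" "v \<noteq> 0"
    then have "e (v * s) (v * t) u \<in> \<Union>Ls \<longleftrightarrow> (\<exists>j\<in>{..<m}. u = v * h j s t)"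
      unfolding Un by (auto simp: mem_L h_scale)
    then show "(v * s) *s A + (v * t) *s B + u *s R \<in> \<Union>Ls \<longleftrightarrow> (\<exists>j\<in>{..<m}. (s, t) \<in> UNIV \<and> u = h j s t * v)"
      by (simp add: e_def mult.commute)
  qed (auto simp: cone_def)
  define K where "K s t = (\<Sum>i<N. ?p s t ^ i * g i s t)" for s t
  have "n 0 \<le> N" unfolding N using k by (intro member_le_sum) auto
  then have "0 < N" using n[of 0] k by simp
  have K_form: "binary_form (Suc N) K" unfolding K_def[abs_def]
  proof (rule binary_form_sum)
    fix i assume "i \<in> {..<N}"
    then show "binary_form (Suc N) (\<lambda>s t. ?p s t ^ i * g i s t)"
      using binary_form_mult[OF binary_form_power[OF fiber_eq_form, of i] g, of i A B P] by simp
  qed simp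
  \<comment> \<open>On the fiber of \<open>P\<close> only the term with exponent 0 survives, so the
    condition on \<open>K\<close> is the condition on the first centre.\<close>
  have K_root: "K s t = g 0 s t" if "?p s t = 0" for s t
  proof -
    have "K s t = (\<Sum>i<N. if i = 0 then g 0 s t else 0)" unfolding K_def that
      by (intro sum.cong) (auto simp: zero_power)
    then show ?thesis using \<open>0 < N\<close> by simp
  qed
  have top: "to_top A B R k n Q (\<Union>Ls) = sections ?p 0 {..<m} (\<lambda>_. UNIV) (\<lambda>j s t. (\<Prod>i<k. ?l i s t ^ n i) * h j s t)"
    by (rule to_top_sections[OF _ _ fiber_eq_form h_form blow_Un]) (auto simp: cone_def)
  \<comment> \<open>The hypothesis on the centre, applied to the point of the \<open>j\<close>-th
    section over this root in the normalization \<open>v = 1\<close>.\<close>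
  have avoid: "(\<Prod>i<k. ?l i s t ^ n i) * h j s t \<noteq> g 0 s t" if "j < m" "(s, t) \<noteq> (0, 0)" "?p s t = 0" for j s t
    using centre[of s t "(\<Prod>i<k. ?l i s t ^ n i) * h j s t" 1] that unfolding top
    by (auto simp: sections_def hcarrier_def)
  interpret twisted_lines m k N n h ?l ?p K
  proof
    show "\<exists>s t. ?l i s t \<noteq> 0" if "i < k" for i using fiber_nonzero Q[OF that] by blast
    show "\<exists>s t. ?p s t \<noteq> 0" using fiber_nonzero P by blast
    show "?p s t \<noteq> 0" if i: "i < k" "(s, t) \<noteq> (0, 0)" "?l i s t = 0" for i s t
      using same_line[OF P(1,2) _ _ i(2) _ i(3)] Q[OF i(1)] P_distinct[OF i(1)] by auto
    show "i = j" if "i < k" "j < k" "(s, t) \<noteq> (0, 0)" "?l i s t = 0" "?l j s t = 0" for i j s t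
      using same_line[of "Q i" "Q j" s t] Q[OF that(1)] Q[OF that(2)] that Q_distinct by (auto simp: inj_on_def)
    show "b = c" if "i < k" "b < m" "c < m" "(s, t) \<noteq> (0, 0)" "?l i s t = 0" "h b s t = h c s t" for i b c s t
      using no_node[of "Q i" b c s t] Q[OF that(1)] that by blast
    show "b = c" if "b < m" "c < m" "(s, t) \<noteq> (0, 0)" "?p s t = 0" "h b s t = h c s t" for b c s t
      using no_node[of P b c s t] P that by blast
    show "(\<Prod>i<k. ?l i s t ^ n i) * h j s t \<noteq> K s t" if "j < m" "(s, t) \<noteq> (0, 0)" "?p s t = 0" for j s t
      using avoid[OF that] K_root[OF that(3)] by simp
    show "b = c \<or> c = d \<or> b = d"
      if "b < m" "c < m" "d < m" "(s, t) \<noteq> (0, 0)" "h b s t = h c s t" "h c s t = h d s t" for b c d s t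
      using no_triple[OF that] .
  qed (rule h_form fiber_eq_form K_form card k N | erule n)+
  have T_sections: "T C = plane_blow_down (sections ?p N J D G)"
    if J: "finite J" "J \<subseteq> {..<m}" "\<And>j. j \<in> J \<Longrightarrow> cone (D j)" and C: "plane_blow_up A B R C = sections ?p 0 J D h" for C J D
  proof -
    have "T C = plane_blow_down (sections ?p N J D (\<lambda>j s t. (\<Prod>i<k. ?l i s t ^ n i) * h j s t - K s t))"
      unfolding T K_def using J avoid by (intro cremona_T_sections[OF J(1,3) h_form C N g]) auto
    then show ?thesis by (simp add: G_def[abs_def] H_def)
  qed
  have T_Un: "T (\<Union>Ls) = {z. z \<noteq> 0 \<and> F z = 0}"
  proof -
    \<comment> \<open>Both sides of a branch equation have positive degree in the first two
      coordinates, so the vertex is on the curve; it is the point that the blow-down contributes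
      from \<open>v = 0\<close>.\<close>
    have 1: "z $ 1 = 0 \<and> z $ 2 = 0 \<Longrightarrow> F z = 0" for z :: "complex^3"
      using card(3) \<open>0 < N\<close> binary_form_homogeneous[OF G_form, of 0 0 0 0]
      by (auto simp: F_zero_iff fiber_eq_linear intro!: exI[of _ 0])
    obtain s t where st: "(s, t) \<noteq> (0, 0)" "?p s t = 0" by (rule p_root)
    have "T (\<Union>Ls) = plane_blow_down (sections ?p N {..<m} (\<lambda>_. UNIV) G)"
      by (rule T_sections[OF _ _ _ blow_Un]) (auto simp: cone_def)
    also have "\<dots> = {z. (z $ 1, z $ 2) \<noteq> (0, 0) \<and> (\<exists>j\<in>{..<m}. (z $ 1, z $ 2) \<in> UNIV \<and> ?p (z $ 1) (z $ 2) ^ N * z $ 3 = G j (z $ 1) (z $ 2))} \<union>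
      {z. z \<noteq> 0 \<and> z $ 1 = 0 \<and> z $ 2 = 0 \<and> (\<exists>j\<in>{..<m}. \<exists>s t. (s, t) \<in> UNIV \<and> (s, t) \<noteq> (0, 0) \<and> ?p s t = 0)}"
      by (rule plane_blow_down_sections[OF _ fiber_eq_form G_form \<open>0 < N\<close> G_nonzero]) (auto simp: cone_def)
    also have "\<dots> = {z. z \<noteq> 0 \<and> F z = 0}"
    proof (intro set_eqI)
      fix z :: "complex^3"
      have "\<exists>j\<in>{..<m}. \<exists>s t. (s, t) \<in> UNIV \<and> (s, t) \<noteq> (0, 0) \<and> ?p s t = 0"
        using st card(3) by (intro bexI[of _ 0]) auto
      then show "z \<in> {z. (z $ 1, z $ 2) \<noteq> (0, 0) \<and> (\<exists>j\<in>{..<m}. (z $ 1, z $ 2) \<in> UNIV \<and> ?p (z $ 1) (z $ 2) ^ N * z $ 3 = G j (z $ 1) (z $ 2))} \<union>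
          {z. z \<noteq> 0 \<and> z $ 1 = 0 \<and> z $ 2 = 0 \<and> (\<exists>j\<in>{..<m}. \<exists>s t. (s, t) \<in> UNIV \<and> (s, t) \<noteq> (0, 0) \<and> ?p s t = 0)}
          \<longleftrightarrow> z \<in> {z. z \<noteq> 0 \<and> F z = 0}"
        using 1[of z] by (cases "(z $ 1, z $ 2) = (0, 0)") (auto simp: F_zero_iff)
    qed
    finally show ?thesis .
  qed
  have T_pt: "T (pt (e s t (h j s t))) = pt (vec3 s t (G j s t / ?p s t ^ N))"
    if j: "j < m" and st: "(s, t) \<noteq> (0, 0)" "?p s t \<noteq> 0" for j s t
  proof -
    \<comment> \<open>The line through the origin and \<open>(s, t)\<close>: a single point of the
      plane is the \<open>j\<close>-th section restricted to one fiber.\<close>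
    define D where "D = {x. fst x * t = s * snd x}"
    have D_iff: "(s', t') \<in> D \<longleftrightarrow> (\<exists>c. c \<noteq> 0 \<and> s' = c * s \<and> t' = c * t)" if nz: "(s', t') \<noteq> (0, 0)" for s' t'
    proof
      assume "(s', t') \<in> D"
      then have "s' * t = s * t'" by (simp add: D_def)
      then show "\<exists>c. c \<noteq> 0 \<and> s' = c * s \<and> t' = c * t"
      proof (cases "s = 0")
        case True
        then show ?thesis using nz st(1) \<open>s' * t = s * t'\<close> by (intro exI[of _ "t' / t"]) auto
      next
        case False
        then have "s' \<noteq> 0" using nz \<open>s' * t = s * t'\<close> by auto
        then show ?thesis using False \<open>s' * t = s * t'\<close> by (intro exI[of _ "s' / s"]) (simp add: field_simps)
      qed
    qed (auto simp: D_def)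
    have "closed D" unfolding D_def by (intro closed_Collect_eq continuous_intros)
    then have cone: "cone D" by (auto simp: cone_def D_def)
    have "plane_blow_up A B R (pt (e s t (h j s t))) = sections ?p 0 {j} (\<lambda>_. D) h"
    proof (rule plane_blow_up_sections[OF _ cone fiber_eq_form h_form])
      fix s' t' u v :: complex assume nz: "(s', t') \<noteq> (0, 0)" and v: "v \<noteq> 0"
      have "e (v * s') (v * t') u \<in> pt (e s t (h j s t)) \<longleftrightarrow> (s', t') \<in> D \<and> u = h j s' t' * v"
      proof
        assume "e (v * s') (v * t') u \<in> pt (e s t (h j s t))"
        then obtain c where c: "c \<noteq> 0" "v * s' = c * s" "v * t' = c * t" "u = c * h j s t"
          by (auto simp: pt_def e_scale e_inj)
        then have "s' = (c / v) * s" "t' = (c / v) * t" using v by (simp_all add: field_simps)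
        moreover from this have "u = h j s' t' * v" using c(4) v by (simp only: h_scale) (simp add: field_simps)
        ultimately show "(s', t') \<in> D \<and> u = h j s' t' * v" using D_iff[OF nz] c(1) v by (metis divide_eq_0_iff)
      next
        assume "(s', t') \<in> D \<and> u = h j s' t' * v"
        then obtain c where c: "c \<noteq> 0" "s' = c * s" "t' = c * t" "u = h j s' t' * v" using D_iff[OF nz] by blast
        then have "e (v * s') (v * t') u = (v * c) *s e s t (h j s t)" by (simp add: e_scale h_scale mult_ac)
        then show "e (v * s') (v * t') u \<in> pt (e s t (h j s t))" unfolding pt_def using c(1) v by auto
      qed
      then show "(v * s') *s A + (v * t') *s B + u *s R \<in> pt (e s t (h j s t)) \<longleftrightarrow>
          (\<exists>j\<in>{j}. (s', t') \<in> D \<and> u = h j s' t' * v)"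
        by (simp add: e_def)
    qed simp
    then have "T (pt (e s t (h j s t))) = plane_blow_down (sections ?p N {j} (\<lambda>_. D) G)"
      using j cone by (intro T_sections) auto
    also have "\<dots> = {z. (z $ 1, z $ 2) \<noteq> (0, 0) \<and> (\<exists>i\<in>{j}. (z $ 1, z $ 2) \<in> D \<and> ?p (z $ 1) (z $ 2) ^ N * z $ 3 = G i (z $ 1) (z $ 2))} \<union>
      {z. z \<noteq> 0 \<and> z $ 1 = 0 \<and> z $ 2 = 0 \<and> (\<exists>i\<in>{j}. \<exists>s t. (s, t) \<in> D \<and> (s, t) \<noteq> (0, 0) \<and> ?p s t = 0)}"
      by (rule plane_blow_down_sections[OF cone fiber_eq_form G_form \<open>0 < N\<close> G_nonzero]) (use j in auto)
    also have "\<dots> = pt (vec3 s t (G j s t / ?p s t ^ N))"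
    proof (intro set_eqI iffI)
      have p_scale: "?p (c * s) (c * t) = c * ?p s t" for c using binary_form_homogeneous[OF p(1)] by simp
      fix z :: "complex^3"
      {
        assume "z \<in> {z. (z $ 1, z $ 2) \<noteq> (0, 0) \<and> (\<exists>i\<in>{j}. (z $ 1, z $ 2) \<in> D \<and> ?p (z $ 1) (z $ 2) ^ N * z $ 3 = G i (z $ 1) (z $ 2))} \<union>
          {z. z \<noteq> 0 \<and> z $ 1 = 0 \<and> z $ 2 = 0 \<and> (\<exists>i\<in>{j}. \<exists>s t. (s, t) \<in> D \<and> (s, t) \<noteq> (0, 0) \<and> ?p s t = 0)}"
        \<comment> \<open>The fiber \<open>D\<close> is not that of \<open>P\<close>, so nothing is
          sent to the vertex and the image is a single point.\<close>
        moreover have "?p s' t' \<noteq> 0" if "(s', t') \<in> D" "(s', t') \<noteq> (0, 0)" for s' t'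
          using that D_iff[OF that(2)] st(2) p_scale by auto
        ultimately have z: "(z $ 1, z $ 2) \<noteq> (0, 0)" "(z $ 1, z $ 2) \<in> D" "?p (z $ 1) (z $ 2) ^ N * z $ 3 = G j (z $ 1) (z $ 2)"
          by auto
        obtain c where "c \<noteq> 0" "z $ 1 = c * s" "z $ 2 = c * t" using D_iff[OF z(1)] z(2) by blast
        then have "pt z = pt (vec3 s t (G j s t / ?p s t ^ N))"
          using st(2) G_form[OF j] z(3) by (intro pt_eq_scaled) auto
        then show "z \<in> pt (vec3 s t (G j s t / ?p s t ^ N))" using pt_self[of z] by simp
      next
        assume "z \<in> pt (vec3 s t (G j s t / ?p s t ^ N))"
        then obtain c where c: "c \<noteq> 0" "z $ 1 = c * s" "z $ 2 = c * t" "z $ 3 = c * (G j s t / ?p s t ^ N)"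
          by (auto simp: pt_def)
        have nz: "(z $ 1, z $ 2) \<noteq> (0, 0)" using c st(1) by auto
        moreover have "(z $ 1, z $ 2) \<in> D" using D_iff[OF nz] c(1-3) by blast
        moreover have "?p (z $ 1) (z $ 2) ^ N * z $ 3 = G j (z $ 1) (z $ 2)"
          unfolding c(2-4) p_scale binary_form_homogeneous[OF G_form[OF j]] using st(2)
          by (simp add: power_mult_distrib)
        ultimately show "z \<in> {z. (z $ 1, z $ 2) \<noteq> (0, 0) \<and> (\<exists>i\<in>{j}. (z $ 1, z $ 2) \<in> D \<and> ?p (z $ 1) (z $ 2) ^ N * z $ 3 = G i (z $ 1) (z $ 2))} \<union>
          {z. z \<noteq> 0 \<and> z $ 1 = 0 \<and> z $ 2 = 0 \<and> (\<exists>i\<in>{j}. \<exists>s t. (s, t) \<in> D \<and> (s, t) \<noteq> (0, 0) \<and> ?p s t = 0)}"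
          by blast
      }
    qed
    finally show ?thesis .
  qed
  have crossingE: "\<exists>i j s t. i < m \<and> j < m \<and> i \<noteq> j \<and> (s, t) \<noteq> (0, 0) \<and> h i s t = h j s t \<and> x = pt (e s t (h i s t))
      \<and> ?p s t \<noteq> 0 \<and> H s t \<noteq> 0 \<and> T x = pt (vec3 s t (G i s t / ?p s t ^ N))"
    if x: "x \<in> crossings Ls" for x
  proof -
    obtain z l l' where z: "x = pt z" "l \<in> Ls" "l' \<in> Ls" "l \<noteq> l'" "z \<in> l" "z \<in> l'"
      using x by (auto simp: crossings_def)
    obtain i j where ij: "i < m" "l = L i" "j < m" "l' = L j" using z(2,3) L by (auto simp: bij_betw_def)
    obtain s t u where e: "z = e s t u" using e_surj by blast
    have st: "(s, t) \<noteq> (0, 0)" "u = h i s t" "h i s t = h j s t"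
      using z(5,6) unfolding e ij using mem_L ij by auto
    have ne: "i \<noteq> j" using z(4) ij by blast
    have p0: "?p s t \<noteq> 0" using h_p[OF ij(1,3) st(1) _ st(3)] ne by blast
    have "H s t \<noteq> 0" using h_l[OF _ ij(1,3) st(1) _ st(3)] ne by (auto simp: H_eq_0_iff)
    then show ?thesis using ij st ne p0 T_pt[OF ij(1) st(1) p0] z(1) e by blast
  qed
  have T_crossings: "T ` crossings Ls = nodes"
  proof
    show "T ` crossings Ls \<subseteq> nodes"
    proof clarify
      fix x assume "x \<in> crossings Ls"
      then show "T x \<in> nodes" using crossingE[of x] unfolding nodes_def node_def by blast
    qed
    show "nodes \<subseteq> T ` crossings Ls"
    proof
      fix x assume "x \<in> nodes"
      then obtain i j s t where *: "i < m" "j < m" "i \<noteq> j" "(s, t) \<noteq> (0, 0)" "h i s t = h j s t"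
        "x = pt (vec3 s t (G i s t / ?p s t ^ N))" "?p s t \<noteq> 0" by (rule nodesE)
      have "e s t (h i s t) \<in> L i \<inter> L j" using mem_L * by auto
      moreover have "L i \<noteq> L j" using L_inj * by blast
      ultimately have "pt (e s t (h i s t)) \<in> crossings Ls"
        unfolding crossings_def using L_in *(1,2) by blast
      then show "x \<in> T ` crossings Ls" using T_pt[OF *(1,4,7)] *(6) by blast
    qed
  qed
  have inj: "inj_on T (crossings Ls)"
  proof (rule inj_onI)
    fix x y assume xy: "x \<in> crossings Ls" "y \<in> crossings Ls" "T x = T y"
    obtain i s t where x: "i < m" "x = pt (e s t (h i s t))" "?p s t \<noteq> 0" "H s t \<noteq> 0"
      "T x = pt (vec3 s t (G i s t / ?p s t ^ N))" using crossingE[OF xy(1)] by blast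
    obtain j s' t' where y: "j < m" "y = pt (e s' t' (h j s' t'))" "?p s' t' \<noteq> 0" "H s' t' \<noteq> 0"
      "T y = pt (vec3 s' t' (G j s' t' / ?p s' t' ^ N))" using crossingE[OF xy(2)] by blast
    obtain c where c: "c \<noteq> 0" "vec3 s t (G i s t / ?p s t ^ N) = c *s vec3 s' t' (G j s' t' / ?p s' t' ^ N)"
      using x(5) y(5) xy(3) pt_eqE by metis
    have st: "s = c * s'" "t = c * t'" and G: "G i s t / ?p s t ^ N = c * (G j s' t' / ?p s' t' ^ N)"
      using arg_cong[OF c(2), of "\<lambda>z :: complex^3. z $ 1"] arg_cong[OF c(2), of "\<lambda>z :: complex^3. z $ 2"]
        arg_cong[OF c(2), of "\<lambda>z :: complex^3. z $ 3"] by (simp_all only: vector_smult_component vector_3)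
    have "?p s t ^ N = c ^ N * ?p s' t' ^ N" "G i s t = c ^ Suc N * G i s' t'"
      unfolding st binary_form_homogeneous[OF p(1)] binary_form_homogeneous[OF G_form[OF x(1)]]
      by (simp_all add: power_mult_distrib)
    \<comment> \<open>Equal images lie over proportional base points at equal height. Dividing out
      \<open>H\<close>, nonzero at crossings, recovers equality of the original heights.\<close>
    then have "G i s' t' = G j s' t'" using G c(1) y(3) by (simp add: field_simps)
    then have "h i s' t' = h j s' t'" using y(4) by (simp add: G_def)
    then have "e s t (h i s t) = c *s e s' t' (h j s' t')" by (simp add: e_scale st h_scale)
    then show "x = y" unfolding x(2) y(2) by (simp add: pt_scale[OF c(1)])
  qed
  have count: "card (crossings Ls) = m choose 2"
    unfolding card(2)[symmetric]
  proof (rule card_crossings[OF card(1) gen])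
    fix l l' assume l: "l \<in> Ls" "l' \<in> Ls" "l \<noteq> l'"
    obtain i j where ij: "i < m" "l = L i" "j < m" "l' = L j" using l(1,2) L by (auto simp: bij_betw_def)
    have ne: "i \<noteq> j" using l(3) ij by blast
    note d = h_diff[OF ij(1,3) ne]
    obtain s t where st: "(s, t) \<noteq> (0, 0)" "h j s t - h i s t = 0" by (rule linear_form_root[OF d(1)])
    obtain x y where "h j x y - h i x y \<noteq> 0" using d(2) by blast
    note scaled = linear_form_roots_proportional[OF d(1) this st(2) _ st(1)]
    have "z \<in> L i \<inter> L j \<longleftrightarrow> z \<in> pt (e s t (h i s t))" for z
    proof
      assume z: "z \<in> L i \<inter> L j"
      obtain s' t' u where e: "z = e s' t' u" using e_surj by blast
      have st': "(s', t') \<noteq> (0, 0)" "u = h i s' t'" "h j s' t' - h i s' t' = 0"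
        using z mem_L[OF ij(1)] mem_L[OF ij(3)] unfolding e by auto
      obtain c where "c \<noteq> 0" "s' = c * s" "t' = c * t" using scaled[OF st'(3,1)] by blast
      then show "z \<in> pt (e s t (h i s t))" unfolding pt_def e st'(2) by (auto simp: e_scale h_scale)
    next
      assume "z \<in> pt (e s t (h i s t))"
      then obtain c where "c \<noteq> 0" "z = e (c * s) (c * t) (c * h i s t)" by (auto simp: pt_def e_scale)
      then show "z \<in> L i \<inter> L j" using st mem_L[OF ij(1)] mem_L[OF ij(3)] by (auto simp: h_scale)
    qed
    then show "\<exists>z. l \<inter> l' = pt z" unfolding ij by blast
  qed
  have "curve_equation (T (\<Union>Ls)) (m * (N + 1)) F"
    unfolding curve_equation_def T_Un using squarefree_F by simp
  then show ?thesis
    using inj count has_at_nodes singular_points_distinct has_at_tac has_at_vertex singular_points_F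
    unfolding T_crossings
    by (intro exI[of _ F] conjI exI[of _ tac] exI[of _ vertex] ballI allI impI) (auto simp: vertex_def)
qed

end
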